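(* Let $P=[v_1,\dots,v_n]\subset\mathbb{R}^3$ with $n\ge 6$ be a space polygon, let $T^+$ be its number of pairs of parallel vertices with the same orientation and $F$ its number of flattenings. Then $2T^++F\ge 4$.
   Context: A space polygon $P=[v_1,\dots,v_n]$ is a closed polygonal line in $\mathbb{R}^3$ (indices mod $n$). Its tangent indicatrix is the spherical polygon $Q=[u_1,\dots,u_n]$ with $u_i=(v_{i+1}-v_i)/|v_{i+1}-v_i|$, whose edges are the minimal great-circle arcs from $u_i$ to $u_{i+1}$; standing assumption: no three of the $u_i$ are coplanar (through the origin). A flattening of $P$ is a triple $\{v_i,v_{i+1},v_{i+2}\}$ such that $v_{i-1}$ and $v_{i+3}$ lie on the same side of the plane through $v_i,v_{i+1},v_{i+2}$. A pair of vertices $v_i,v_j$ is a pair of parallel vertices with the same orientation if the spherical edges $u_{i-1}u_i$ and $u_{j-1}u_j$ of $Q$ intersect. *)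

theory Defs
  imports "HOL-Analysis.Analysis"
begin

text \<open>A space polygon with n vertices is given by v :: nat => real^3, using only
  the values v 0, ..., v (n-1); all indices are taken mod n.\<close>

definition vtx :: "(nat \<Rightarrow> real^3) \<Rightarrow> nat \<Rightarrow> int \<Rightarrow> real^3" where
  "vtx v n i = v (nat (i mod int n))"

definition tang :: "(nat \<Rightarrow> real^3) \<Rightarrow> nat \<Rightarrow> int \<Rightarrow> real^3" where
  "tang v n i = sgn (vtx v n (i + 1) - vtx v n i)"

text \<open>Minimal great-circle arc between two (non-antipodal) unit vectors.\<close>
definition sph_arc :: "real^3 \<Rightarrow> real^3 \<Rightarrow> (real^3) set" where
  "sph_arc a b = (\<lambda>t. sgn ((1 - t) *\<^sub>R a + t *\<^sub>R b)) ` {0..1}"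

text \<open>Standing assumptions: consecutive vertices distinct (so u_i is defined) and
  no three of the u_i are coplanar with the origin.\<close>
definition admissible_polygon :: "(nat \<Rightarrow> real^3) \<Rightarrow> nat \<Rightarrow> bool" where
  "admissible_polygon v n \<longleftrightarrow>
     (\<forall>i<n. vtx v n (int i + 1) \<noteq> vtx v n (int i)) \<and>
     (\<forall>i<n. \<forall>j<n. \<forall>k<n. i \<noteq> j \<and> j \<noteq> k \<and> i \<noteq> k \<longrightarrow>
        \<not> coplanar {0, tang v n (int i), tang v n (int j), tang v n (int k)})"

definition flattening :: "(nat \<Rightarrow> real^3) \<Rightarrow> nat \<Rightarrow> int \<Rightarrow> bool" where
  "flattening v n i \<longleftrightarrow>
     (let N = cross3 (vtx v n (i + 1) - vtx v n i) (vtx v n (i + 2) - vtx v n i)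
      in (N \<bullet> (vtx v n (i - 1) - vtx v n i)) * (N \<bullet> (vtx v n (i + 3) - vtx v n i)) > 0)"

definition num_flattenings :: "(nat \<Rightarrow> real^3) \<Rightarrow> nat \<Rightarrow> nat" where
  "num_flattenings v n = card {i. i < n \<and> flattening v n (int i)}"

text \<open>Vertices v_i, v_j (distinct, with non-adjacent spherical edges) form a pair of
  parallel vertices with the same orientation if the spherical edges u_{i-1}u_i and
  u_{j-1}u_j of the tangent indicatrix intersect.\<close>
definition parallel_same_orient :: "(nat \<Rightarrow> real^3) \<Rightarrow> nat \<Rightarrow> nat \<Rightarrow> nat \<Rightarrow> bool" where
  "parallel_same_orient v n i j \<longleftrightarrow>
     sph_arc (tang v n (int i - 1)) (tang v n (int i)) \<inter>
     sph_arc (tang v n (int j - 1)) (tang v n (int j)) \<noteq> {}"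

definition T_plus :: "(nat \<Rightarrow> real^3) \<Rightarrow> nat \<Rightarrow> nat" where
  "T_plus v n = card {(i, j). i < j \<and> j < n \<and> j \<noteq> i + 1 \<and> \<not> (i = 0 \<and> j = n - 1)
                       \<and> parallel_same_orient v n i j}"

end

theory Submission
  imports Defs
begin

text \<open>
  Since the edges of P sum to zero, the tangent indicatrix lies in no open hemisphere. Its
  self-crossings (D of them) give parallel vertices and the changes of its turning direction
  (I of them) give flattenings, so it suffices that a spherical polygon in general position with
  2 D + I at most 3 lies in an open hemisphere.

  D = 0. Take a counterexample with the fewest vertices. By Helly's theorem some vertex m can be
  dropped without the rest becoming hemispheric, say a left turn. Its triangle with its two
  neighbours is not empty: otherwise m could be cut off. The vertex k of the triangle farthest
  from its opposite side is a right turn, and the chord from m to k splits the polygon into two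
  smaller ones. They are hemispheric by minimality, and their hulls turn left, as otherwise one of them would contain
  the other in its hull. So each has a left-turning ear away from the chord, which is an ear of
  the whole polygon. The vertex k can be dropped as well, since it lies inside a triangle of other
  vertices, so by symmetry there is a right-turning ear f. No ear can be dropped, by minimality.
  Let e be a left-turning ear not adjacent to f. Without e the polygon is hemispheric, f is a
  vertex of its hull and e is outside the hull and on the right side, so f is a left turn: a
  contradiction.

  D = 1 and I = 0. Of the two loops at the crossing one turns right there and left everywhere
  else. By the first case it is hemispheric; its hull turns left, and the other loop lies on its
  left side, hence in the same hemisphere.
\<close>

section \<open>Orientation and crossing of great-circle arcs\<close>

text \<open>Crossings, sides and containment are Boolean combinations of signs of determinants. The
  Jordan curve theorem enters only as a parity count, which comes down to the Grassmann-Pluecker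
  relation for five vectors. The price is that every auxiliary point must be in general position,
  hence the repeated passage to generic points. The number of changes of turn around a cycle is
  even, so 2 D + I \<le> 3 leaves only D = 0 with I \<le> 2 and D = 1 with I = 0. If I \<le> 2, the
  left turns form one cyclic interval, and this survives the induction: cutting off a left-turning
  ear can make a right turn into a left one only next to the gap, and a chord from a left turn to a
  right turn cuts both intervals once. Helly's theorem for half-spaces of three-space concerns
  families of four, so it is applied to at least five vertices; four vertices need an argument of
  their own.\<close>

definition det3 :: "real^3 \<Rightarrow> real^3 \<Rightarrow> real^3 \<Rightarrow> real" where
  "det3 a b c = cross3 a b \<bullet> c"

lemma det3_expand: "det3 a b c =
   (a$2 * b$3 - a$3 * b$2) * c$1 + (a$3 * b$1 - a$1 * b$3) * c$2 + (a$1 * b$2 - a$2 * b$1) * c$3"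
  by (simp add: det3_def cross3_def inner_vec_def sum_3)

lemma det3_cyc: "det3 b c a = det3 a b c"
  by (simp add: det3_expand algebra_simps)

lemma det3_swap: "det3 b a c = - det3 a b c"
  by (simp add: det3_expand algebra_simps)

lemma det3_add: "det3 (x + y) b c = det3 x b c + det3 y b c"
  by (simp add: det3_expand algebra_simps)

lemma det3_scale: "det3 (r *\<^sub>R x) b c = r * det3 x b c"
  by (simp add: det3_expand algebra_simps)

lemma det3_same [simp]: "det3 a a c = 0" "det3 a c c = 0" "det3 a c a = 0"
  by (simp_all add: det3_expand algebra_simps)

lemma det3_neg: "det3 (-a) (-b) (-c) = - det3 a b c"
  by (simp add: det3_expand algebra_simps)

lemma cramer: "det3 a b c *\<^sub>R w = det3 w b c *\<^sub>R a + det3 a w c *\<^sub>R b + det3 a b w *\<^sub>R c"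
  by (simp add: vec_eq_iff forall_3 det3_expand algebra_simps)

text \<open>Modulo \<open>a\<close> this is the Pluecker relation between the 2 by 2 minors of four
  vectors in a plane.\<close>

lemma grassmann_pluecker:
  "det3 a b c * det3 a d e - det3 a b d * det3 a c e + det3 a b e * det3 a c d = 0"
  by (simp add: det3_expand algebra_simps)

text \<open>For sets of at least three elements this also excludes the zero vector and antipodal
  pairs.\<close>

definition generic :: "(real^3) set \<Rightarrow> bool" where
  "generic S \<longleftrightarrow> (\<forall>a\<in>S. \<forall>b\<in>S. \<forall>c\<in>S. a \<noteq> b \<and> b \<noteq> c \<and> a \<noteq> c \<longrightarrow> det3 a b c \<noteq> 0)"

definition ccw :: "real^3 \<Rightarrow> real^3 \<Rightarrow> real^3 \<Rightarrow> bool" where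
  "ccw a b c \<longleftrightarrow> det3 a b c > 0"

lemma generic_subset: "generic S \<Longrightarrow> T \<subseteq> S \<Longrightarrow> generic T"
  unfolding generic_def by blast

lemma generic_det3: "generic S \<Longrightarrow> a \<in> S \<Longrightarrow> b \<in> S \<Longrightarrow> c \<in> S \<Longrightarrow> a \<noteq> b \<Longrightarrow> b \<noteq> c \<Longrightarrow> a \<noteq> c \<Longrightarrow> det3 a b c \<noteq> 0"
  unfolding generic_def by blast

lemma ccw_cyc: "ccw b c a = ccw a b c" "ccw c a b = ccw a b c"
  by (simp_all add: ccw_def det3_cyc det3_cyc[symmetric])

lemma ccw_same [simp]: "\<not> ccw a a c" "\<not> ccw a c c" "\<not> ccw a c a"
  by (simp_all add: ccw_def)

lemma ccw_swap:
  assumes "generic S" "a \<in> S" "b \<in> S" "c \<in> S" "a \<noteq> b" "b \<noteq> c" "a \<noteq> c"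
  shows "ccw b a c = (\<not> ccw a b c)" "ccw a c b = (\<not> ccw a b c)" "ccw c b a = (\<not> ccw a b c)"
proof -
  have "det3 a b c \<noteq> 0" using assms generic_det3 by blast
  moreover have "det3 b a c = - det3 a b c" "det3 a c b = - det3 a b c" "det3 c b a = - det3 a b c"
    by (simp_all add: det3_expand algebra_simps)
  ultimately show "ccw b a c = (\<not> ccw a b c)" "ccw a c b = (\<not> ccw a b c)" "ccw c b a = (\<not> ccw a b c)"
    by (auto simp: ccw_def)
qed

text \<open>Three nonzero numbers with sum zero do not all have the same sign: the first part
  excludes all positive, the second all negative.\<close>

lemma ccw_grassmann_pluecker:
  assumes g: "generic S" and "a \<in> S" "b \<in> S" "c \<in> S" "d \<in> S" "e \<in> S" "distinct [a,b,c,d,e]"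
  shows "\<not> ((ccw a b c = ccw a d e) \<and> (ccw a b d \<noteq> ccw a c e) \<and> (ccw a b e = ccw a c d))"
    "(ccw a b c = ccw a d e) \<or> (ccw a b d \<noteq> ccw a c e) \<or> (ccw a b e = ccw a c d)"
proof -
  have nz: "det3 a b c \<noteq> 0" "det3 a d e \<noteq> 0" "det3 a b d \<noteq> 0" "det3 a c e \<noteq> 0" "det3 a b e \<noteq> 0" "det3 a c d \<noteq> 0"
    using assms generic_det3[OF g] by auto
  have pos: "(0 < x * y) = ((0 < x) = (0 < y))" if "x \<noteq> 0" "y \<noteq> 0" for x y :: real
    using that by (auto simp: zero_less_mult_iff)
  have gp: "det3 a b c * det3 a d e - det3 a b d * det3 a c e + det3 a b e * det3 a c d = 0"
    by (rule grassmann_pluecker)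
  have m: "det3 a b c * det3 a d e \<noteq> 0" "det3 a b d * det3 a c e \<noteq> 0" "det3 a b e * det3 a c d \<noteq> 0"
    using nz by auto
  show "\<not> ((ccw a b c = ccw a d e) \<and> (ccw a b d \<noteq> ccw a c e) \<and> (ccw a b e = ccw a c d))"
    unfolding ccw_def using gp m nz
    by (smt (verit) pos)
  show "(ccw a b c = ccw a d e) \<or> (ccw a b d \<noteq> ccw a c e) \<or> (ccw a b e = ccw a c d)"
    unfolding ccw_def using gp m nz
    by (smt (verit) pos)
qed

text \<open>Equivalent to p a + q b = r c + t d for some positive p, q, r, t.\<close>

definition crosses :: "real^3 \<Rightarrow> real^3 \<Rightarrow> real^3 \<Rightarrow> real^3 \<Rightarrow> bool" where
  "crosses a b c d \<longleftrightarrow> distinct [a,b,c,d] \<and>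
     (ccw b c d \<noteq> ccw a c d) \<and> (ccw a b d \<noteq> ccw a b c) \<and> (ccw b c d \<noteq> ccw a b d)"

text \<open>By Cramer's rule, \<open>w\<close> has positive coordinates with respect to
  \<open>a\<close>, \<open>b\<close>, \<open>c\<close>, whichever way the triangle is
  oriented.\<close>

definition in_tri :: "real^3 \<Rightarrow> real^3 \<Rightarrow> real^3 \<Rightarrow> real^3 \<Rightarrow> bool" where
  "in_tri a b c w \<longleftrightarrow> ccw w b c = ccw a b c \<and> ccw a w c = ccw a b c \<and> ccw a b w = ccw a b c"

text \<open>\<open>b\<close> lies in the lune with corners \<open>p\<close> and \<open>-p\<close>
  whose sides pass through \<open>x\<close> and \<open>y\<close>.\<close>

definition sector :: "real^3 \<Rightarrow> real^3 \<Rightarrow> real^3 \<Rightarrow> real^3 \<Rightarrow> bool" where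
  "sector p x y b \<longleftrightarrow> ccw p x b = ccw p x y \<and> ccw p b y = ccw p x y"

text \<open>x is seen from p in the sector to the left of the path a, p, b; the sector is convex at left turns only.\<close>

definition left_of :: "real^3 \<Rightarrow> real^3 \<Rightarrow> real^3 \<Rightarrow> real^3 \<Rightarrow> bool" where
  "left_of a p b x \<longleftrightarrow> (if ccw a p b then ccw p b x \<and> ccw a p x else ccw p b x \<or> ccw a p x)"

lemma crosses_sym:
  assumes g: "generic S" and S: "a \<in> S" "b \<in> S" "c \<in> S" "d \<in> S"
  shows "crosses b a c d = crosses a b c d" "crosses a b d c = crosses a b c d" "crosses c d a b = crosses a b c d"
proof -
  { assume d: "distinct [a,b,c,d]"
    note s = ccw_swap[OF g]
    have e: "ccw b a d = (\<not> ccw a b d)" "ccw b a c = (\<not> ccw a b c)" "ccw b d c = (\<not> ccw b c d)"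
        "ccw a d c = (\<not> ccw a c d)" "ccw c d a = ccw a c d" "ccw d a b = ccw a b d"
        "ccw c a b = ccw a b c" "ccw c d b = ccw b c d"
      using s[of a b d] s[of a b c] s[of b c d] s[of a c d] d S ccw_cyc by auto
    have "crosses b a c d = crosses a b c d \<and> crosses a b d c = crosses a b c d \<and> crosses c d a b = crosses a b c d"
      using d unfolding crosses_def e by auto }
  then show "crosses b a c d = crosses a b c d" "crosses a b d c = crosses a b c d" "crosses c d a b = crosses a b c d"
    by (auto simp: crosses_def)
qed

text \<open>The side \<open>yz\<close> divides the lune at \<open>x\<close> into the triangle and
  the part beyond it; a point beyond is seen from \<open>x\<close> across \<open>yz\<close>.\<close>

lemma crosses_corner:
  assumes "generic S" "x \<in> S" "y \<in> S" "z \<in> S" "b \<in> S" "distinct [x,y,z,b]"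
  shows "(crosses x b y z \<noteq> in_tri x y z b) = sector x y z b"
proof -
  note s = ccw_swap[OF assms(1)]
  have c: "ccw y z b = ccw b y z" by (auto simp: ccw_cyc)
  have e: "ccw x b y = (\<not> ccw x y b)" "ccw x b z = (\<not> ccw x z b)"
    using s[of x y b] s[of x z b] assms by auto
  show ?thesis
    using assms(6) unfolding crosses_def in_tri_def sector_def c e by auto
qed

text \<open>The Jordan curve theorem for a triangle and one arc, on which all later parities rest.
  It is a propositional consequence of the Grassmann-Pluecker sign conditions, taken once with each
  of the five points as base.\<close>

lemma parity_triangle:
  assumes g: "generic S" and S: "a \<in> S" "b \<in> S" "x \<in> S" "y \<in> S" "z \<in> S" and d: "distinct [a,b,x,y,z]"
  shows "(((crosses a b x y \<noteq> crosses a b y z) \<noteq> crosses a b z x) = (in_tri x y z a \<noteq> in_tri x y z b))"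
proof -
  note s = ccw_swap[OF g]
  have e: "ccw b z x = (\<not> ccw b x z)" "ccw a z x = (\<not> ccw a x z)" "ccw x a z = (\<not> ccw a x z)"
    "ccw x y a = ccw a x y" "ccw x y b = ccw b x y" "ccw x b z = (\<not> ccw b x z)"
    using s[of a x z] s[of b x z] S d ccw_cyc by auto
  have f: "ccw b a x = (\<not> ccw a b x)" "ccw b a y = (\<not> ccw a b y)" "ccw b a z = (\<not> ccw a b z)"
    "ccw x a b = ccw a b x" "ccw x a y = (\<not> ccw a x y)" "ccw x b y = (\<not> ccw b x y)"
    "ccw y a b = ccw a b y" "ccw y x z = (\<not> ccw x y z)" "ccw y a x = ccw a x y" "ccw y b z = (\<not> ccw b y z)"
    "ccw y a z = (\<not> ccw a y z)" "ccw y b x = ccw b x y"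
    "ccw z a b = ccw a b z" "ccw z x y = ccw x y z" "ccw z a x = ccw a x z" "ccw z b y = ccw b y z"
    "ccw z a y = ccw a y z" "ccw z b x = ccw b x z"
    using s[of a b x] s[of a b y] s[of a b z] s[of a x y] s[of b x y] s[of x y z] s[of b y z] s[of a y z] S d ccw_cyc by auto
  note gp = ccw_grassmann_pluecker[OF g]
  have ds: "distinct [b,a,x,y,z]" "distinct [x,a,b,y,z]" "distinct [y,a,b,x,z]" "distinct [z,a,b,x,y]"
    using d by auto
  have rel: "a \<noteq> b" "a \<noteq> x" "a \<noteq> y" "a \<noteq> z" "b \<noteq> x" "b \<noteq> y" "b \<noteq> z" "x \<noteq> y" "x \<noteq> z" "y \<noteq> z" "z \<noteq> x"
    using d by auto
  have X: "crosses a b x y = ((ccw b x y \<noteq> ccw a x y) \<and> (ccw a b y \<noteq> ccw a b x) \<and> (ccw b x y \<noteq> ccw a b y))"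
    "crosses a b y z = ((ccw b y z \<noteq> ccw a y z) \<and> (ccw a b z \<noteq> ccw a b y) \<and> (ccw b y z \<noteq> ccw a b z))"
    "crosses a b z x = ((ccw b z x \<noteq> ccw a z x) \<and> (ccw a b x \<noteq> ccw a b z) \<and> (ccw b z x \<noteq> ccw a b x))"
    using rel by (auto simp: crosses_def)
  note gps = gp[OF S(1,2,3,4,5) d] gp[OF S(2,1,3,4,5) ds(1)] gp[OF S(3,1,2,4,5) ds(2)]
    gp[OF S(4,1,2,3,5) ds(3)] gp[OF S(5,1,2,3,4) ds(4)]
  show ?thesis
    using gps unfolding X in_tri_def e f by argo
qed

lemma det3_cong_comb:
  assumes "p *\<^sub>R a + q *\<^sub>R b = r *\<^sub>R c + t *\<^sub>R d"
  shows "p * det3 a x y + q * det3 b x y = r * det3 c x y + t * det3 d x y"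
  using arg_cong[OF assms, of "\<lambda>v. det3 v x y"] by (simp add: det3_add det3_scale)

text \<open>The coefficients are those of the linear relation between four vectors of three-space.
  \<open>crosses\<close> determines their signs up to a common one, hence the two cases.\<close>

lemma crosses_elim:
  assumes g: "generic S" and S: "a \<in> S" "b \<in> S" "c \<in> S" "d \<in> S" and X: "crosses a b c d"
  obtains p q r t where "p > 0" "q > 0" "r > 0" "t > 0" "p *\<^sub>R a + q *\<^sub>R b = r *\<^sub>R c + t *\<^sub>R d"
proof -
  have dist: "distinct [a,b,c,d]" using X by (auto simp: crosses_def)
  have nz: "det3 b c d \<noteq> 0" "det3 a c d \<noteq> 0" "det3 a b d \<noteq> 0" "det3 a b c \<noteq> 0"
    using generic_det3[OF g] S dist by auto
  have id: "det3 b c d *\<^sub>R a + (- det3 a c d) *\<^sub>R b = (- det3 a b d) *\<^sub>R c + det3 a b c *\<^sub>R d"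
    by (simp add: vec_eq_iff forall_3 det3_expand algebra_simps)
  consider "det3 b c d > 0" "det3 a c d < 0" "det3 a b d < 0" "det3 a b c > 0"
    | "det3 b c d < 0" "det3 a c d > 0" "det3 a b d > 0" "det3 a b c < 0"
    using X nz unfolding crosses_def ccw_def by (smt (verit))
  then show thesis
  proof cases
    case 1
    then show thesis using that[of "det3 b c d" "- det3 a c d" "- det3 a b d" "det3 a b c"] id by auto
  next
    case 2
    have "(- det3 b c d) *\<^sub>R a + det3 a c d *\<^sub>R b = det3 a b d *\<^sub>R c + (- det3 a b c) *\<^sub>R d"
      using arg_cong[OF id, of "\<lambda>v. - v"] by (simp add: algebra_simps)
    then show thesis using that[of "- det3 b c d" "det3 a c d" "det3 a b d" "- det3 a b c"] 2 by auto
  qed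
qed

lemma crosses_intro:
  assumes g: "generic S" and S: "a \<in> S" "b \<in> S" "c \<in> S" "d \<in> S"
    and ne: "a \<notin> {c, d}" "c \<noteq> d" "a \<noteq> b"
    and pos: "p > 0" "q > 0" "r > 0" "t > 0" and eq: "p *\<^sub>R a + q *\<^sub>R b = r *\<^sub>R c + t *\<^sub>R d"
  shows "crosses a b c d"
proof -
  have acd: "det3 a c d \<noteq> 0" using generic_det3[OF g] S ne by auto
  have e1: "p * det3 a c d + q * det3 b c d = 0"
    using det3_cong_comb[OF eq, of c d] by (simp add: det3_expand)
  \<comment> \<open>If \<open>b\<close> were \<open>c\<close> or \<open>d\<close>, the second term
    of \<open>e1\<close> would vanish and with it the nonzero first one.\<close>
  have ne2: "b \<noteq> c" "b \<noteq> d"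
    using e1 acd pos by auto
  have nz: "det3 b c d \<noteq> 0" "det3 a b d \<noteq> 0" "det3 a b c \<noteq> 0"
    using generic_det3[OF g] S ne ne2 by auto
  have e2: "r * det3 c a b + t * det3 d a b = 0"
    using det3_cong_comb[OF eq, of a b] by simp
  have e3: "p * det3 a d b = r * det3 c d b"
    using det3_cong_comb[OF eq, of d b] by simp
  have c: "det3 c a b = det3 a b c" "det3 d a b = det3 a b d" "det3 a d b = - det3 a b d" "det3 c d b = det3 b c d"
    using det3_cyc det3_swap by (metis, metis, metis, metis)
  have 1: "(det3 b c d > 0) \<noteq> (det3 a c d > 0)"
    using e1 pos nz acd
    by (smt (verit) mult_pos_pos mult_less_0_iff)
  have 2: "(det3 a b d > 0) \<noteq> (det3 a b c > 0)"
    using e2 pos nz unfolding c by (smt (verit) mult_pos_pos mult_less_0_iff)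
  have 3: "(det3 b c d > 0) \<noteq> (det3 a b d > 0)"
    using e3 pos nz unfolding c by (smt (verit) mult_pos_pos mult_less_0_iff minus_mult_right)
  show ?thesis using 1 2 3 ne ne2 by (auto simp: crosses_def ccw_def)
qed

lemma in_tri_elim:
  assumes g: "generic S" and S: "a \<in> S" "b \<in> S" "c \<in> S" "w \<in> S" and d: "distinct [a,b,c,w]" and I: "in_tri a b c w"
  obtains p q r where "p > 0" "q > 0" "r > 0" "w = p *\<^sub>R a + q *\<^sub>R b + r *\<^sub>R c"
proof -
  have nz: "det3 a b c \<noteq> 0" "det3 w b c \<noteq> 0" "det3 a w c \<noteq> 0" "det3 a b w \<noteq> 0"
    using generic_det3[OF g] S d by auto
  define D where "D = det3 a b c"
  have p: "det3 w b c / D > 0" "det3 a w c / D > 0" "det3 a b w / D > 0"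
    using I nz unfolding in_tri_def ccw_def D_def by (auto simp: zero_less_divide_iff)
  have "w = (1 / D) *\<^sub>R (D *\<^sub>R w)" using nz D_def by simp
  also have "D *\<^sub>R w = det3 w b c *\<^sub>R a + det3 a w c *\<^sub>R b + det3 a b w *\<^sub>R c"
    unfolding D_def by (rule cramer)
  finally have "w = (det3 w b c / D) *\<^sub>R a + (det3 a w c / D) *\<^sub>R b + (det3 a b w / D) *\<^sub>R c"
    by (simp add: scaleR_add_right)
  then show thesis using that p by blast
qed

lemma coords:
  assumes "det3 a b c \<noteq> 0"
  obtains p q r where "w = p *\<^sub>R a + q *\<^sub>R b + r *\<^sub>R c"
proof -
  have "w = (1 / det3 a b c) *\<^sub>R (det3 a b c *\<^sub>R w)" using assms by simp
  also have "det3 a b c *\<^sub>R w = det3 w b c *\<^sub>R a + det3 a w c *\<^sub>R b + det3 a b w *\<^sub>R c"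
    by (rule cramer)
  finally show thesis using that by (simp add: scaleR_add_right)
qed

lemma det3_coords:
  assumes "w = p *\<^sub>R a + q *\<^sub>R b + r *\<^sub>R c"
  shows "det3 w b c = p * det3 a b c" "det3 a w c = q * det3 a b c" "det3 a b w = r * det3 a b c"
  unfolding assms by (simp_all add: det3_expand algebra_simps)

lemma in_tri_intro:
  assumes "w = p *\<^sub>R a + q *\<^sub>R b + r *\<^sub>R c" "p > 0" "q > 0" "r > 0"
  shows "in_tri a b c w"
  using assms(2-) unfolding in_tri_def ccw_def det3_coords[OF assms(1)] by (simp add: zero_less_mult_iff)

text \<open>The arc from z through w leaves the triangle, and not through the side ab, since the i-coordinate stays positive.\<close>

lemma exit_triangle:
  assumes g: "generic S" and S: "a \<in> S" "i \<in> S" "b \<in> S" "w \<in> S" "w' \<in> S"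
    and ne: "distinct [a,i,b]" "w \<notin> {a,i,b}" "w \<noteq> w'"
    and z: "\<alpha> *\<^sub>R a + \<beta> *\<^sub>R i + \<gamma> *\<^sub>R b = p *\<^sub>R w + q *\<^sub>R w'" "\<alpha> > 0" "\<beta> > 0" "\<gamma> > 0" "p \<ge> 0" "q > 0"
    and w: "w = \<alpha>' *\<^sub>R a + \<beta>' *\<^sub>R i + \<gamma>' *\<^sub>R b" "\<alpha>' < 0 \<or> \<gamma>' < 0"
    and \<beta>: "\<And>s. s > 0 \<Longrightarrow> \<alpha> + s * \<alpha>' \<ge> 0 \<Longrightarrow> \<gamma> + s * \<gamma>' \<ge> 0 \<Longrightarrow> \<beta> + s * \<beta>' > 0"
  shows "crosses w w' a i \<or> crosses w w' i b"
proof -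
  \<comment> \<open>The point of the arc that is reached from the starting point by moving towards
    \<open>w\<close> for a time \<open>s\<close>; its coordinates are affine in
    \<open>s\<close>.\<close>
  have key: "(p + s) *\<^sub>R w + q *\<^sub>R w' = (\<alpha> + s * \<alpha>') *\<^sub>R a + (\<beta> + s * \<beta>') *\<^sub>R i + (\<gamma> + s * \<gamma>') *\<^sub>R b" for s
  proof -
    have "(p + s) *\<^sub>R w + q *\<^sub>R w' = (p *\<^sub>R w + q *\<^sub>R w') + s *\<^sub>R w" by (simp add: algebra_simps)
    also have "\<dots> = (\<alpha> *\<^sub>R a + \<beta> *\<^sub>R i + \<gamma> *\<^sub>R b) + s *\<^sub>R (\<alpha>' *\<^sub>R a + \<beta>' *\<^sub>R i + \<gamma>' *\<^sub>R b)"
      using z(1) w(1) by metis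
    finally show ?thesis by (simp add: algebra_simps)
  qed
  \<comment> \<open>Leaving the triangle exactly through the vertex \<open>i\<close> would violate
    general position.\<close>
  have nodep: False if "P > 0" "P *\<^sub>R w + q *\<^sub>R w' = c *\<^sub>R i" for P c
  proof (cases "w' = i")
    case True
    have "P *\<^sub>R w + q *\<^sub>R w' = c *\<^sub>R i + 0 *\<^sub>R i" using that by simp
    from det3_cong_comb[OF this, of i a] True have "P * det3 w i a = 0" by simp
    then show False using that generic_det3[OF g, of w i a] S ne by auto
  next
    case False
    have "P *\<^sub>R w + q *\<^sub>R w' = c *\<^sub>R i + 0 *\<^sub>R i" using that by simp
    from det3_cong_comb[OF this, of w' i] have "P * det3 w w' i = 0" by simp
    then show False using that generic_det3[OF g, of w w' i] S ne False by auto
  qed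
  \<comment> \<open>Compare the times at which the coordinates at \<open>a\<close> and at
    \<open>b\<close> vanish; the earlier one tells through which side the arc leaves.\<close>
  show ?thesis
  proof (cases "\<alpha>' < 0 \<and> (\<gamma>' \<ge> 0 \<or> \<alpha> / (-\<alpha>') \<le> \<gamma> / (-\<gamma>'))")
    case True
    define s where "s = \<alpha> / (-\<alpha>')"
    have s: "s > 0" using True z s_def by (simp add: divide_pos_neg)
    have a0: "\<alpha> + s * \<alpha>' = 0" using True s_def by (simp add: field_simps)
    have g0: "\<gamma> + s * \<gamma>' \<ge> 0"
    proof (cases "\<gamma>' \<ge> 0")
      case True then show ?thesis using s z by simp
    next
      case False
      then have "s \<le> \<gamma> / (-\<gamma>')" using True s_def by auto
      then have "s * (-\<gamma>') \<le> \<gamma>" using False pos_le_divide_eq[of "-\<gamma>'" s \<gamma>] by linarith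
      then show ?thesis by simp
    qed
    have b0: "\<beta> + s * \<beta>' > 0" using \<beta>[OF s] a0 g0 by simp
    have ps: "p + s > 0" using s z by simp
    show ?thesis
    proof (cases "\<gamma> + s * \<gamma>' = 0")
      case True
      then have "(p + s) *\<^sub>R w + q *\<^sub>R w' = (\<beta> + s * \<beta>') *\<^sub>R i" using key[of s] a0 by simp
      from nodep[OF ps this] show ?thesis by simp
    next
      case False
      then have "crosses w w' i b" using crosses_intro[OF g S(4,5,2,3), of "p+s" q "\<beta> + s*\<beta>'" "\<gamma> + s * \<gamma>'"] key[of s] a0 g0 b0 ps z ne by auto
      then show ?thesis by simp
    qed
  next
    case False
    then have gneg: "\<gamma>' < 0" and le: "\<alpha>' \<ge> 0 \<or> \<gamma> / (-\<gamma>') \<le> \<alpha> / (-\<alpha>')" using w(2) by auto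
    define s where "s = \<gamma> / (-\<gamma>')"
    have s: "s > 0" using gneg z s_def by (simp add: divide_pos_neg)
    have a0: "\<gamma> + s * \<gamma>' = 0" using gneg s_def by (simp add: field_simps)
    have g0: "\<alpha> + s * \<alpha>' \<ge> 0"
    proof (cases "\<alpha>' \<ge> 0")
      case True then show ?thesis using s z by simp
    next
      case False
      then have "s \<le> \<alpha> / (-\<alpha>')" using le s_def by auto
      then have "s * (-\<alpha>') \<le> \<alpha>" using False pos_le_divide_eq[of "-\<alpha>'" s \<alpha>] by linarith
      then show ?thesis by simp
    qed
    have b0: "\<beta> + s * \<beta>' > 0" using \<beta>[OF s] a0 g0 by simp
    have ps: "p + s > 0" using s z by simp
    show ?thesis
    proof (cases "\<alpha> + s * \<alpha>' = 0")
      case True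
      then have "(p + s) *\<^sub>R w + q *\<^sub>R w' = (\<beta> + s * \<beta>') *\<^sub>R i" using key[of s] a0 by simp
      from nodep[OF ps this] show ?thesis by simp
    next
      case False
      then have "crosses w w' a i" using crosses_intro[OF g S(4,5,1,2), of "p+s" q "\<alpha> + s * \<alpha>'" "\<beta> + s*\<beta>'"] key[of s] a0 g0 b0 ps z ne by auto
      then show ?thesis by simp
    qed
  qed
qed

lemma crosses_halfspace:
  assumes "generic S" "a \<in> S" "b \<in> S" "c \<in> S" "d \<in> S"
    and "h \<bullet> a < 0" "h \<bullet> b < 0" "h \<bullet> c > 0" "h \<bullet> d > 0"
  shows "\<not> crosses a b c d"
proof
  assume "crosses a b c d"
  from crosses_elim[OF assms(1-5) this] obtain p q r t where pos: "p > 0" "q > 0" "r > 0" "t > 0"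
    and eq: "p *\<^sub>R a + q *\<^sub>R b = r *\<^sub>R c + t *\<^sub>R d" by metis
  have "p * (h \<bullet> a) + q * (h \<bullet> b) = r * (h \<bullet> c) + t * (h \<bullet> d)"
    using arg_cong[OF eq, of "\<lambda>v. h \<bullet> v"] by (simp add: inner_add_right)
  moreover have "p * (h \<bullet> a) < 0" "q * (h \<bullet> b) < 0" "r * (h \<bullet> c) > 0" "t * (h \<bullet> d) > 0"
    using pos assms by (simp_all add: mult_pos_neg)
  ultimately show False by linarith
qed

section \<open>Points in general position\<close>

text \<open>Finitely many planes form a null set, and a nonempty open set is not null.\<close>

lemma open_avoids_planes:
  fixes U :: "(real^3) set"
  assumes "open U" "U \<noteq> {}" "finite N" "0 \<notin> N"
  shows "\<exists>y\<in>U. \<forall>n\<in>N. n \<bullet> y \<noteq> 0"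
proof (rule ccontr)
  assume "\<not> ?thesis"
  then have sub: "U \<subseteq> (\<Union>n\<in>N. {y. n \<bullet> y = 0})" by auto
  have "negligible (\<Union>n\<in>N. {y. n \<bullet> y = 0})"
    using assms by (intro negligible_Union) (auto intro!: negligible_hyperplane)
  then have "negligible U" using sub negligible_subset by blast
  then show False using assms open_not_negligible by blast
qed

lemma generic_insert:
  assumes "generic S" "\<And>a b. a \<in> S \<Longrightarrow> b \<in> S \<Longrightarrow> a \<noteq> b \<Longrightarrow> det3 a b y \<noteq> 0"
  shows "generic (insert y S)"
proof -
  have "det3 a b y \<noteq> 0" "det3 a y b \<noteq> 0" "det3 y a b \<noteq> 0" if "a \<in> S" "b \<in> S" "a \<noteq> b" for a b
  proof -
    have "det3 a y b = - det3 a b y" "det3 y a b = det3 a b y"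
      by (simp_all add: det3_expand algebra_simps)
    then show "det3 a b y \<noteq> 0" "det3 a y b \<noteq> 0" "det3 y a b \<noteq> 0" using assms(2)[OF that] by simp_all
  qed
  then show ?thesis using assms(1) unfolding generic_def by (metis insert_iff)
qed

text \<open>Three elements are required so that any two distinct ones are linearly independent; each
  pair then spans a plane that \<open>y\<close> has to avoid.\<close>

lemma exists_generic_point:
  assumes "open U" "U \<noteq> {}" "finite S" "generic S" "card S \<ge> 3"
  obtains y where "y \<in> U" "y \<notin> S" "generic (insert y S)"
proof -
  have cz: "cross3 a b \<noteq> 0" if ab: "a \<in> S" "b \<in> S" "a \<noteq> b" for a b
  proof -
    have "\<not> S \<subseteq> {a,b}" using assms(3,5) card_mono[of "{a,b}" S] by (auto simp: card_insert_if split: if_splits)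
    then obtain c where "c \<in> S" "c \<noteq> a" "c \<noteq> b" by blast
    then have "det3 a b c \<noteq> 0" using ab assms(4) generic_det3 by blast
    then show ?thesis by (auto simp: det3_def)
  qed
  let ?N = "(\<lambda>(a,b). cross3 a b) ` {(a,b). a \<in> S \<and> b \<in> S \<and> a \<noteq> b}"
  have "finite {(a,b). a \<in> S \<and> b \<in> S \<and> a \<noteq> b}"
    by (rule finite_subset[of _ "S \<times> S"]) (use assms in auto)
  then have "finite ?N" by blast
  moreover have "0 \<notin> ?N" using cz by force
  ultimately obtain y where y: "y \<in> U" "\<forall>n\<in>?N. n \<bullet> y \<noteq> 0" using open_avoids_planes[OF assms(1,2)] by blast
  have d: "det3 a b y \<noteq> 0" if "a \<in> S" "b \<in> S" "a \<noteq> b" for a b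
    using y(2) that by (auto simp: det3_def)
  have "y \<notin> S"
  proof
    assume "y \<in> S"
    have "\<not> S \<subseteq> {y}" using assms(3,5) card_mono[of "{y}" S] by auto
    then obtain a where "a \<in> S" "a \<noteq> y" by blast
    then have "det3 a y y \<noteq> 0" using d \<open>y \<in> S\<close> by blast
    then show False by simp
  qed
  then show thesis using that y(1) generic_insert[OF assms(4) d] by blast
qed

section \<open>Sides of a simple spherical polygon\<close>

fun parity :: "real^3 \<Rightarrow> real^3 \<Rightarrow> (real^3) list \<Rightarrow> bool" where
  "parity x y (a # b # w) = (crosses x y a b \<noteq> parity x y (b # w))"
| "parity x y _ = False"

fun path_edges :: "'a list \<Rightarrow> ('a \<times> 'a) set" where
  "path_edges (a # b # w) = insert (a, b) (path_edges (b # w))"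
| "path_edges _ = {}"

definition closed_path :: "'a list \<Rightarrow> 'a list" where "closed_path zs = zs @ [hd zs]"

definition edges :: "'a list \<Rightarrow> ('a \<times> 'a) set" where "edges zs = path_edges (closed_path zs)"

text \<open>Since \<open>crosses\<close> demands four distinct points, equal and adjacent edges need
  no exception.\<close>

definition simple :: "(real^3) list \<Rightarrow> bool" where
  "simple zs \<longleftrightarrow> (\<forall>(a,b)\<in>edges zs. \<forall>(c,d)\<in>edges zs. \<not> crosses a b c d)"

definition polygon :: "(real^3) list \<Rightarrow> bool" where
  "polygon zs \<longleftrightarrow> distinct zs \<and> 3 \<le> length zs \<and> generic (set zs)"

text \<open>The parity form of the Jordan curve theorem: for simple polygons the value does not depend on the vertex chosen as the head of the list.\<close>

definition left_side :: "(real^3) list \<Rightarrow> real^3 \<Rightarrow> bool" where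
  "left_side zs x \<longleftrightarrow> left_of (last zs) (hd zs) (hd (tl zs)) x \<noteq> parity x (hd zs) (closed_path zs)"

section \<open>Cyclic rotations, edges and parities of vertex lists\<close>

definition rotated :: "'a list \<Rightarrow> 'a list \<Rightarrow> bool" where
  "rotated zs zs' \<longleftrightarrow> (\<exists>n. zs' = rotate n zs)"

lemma rotated_refl: "rotated zs zs" unfolding rotated_def by (rule exI[of _ 0]) simp

lemma rotated_append: "rotated (u @ v) (v @ u)"
  unfolding rotated_def using rotate_append[of u v] by metis

lemma rotated_trans: "rotated a b \<Longrightarrow> rotated b c \<Longrightarrow> rotated a c"
  unfolding rotated_def by (metis rotate_rotate)

lemma rotated_split: "rotated zs zs' \<Longrightarrow> \<exists>u v. zs = u @ v \<and> zs' = v @ u"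
  unfolding rotated_def by (metis append_take_drop_id rotate_drop_take)

lemma rotated_sym: "rotated a b \<Longrightarrow> rotated b a"
  using rotated_split rotated_append by metis

lemma rotated_set: "rotated a b \<Longrightarrow> set b = set a" and rotated_length: "rotated a b \<Longrightarrow> length b = length a"
  and rotated_distinct: "rotated a b \<Longrightarrow> distinct b = distinct a"
  by (auto dest!: rotated_split)

lemma rotated_to_hd: "x \<in> set zs \<Longrightarrow> \<exists>w. rotated zs (x # w)"
  by (metis append_Cons rotated_append split_list)

lemma rotated_hd_eq: assumes "distinct (x # l)" "rotated (x # l) (x # l')" shows "l = l'"
proof -
  from rotated_split[OF assms(2)] obtain u v where uv: "x # l = u @ v" "x # l' = v @ u" by blast
  show ?thesis
  proof (cases u)
    case Nil then have "x # l = x # l'" using uv by (metis append_Nil append_Nil2) then show ?thesis by simp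
  next
    case (Cons y u')
    show ?thesis
    proof (cases v)
      case Nil then have "x # l = x # l'" using uv by (metis append_Nil append_Nil2) then show ?thesis by simp
    next
      case (Cons z v')
      then have "y = x" "z = x" using uv \<open>u = y # u'\<close> by auto
      then show ?thesis using uv assms(1) \<open>u = y # u'\<close> Cons by auto
    qed
  qed
qed

lemma rotated_invariant:
  assumes "rotated a b" "P a" "\<And>l. P l \<Longrightarrow> P (rotate1 l)" shows "P b"
proof -
  obtain n where "b = rotate n a" using assms rotated_def by blast
  moreover have "P (rotate n a)" by (induction n) (auto simp: assms)
  ultimately show ?thesis by simp
qed

lemma path_edges_append: "path_edges (u @ c # v) = path_edges (u @ [c]) \<union> path_edges (c # v)"
proof (induction u)
  case Nil then show ?case by simp
next
  case (Cons a u) then show ?case by (cases u) auto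
qed

lemma path_edges_set: "(a, b) \<in> path_edges w \<Longrightarrow> a \<in> set w \<and> b \<in> set w"
  by (induction w rule: path_edges.induct) auto

lemma path_edges_neq: "distinct w \<Longrightarrow> (a, b) \<in> path_edges w \<Longrightarrow> a \<noteq> b"
  by (induction w rule: path_edges.induct) auto

lemma path_edges_hd: "v \<noteq> [] \<Longrightarrow> path_edges (q # v) = insert (q, hd v) (path_edges v)" by (cases v) auto

lemma path_edges_snoc: "v \<noteq> [] \<Longrightarrow> path_edges (v @ [q]) = insert (last v, q) (path_edges v)"
proof (induction v)
  case (Cons a v) then show ?case by (cases v) auto
qed simp

lemma edges_rotate1: "edges (rotate1 zs) = edges zs"
proof (cases zs)
  case (Cons p w)
  then show ?thesis
  proof (cases w)
    case (Cons q ws)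
    have "edges (rotate1 zs) = path_edges ((q # ws) @ p # [q])" using \<open>zs = p # w\<close> Cons by (simp add: edges_def closed_path_def)
    also have "\<dots> = path_edges (q # ws @ [p]) \<union> {(p, q)}" using path_edges_append[of "q # ws" p "[q]"] by simp
    finally show ?thesis using \<open>zs = p # w\<close> Cons by (simp add: edges_def closed_path_def)
  qed (auto simp: edges_def closed_path_def)
qed (simp add: edges_def closed_path_def)

lemma rotated_edges: "rotated a b \<Longrightarrow> edges b = edges a"
  using rotated_invariant[where P = "\<lambda>l. edges l = edges a"] edges_rotate1 by metis

lemma rotated_simple: "rotated a b \<Longrightarrow> simple a \<Longrightarrow> simple b"
  by (simp add: simple_def rotated_edges)

lemma rotated_polygon: "rotated a b \<Longrightarrow> polygon a \<Longrightarrow> polygon b"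
  using rotated_set[of a b] rotated_length[of a b] rotated_distinct[of a b] by (simp add: polygon_def)

lemma parity_False: "(\<And>a b. (a, b) \<in> path_edges w \<Longrightarrow> \<not> crosses x y a b) \<Longrightarrow> \<not> parity x y w"
  by (induction w rule: path_edges.induct) auto

lemma parity_cons: "v \<noteq> [] \<Longrightarrow> parity s t (q # v) = (crosses s t q (hd v) \<noteq> parity s t v)"
  by (cases v) auto

lemma parity_snoc: "v \<noteq> [] \<Longrightarrow> parity s t (v @ [p]) = (parity s t v \<noteq> crosses s t (last v) p)"
proof (induction v)
  case (Cons a v) then show ?case by (cases v) auto
qed simp

lemma crosses_share [simp]: "\<not> crosses a b a d" "\<not> crosses a b c a" "\<not> crosses a b b d" "\<not> crosses a b c b" "\<not> crosses a a c d" "\<not> crosses a b c c"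
  by (simp_all add: crosses_def)

lemma parity_swap: "generic S \<Longrightarrow> x \<in> S \<Longrightarrow> y \<in> S \<Longrightarrow> set w \<subseteq> S \<Longrightarrow> parity y x w = parity x y w"
proof (induction w rule: path_edges.induct)
  case (1 a b w)
  then have "crosses y x a b = crosses x y a b" using crosses_sym(1)[of S x y a b] by auto
  then show ?case using 1 by auto
qed auto

text \<open>Adding up \<open>parity_triangle\<close> over the edges of the path, the contributions
  of the inner vertices cancel.\<close>

lemma parity_triangle_path:
  assumes g: "generic S" and S: "x \<in> S" "y \<in> S" "z \<in> S" and d: "distinct [x,y,z]"
  shows "set v \<subseteq> S \<Longrightarrow> set v \<inter> {x,y,z} = {} \<Longrightarrow> distinct v \<Longrightarrow> v \<noteq> [] \<Longrightarrow>
    ((parity x y v \<noteq> parity y z v) \<noteq> parity z x v) = (in_tri x y z (hd v) \<noteq> in_tri x y z (last v))"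
proof (induction v rule: path_edges.induct)
  case (1 a b w)
  have ab: "a \<in> S" "b \<in> S" "distinct [a,b,x,y,z]" using 1 d by auto
  have "((crosses a b x y \<noteq> crosses a b y z) \<noteq> crosses a b z x) = (in_tri x y z a \<noteq> in_tri x y z b)"
    using parity_triangle[OF g ab(1,2) S ab(3)] .
  moreover have "crosses a b x y = crosses x y a b" "crosses a b y z = crosses y z a b" "crosses a b z x = crosses z x a b"
    using crosses_sym(3)[OF g] ab S by auto
  moreover have "((parity x y (b # w) \<noteq> parity y z (b # w)) \<noteq> parity z x (b # w)) = (in_tri x y z b \<noteq> in_tri x y z (last (b # w)))"
    using 1 by auto
  ultimately show ?case by (simp del: last.simps add: last_ConsR) argo
qed auto

lemma in_tri_cyc: "in_tri b c a w = in_tri a b c w"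
  unfolding in_tri_def by (metis ccw_cyc)

text \<open>This lemma and the next two turn the case distinction of \<open>left_of\<close> into
  exclusive ors of orientations and sectors, so that it can be added to crossing parities.\<close>

lemma left_of_sector_1:
  assumes "generic S" "a \<in> S" "p \<in> S" "q \<in> S" "x \<in> S" "distinct [a,p,q,x]"
  shows "left_of a p q x = (ccw p q x \<noteq> sector p q x a)"
proof -
  have "ccw p q a = ccw a p q" "ccw p a x = (\<not> ccw a p x)"
    using ccw_swap[of S a p x] assms ccw_cyc by auto
  then show ?thesis unfolding left_of_def sector_def by auto
qed

lemma left_of_sector_2:
  assumes "generic S" "p \<in> S" "q \<in> S" "c \<in> S" "x \<in> S" "distinct [p,q,c,x]"
  shows "left_of p q c x = (ccw p q x \<noteq> sector q x p c)"
proof -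
  have "ccw q x c = (\<not> ccw q c x)" "ccw q x p = ccw p q x" "ccw q c p = ccw p q c"
    using ccw_swap[of S q c x] assms ccw_cyc by auto
  then show ?thesis unfolding left_of_def sector_def by auto
qed

lemma left_of_sector_3:
  assumes g: "generic S" and S: "a \<in> S" "p \<in> S" "q \<in> S" "x \<in> S" "y \<in> S" and d: "distinct [a,p,q,x,y]"
  shows "(left_of a p q x \<noteq> left_of a p q y) = (sector p x y q \<noteq> sector p x y a)"
proof -
  have e: "ccw p x q = (\<not> ccw p q x)" "ccw p x a = ccw a p x" "ccw p a y = (\<not> ccw a p y)"
    "ccw p q a = ccw a p q"
    using ccw_swap[of S p q x] ccw_swap[of S a p y] assms ccw_cyc by auto
  have f: "ccw p a q = (\<not> ccw a p q)" "ccw p a x = (\<not> ccw a p x)" "ccw p a y = (\<not> ccw a p y)"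
    using ccw_swap[of S a p q] ccw_swap[of S a p y] ccw_swap[of S a p x] assms ccw_cyc by auto
  have "distinct [p,a,q,x,y]" using d by auto
  note gp = ccw_grassmann_pluecker[OF g S(2,1,3,4,5) this]
  show ?thesis using gp unfolding left_of_def sector_def e f by argo
qed

text \<open>The base vertex moves from \<open>p\<close> to \<open>q\<close>. Apply the parity count
  to the triangle \<open>x p q\<close> and the path from \<open>c\<close> to \<open>a\<close>; the
  end terms inside the triangle and the crossings with the edges next to \<open>pq\<close> combine
  to the sectors by which the angles at \<open>p\<close> and \<open>q\<close> differ.\<close>

lemma left_side_rotate1:
  assumes p: "polygon zs" and s: "simple zs" and x: "x \<notin> set zs" "generic (insert x (set zs))"
  shows "left_side (rotate1 zs) x = left_side zs x"
proof -
  obtain p q c cs where zs: "zs = p # q # c # cs"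
    using p unfolding polygon_def by (metis Suc_le_length_iff numeral_3_eq_3)
  define ws where "ws = c # cs"
  define a where "a = last ws"
  have ws: "ws \<noteq> []" "hd ws = c" "zs = p # q # ws" using zs ws_def by auto
  have aS: "a \<in> set ws" "c \<in> set ws" using ws a_def ws_def by auto
  have dist: "distinct (p # q # ws)" using p ws(3) unfolding polygon_def by metis
  let ?S = "insert x (set zs)"
  note g = x(2)
  have S: "x \<in> ?S" "p \<in> ?S" "q \<in> ?S" "a \<in> ?S" "c \<in> ?S" "set ws \<subseteq> ?S" using ws aS by auto
  have ne: "x \<noteq> p" "x \<noteq> q" "x \<noteq> a" "x \<noteq> c" "p \<noteq> q" "p \<noteq> a" "p \<noteq> c" "q \<noteq> a" "q \<noteq> c"
    using x(1) ws(3) aS dist by auto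
  have side1: "left_side zs x = (left_of a p q x \<noteq> ((crosses x p q c \<noteq> parity x p ws)))"
    using ws by (simp add: left_side_def closed_path_def a_def parity_cons parity_snoc)
  have side2: "left_side (rotate1 zs) x = (left_of p q c x \<noteq> (parity x q ws \<noteq> crosses x q a p))"
  proof -
    have "parity x q (q # ws @ [p, q]) = (parity x q ws \<noteq> crosses x q a p)"
      using parity_snoc[of "q # ws @ [p]" x q q] ws parity_cons[of "ws @ [p]" x q q] parity_snoc[of ws x q p] a_def by auto
    then show ?thesis using ws by (simp add: left_side_def closed_path_def)
  qed
  have tri: "((parity x p ws \<noteq> parity p q ws) \<noteq> parity q x ws) = (in_tri x p q c \<noteq> in_tri x p q a)"
  proof -
    have 1: "distinct [x,p,q]" using ne by simp
    have 2: "set ws \<inter> {x,p,q} = {}" using dist x(1) ws(3) by auto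
    have 3: "distinct ws" using dist by simp
    show ?thesis using parity_triangle_path[OF g S(1-3) 1 S(6) 2 3 ws(1)] by (simp only: ws(2) a_def)
  qed
  \<comment> \<open>Simplicity enters here: the edge \<open>pq\<close> crosses nothing, so its term
    drops out of the count.\<close>
  have "\<not> parity p q ws"
  proof (rule parity_False)
    fix u v assume "(u, v) \<in> path_edges ws"
    then have "(u, v) \<in> edges zs" using path_edges_append[of "[p,q]" "c" "cs @ [p]"] path_edges_snoc[of ws p] ws zs ws_def
      by (auto simp: edges_def closed_path_def)
    moreover have "(p, q) \<in> edges zs" by (simp add: edges_def closed_path_def zs)
    ultimately show "\<not> crosses p q u v" using s unfolding simple_def by blast
  qed
  moreover have "parity q x ws = parity x q ws" using parity_swap[OF g S(1,3,6)] .
  moreover have "(crosses q c x p \<noteq> in_tri q x p c) = sector q x p c"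
    using crosses_corner[OF g S(3,1,2,5)] ne by auto
  moreover have "(crosses p a q x \<noteq> in_tri p q x a) = sector p q x a"
    using crosses_corner[OF g S(2,3,1,4)] ne by auto
  moreover have "crosses q c x p = crosses x p q c" "crosses p a q x = crosses x q a p"
    using crosses_sym(3)[OF g S(1,2,3,5)] crosses_sym(3)[OF g S(3,1,2,4)] crosses_sym(1)[OF g S(1,3,2,4)] crosses_sym(2)[OF g S(1,3,2,4)] by simp_all
  moreover have "in_tri q x p c = in_tri x p q c" "in_tri p q x a = in_tri x p q a" by (rule in_tri_cyc[symmetric], rule in_tri_cyc)
  moreover have "left_of a p q x = (ccw p q x \<noteq> sector p q x a)" using left_of_sector_1[OF g S(4,2,3,1)] ne by auto
  moreover have "left_of p q c x = (ccw p q x \<noteq> sector q x p c)" using left_of_sector_2[OF g S(2,3,5,1)] ne by auto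
  ultimately show ?thesis using side1 side2 tri by argo
qed

lemma rotated_left_side:
  assumes "rotated zs zs'" "polygon zs" "simple zs" "x \<notin> set zs" "generic (insert x (set zs))"
  shows "left_side zs' x = left_side zs x"
proof -
  have "rotated zs zs' \<and> polygon zs' \<and> simple zs' \<and> left_side zs' x = left_side zs x"
  proof (rule rotated_invariant[OF assms(1)])
    show "rotated zs zs \<and> polygon zs \<and> simple zs \<and> left_side zs x = left_side zs x" using assms rotated_refl by auto
    fix l assume l: "rotated zs l \<and> polygon l \<and> simple l \<and> left_side l x = left_side zs x"
    have r: "rotated l (rotate1 l)" unfolding rotated_def by (rule exI[of _ 1]) simp
    have "left_side (rotate1 l) x = left_side l x"
      using left_side_rotate1[of l x] l assms(4,5) rotated_set[of zs l] by auto
    then show "rotated zs (rotate1 l) \<and> polygon (rotate1 l) \<and> simple (rotate1 l) \<and> left_side (rotate1 l) x = left_side zs x"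
      using l r rotated_trans rotated_polygon rotated_simple by blast
  qed
  then show ?thesis by blast
qed

text \<open>The triangle \<open>x y p\<close> takes the place that \<open>x p q\<close> has in
  \<open>left_side_rotate1\<close>; the two edges at \<open>p\<close> account for the change of
  \<open>left_of\<close>.\<close>

lemma left_side_diff:
  assumes p: "polygon zs" and x: "x \<notin> set zs" "y \<notin> set zs" "x \<noteq> y" "generic (insert x (insert y (set zs)))"
  shows "(left_side zs x \<noteq> left_side zs y) = parity x y (closed_path zs)"
proof -
  obtain p q c cs where zs: "zs = p # q # c # cs"
    using p unfolding polygon_def by (metis Suc_le_length_iff numeral_3_eq_3)
  define v where "v = q # c # cs"
  define a where "a = last v"
  have v: "v \<noteq> []" "hd v = q" "zs = p # v" using zs v_def by auto
  have aS: "a \<in> set v" "q \<in> set v" "a \<noteq> q" using v a_def v_def p zs by (auto simp: polygon_def split: if_splits)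
  have dist: "distinct (p # v)" using p v(3) unfolding polygon_def by metis
  let ?S = "insert x (insert y (set zs))"
  note g = x(4)
  have S: "x \<in> ?S" "y \<in> ?S" "p \<in> ?S" "q \<in> ?S" "a \<in> ?S" "set v \<subseteq> ?S" using v aS by auto
  have ne: "x \<noteq> p" "x \<noteq> q" "x \<noteq> a" "y \<noteq> p" "y \<noteq> q" "y \<noteq> a" "p \<noteq> q" "p \<noteq> a" "q \<noteq> a"
    using x v(3) aS dist by auto
  have pcl: "parity s t (closed_path zs) = (crosses s t p q \<noteq> (parity s t v \<noteq> crosses s t a p))" for s t
    using v by (simp add: closed_path_def a_def parity_cons parity_snoc)
  have side: "left_side zs x = (left_of a p q x \<noteq> parity x p v)" "left_side zs y = (left_of a p q y \<noteq> parity y p v)"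
    using pcl[of x p] pcl[of y p] v unfolding left_side_def a_def by simp_all
  have tri: "((parity x y v \<noteq> parity y p v) \<noteq> parity p x v) = (in_tri x y p q \<noteq> in_tri x y p a)"
  proof -
    have 1: "distinct [x,y,p]" using ne x(3) by simp
    have 2: "set v \<inter> {x,y,p} = {}" using dist x(1,2) v(3) by auto
    have 3: "distinct v" using dist by simp
    show ?thesis using parity_triangle_path[OF g S(1-3) 1 S(6) 2 3 v(1)] by (simp only: v(2) a_def)
  qed
  moreover have "parity p x v = parity x p v" using parity_swap[OF g S(1,3,6)] .
  moreover have "(crosses p q x y \<noteq> in_tri p x y q) = sector p x y q"
    using crosses_corner[OF g S(3,1,2,4)] ne x by auto
  moreover have "(crosses p a x y \<noteq> in_tri p x y a) = sector p x y a"
    using crosses_corner[OF g S(3,1,2,5)] ne x by auto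
  moreover have "crosses p q x y = crosses x y p q" "crosses p a x y = crosses x y a p"
    using crosses_sym(3)[OF g S(1,2,3,4)] crosses_sym(3)[OF g S(1,2,3,5)] crosses_sym(2)[OF g S(1,2,3,5)] by simp_all
  moreover have "in_tri p x y q = in_tri x y p q" "in_tri p x y a = in_tri x y p a" by (rule in_tri_cyc[symmetric])+
  moreover have "(left_of a p q x \<noteq> left_of a p q y) = (sector p x y q \<noteq> sector p x y a)"
    using left_of_sector_3[OF g S(5,3,4,1,2)] ne x by auto
  ultimately show ?thesis using side pcl[of x y] by argo
qed

section \<open>Hull vertices\<close>

definition corner :: "'a list \<Rightarrow> 'a \<Rightarrow> 'a \<Rightarrow> 'a \<Rightarrow> bool" where
  "corner zs a p b \<longleftrightarrow> (\<exists>u. rotated zs (a # p # b # u))"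

definition left_turn :: "(real^3) list \<Rightarrow> real^3 \<Rightarrow> bool" where
  "left_turn zs p \<longleftrightarrow> (\<exists>a b. corner zs a p b \<and> ccw a p b)"

text \<open>A plane through the origin cuts off \<open>a\<close>. In a generic hemispheric set these
  are the vertices of the spherical convex hull.\<close>

definition hull_vertex :: "(real^3) set \<Rightarrow> real^3 \<Rightarrow> bool" where
  "hull_vertex S a \<longleftrightarrow> a \<in> S \<and> (\<exists>g. g \<bullet> a < 0 \<and> (\<forall>y\<in>S - {a}. g \<bullet> y > 0))"

lemma corner_infix: "corner (L @ a # p # b # R) a p b"
  unfolding corner_def using rotated_append[of L "a # p # b # R"] by auto

lemma corner_hd: "corner (p # b # ws @ [a]) a p b"
  unfolding corner_def using rotated_append[of "p # b # ws" "[a]"] by auto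

lemma corner_last: "corner (b # ws @ [a, p]) a p b"
  unfolding corner_def using rotated_append[of "b # ws" "[a, p]"] by auto

lemma corner_rotated: "rotated zs zs' \<Longrightarrow> corner zs' a p b = corner zs a p b"
  unfolding corner_def using rotated_trans rotated_sym by blast

lemma corner_set: "corner zs a p b \<Longrightarrow> a \<in> set zs \<and> p \<in> set zs \<and> b \<in> set zs"
  unfolding corner_def using rotated_set by fastforce

lemma corner_distinct: "distinct zs \<Longrightarrow> corner zs a p b \<Longrightarrow> distinct [a,p,b]"
  unfolding corner_def using rotated_distinct by fastforce

lemma corner_rotated_hd: "corner zs a p b \<longleftrightarrow> (\<exists>u. rotated zs (p # b # u @ [a]))"
proof
  assume "corner zs a p b"
  then obtain u where "rotated zs (a # p # b # u)" by (auto simp: corner_def)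
  then have "rotated zs (p # b # u @ [a])" using rotated_append[of "[a]" "p # b # u"] rotated_trans by fastforce
  then show "\<exists>u. rotated zs (p # b # u @ [a])" by blast
next
  assume "\<exists>u. rotated zs (p # b # u @ [a])"
  then obtain u where "rotated zs (p # b # u @ [a])" by blast
  then show "corner zs a p b" using corner_hd[of p b u a] corner_rotated by metis
qed

lemma corner_unique:
  assumes "distinct zs" "corner zs a p b" "corner zs a' p b'"
  shows "a = a' \<and> b = b'"
proof -
  obtain u u' where u: "rotated zs (p # b # u @ [a])" "rotated zs (p # b' # u' @ [a'])"
    using assms corner_rotated_hd by metis
  then have "b # u @ [a] = b' # u' @ [a']"
    using rotated_hd_eq assms(1) rotated_distinct rotated_sym rotated_trans by metis
  then show ?thesis by auto
qed

lemma corner_exists: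
  assumes "polygon zs" "p \<in> set zs"
  obtains a b u where "rotated zs (p # b # u @ [a])" "corner zs a p b"
proof -
  obtain w where w: "rotated zs (p # w)" using rotated_to_hd assms(2) by metis
  then have "length w \<ge> 2" using assms(1) rotated_length[OF w] by (simp add: polygon_def)
  then obtain b w' where "w = b # w'" "w' \<noteq> []"
    by (cases w) (auto simp: numeral_2_eq_2 Suc_le_eq)
  then have r: "rotated zs (p # b # butlast w' @ [last w'])" using w by simp
  have "corner zs (last w') p b" unfolding corner_rotated_hd using r by blast
  then show thesis using that[OF r] by simp
qed

lemma left_turn_corner: "polygon zs \<Longrightarrow> corner zs a p b \<Longrightarrow> left_turn zs p = ccw a p b"
  unfolding left_turn_def polygon_def using corner_unique by metis

lemma left_turn_rotated: "rotated zs zs' \<Longrightarrow> left_turn zs' p = left_turn zs p"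
  unfolding left_turn_def by (simp add: corner_rotated)

lemma edges_set: "(a, b) \<in> edges zs \<Longrightarrow> a \<in> set zs \<and> b \<in> set zs"
  unfolding edges_def closed_path_def
  by (cases zs) (auto dest!: path_edges_set)

lemma closed_path_parity_False:
  assumes "\<And>a b. (a, b) \<in> edges zs \<Longrightarrow> \<not> crosses x y a b" shows "\<not> parity x y (closed_path zs)"
  using assms unfolding edges_def by (intro parity_False) auto

text \<open>A point that sees the vertex \<open>p\<close> has crossing parity zero there, so the
  angle at \<open>p\<close> alone decides its side.\<close>

lemma left_side_corner:
  assumes p: "polygon zs" "simple zs" and x: "x \<notin> set zs" "generic (insert x (set zs))"
    and c: "corner zs a p b" and n: "\<And>c d. (c, d) \<in> edges zs \<Longrightarrow> \<not> crosses x p c d"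
  shows "left_side zs x = left_of a p b x"
proof -
  obtain u where u: "rotated zs (p # b # u @ [a])" using c corner_rotated_hd by metis
  have "\<not> parity x p (closed_path (p # b # u @ [a]))"
    by (rule closed_path_parity_False) (use n rotated_edges[OF u] in auto)
  then have "left_side (p # b # u @ [a]) x = left_of a p b x" by (simp add: left_side_def)
  then show ?thesis using rotated_left_side[OF u p x] by simp
qed

lemma left_side_same:
  assumes p: "polygon zs" and x: "x \<notin> set zs" "y \<notin> set zs" "generic (insert x (insert y (set zs)))"
    and n: "\<And>c d. (c, d) \<in> edges zs \<Longrightarrow> \<not> crosses x y c d"
  shows "left_side zs x = left_side zs y"
proof (cases "x = y")
  case False
  have "\<not> parity x y (closed_path zs)" by (rule closed_path_parity_False) (use n in auto)
  then show ?thesis using left_side_diff[OF p x(1,2) False x(3)] by blast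
qed simp

lemma generic_pair_third:
  assumes "generic S" "finite S" "card S \<ge> 3" "a \<in> S" "b \<in> S" "a \<noteq> b"
  obtains c where "c \<in> S" "c \<noteq> a" "c \<noteq> b" "det3 a b c \<noteq> 0"
proof -
  have "\<not> S \<subseteq> {a,b}" using assms(2,3) card_mono[of "{a,b}" S] by (auto simp: card_insert_if split: if_splits)
  then obtain c where "c \<in> S" "c \<noteq> a" "c \<noteq> b" by blast
  then show thesis using that assms generic_det3 by blast
qed

lemma polygon_card: "polygon zs \<Longrightarrow> card (set zs) \<ge> 3 \<and> generic (set zs)"
  by (simp add: polygon_def distinct_card)

lemma open_halfspaces: "finite S \<Longrightarrow> open {h::real^3. \<forall>z\<in>S. h \<bullet> z > 0}"
proof -
  assume "finite S"
  then have "open (\<Inter>z\<in>S. {h. z \<bullet> h > 0})" by (intro open_INT) (auto simp: open_halfspace_gt)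
  moreover have "(\<Inter>z\<in>S. {h. z \<bullet> h > 0}) = {h. \<forall>z\<in>S. h \<bullet> z > 0}" by (auto simp: inner_commute)
  ultimately show ?thesis by simp
qed

lemma open_lt: "open {y::real^3. h \<bullet> y < 0}"
  by (rule open_halfspace_lt)

text \<open>x can be replaced by a point beyond p, from which the arc to p does not meet the polygon.\<close>

lemma hull_left_side:
  assumes p: "polygon zs" "simple zs" and h: "\<forall>z\<in>set zs. h \<bullet> z > 0" and hv: "hull_vertex (set zs) p"
    and x: "x \<notin> set zs" "generic (insert x (set zs))" "h \<bullet> x < 0"
  shows "left_side zs x = (\<not> left_turn zs p)"
proof -
  obtain g where g: "g \<bullet> p < 0" "\<forall>y\<in>set zs - {p}. g \<bullet> y > 0" and pz: "p \<in> set zs" using hv by (auto simp: hull_vertex_def)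
  obtain a b where c: "corner zs a p b" using corner_exists[OF p(1) pz] by metis
  have abp: "a \<in> set zs" "b \<in> set zs" "distinct [a,p,b]" using corner_set[OF c] corner_distinct[OF _ c] p(1) by (simp_all add: polygon_def)
  let ?U = "{y. h \<bullet> y < 0} \<inter> {y. g \<bullet> y < 0}"
  have U: "open ?U" by (intro open_Int open_lt)
  have "-a \<in> ?U" using h g abp by auto
  then have U2: "?U \<noteq> {}" by blast
  have "card (insert x (set zs)) \<ge> 3" using polygon_card[OF p(1)] x(1) by simp
  then obtain y where y: "y \<in> ?U" "y \<notin> insert x (set zs)" "generic (insert y (insert x (set zs)))"
    using exists_generic_point[OF U U2 _ x(2)] by blast
  have gy: "generic (insert y (set zs))" using y(3) generic_subset by (metis insert_commute subset_insertI)
  have "left_side zs x = left_side zs y"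
  proof (rule left_side_same[OF p(1) x(1)])
    show "y \<notin> set zs" using y by auto
    show "generic (insert x (insert y (set zs)))" using y(3) by (simp add: insert_commute)
    fix c d assume "(c, d) \<in> edges zs"
    then show "\<not> crosses x y c d"
      using crosses_halfspace[of "insert y (insert x (set zs))" x y c d h] edges_set[of c d zs] y x h by auto
  qed
  also have "left_side zs y = left_of a p b y"
  proof (rule left_side_corner[OF p _ gy c])
    show "y \<notin> set zs" using y by auto
    fix c d assume e: "(c, d) \<in> edges zs"
    \<comment> \<open>\<open>g\<close> is negative at \<open>y\<close> and \<open>p\<close> and
      positive at all other vertices.\<close>
    show "\<not> crosses y p c d"
    proof (cases "p = c \<or> p = d")
      case True then show ?thesis by auto
    next
      case False
      then show ?thesis
        using crosses_halfspace[of "insert y (set zs)" y p c d g] edges_set[of c d zs] e y g pz gy by auto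
    qed
  qed
  also have "left_of a p b y = (\<not> ccw a p b)"
  proof -
    have nz: "det3 a p b \<noteq> 0" "det3 y p b \<noteq> 0" "det3 a p y \<noteq> 0"
      using generic_det3[OF gy] abp pz y(2) by auto
    obtain \<alpha> \<beta> \<gamma> where co: "y = \<alpha> *\<^sub>R a + \<beta> *\<^sub>R p + \<gamma> *\<^sub>R b" using coords[OF nz(1)] by metis
    \<comment> \<open>\<open>y\<close> is not in the lune spanned by the angle at \<open>p\<close>:
      if \<alpha> and \<gamma> were positive, \<open>h\<close> would force \<beta> < 0 and
      \<open>g\<close> would force \<beta> > 0.\<close>
    have no: "\<not> (\<alpha> > 0 \<and> \<gamma> > 0)"
    proof
      assume ag: "\<alpha> > 0 \<and> \<gamma> > 0"
      have hp: "h \<bullet> a > 0" "h \<bullet> b > 0" "h \<bullet> p > 0" "g \<bullet> a > 0" "g \<bullet> b > 0" using h g abp pz by auto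
      have "h \<bullet> y = \<alpha> * (h \<bullet> a) + \<beta> * (h \<bullet> p) + \<gamma> * (h \<bullet> b)" "g \<bullet> y = \<alpha> * (g \<bullet> a) + \<beta> * (g \<bullet> p) + \<gamma> * (g \<bullet> b)"
        by (simp_all add: co inner_add_right)
      moreover have "\<alpha> * (h \<bullet> a) > 0" "\<gamma> * (h \<bullet> b) > 0" "\<alpha> * (g \<bullet> a) > 0" "\<gamma> * (g \<bullet> b) > 0" using ag hp by auto
      ultimately have "\<beta> * (h \<bullet> p) < 0" "\<beta> * (g \<bullet> p) < 0" using y(1) by auto
      then show False using hp g by (auto simp: mult_less_0_iff)
    qed
    have d: "det3 y p b = \<alpha> * det3 a p b" "det3 a p y = \<gamma> * det3 a p b" using det3_coords[OF co] by auto
    have e: "ccw p b y = (det3 y p b > 0)" by (simp only: ccw_def det3_cyc[of p b y])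
    show ?thesis
    proof (cases "ccw a p b")
      case True
      then show ?thesis using no d e unfolding left_of_def ccw_def by (auto simp: zero_less_mult_iff)
    next
      case False
      then have "det3 a p b < 0" using nz unfolding ccw_def by auto
      then show ?thesis using no d e False nz unfolding left_of_def ccw_def by (auto simp: zero_less_mult_iff)
    qed
  qed
  finally show ?thesis using left_turn_corner[OF p(1) c] by simp
qed

text \<open>Both turns are compared with the side of one generic point of the opposite
  hemisphere.\<close>

lemma hull_left_turn_eq:
  assumes p: "polygon zs" "simple zs" and h: "\<forall>z\<in>set zs. h \<bullet> z > 0" and hv: "hull_vertex (set zs) p" "hull_vertex (set zs) q"
  shows "left_turn zs p = left_turn zs q"
proof -
  have pz: "p \<in> set zs" using hv by (auto simp: hull_vertex_def)
  then have "-p \<in> {y. h \<bullet> y < 0}" using h by auto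
  then obtain x where "x \<in> {y. h \<bullet> y < 0}" "x \<notin> set zs" "generic (insert x (set zs))"
    using exists_generic_point[OF open_lt[of h] _ _ ] polygon_card[OF p(1)] by (metis List.finite_set empty_iff)
  then show ?thesis using hull_left_side[OF p h hv(1)] hull_left_side[OF p h hv(2)] by auto
qed

text \<open>Positivity on a finite set is an open condition, so \<open>h\<close> can be moved a
  little against \<open>x\<close>. The factor makes the shift half as long as the radius of the
  ball.\<close>

lemma tilt:
  assumes "finite S" "\<forall>z\<in>S. h \<bullet> z > 0" "h \<bullet> x \<le> 0" "x \<noteq> (0::real^3)"
  obtains h' where "\<forall>z\<in>S. h' \<bullet> z > 0" "h' \<bullet> x < 0"
proof -
  have "open {h::real^3. \<forall>z\<in>S. h \<bullet> z > 0}" using assms open_halfspaces by blast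
  then obtain e where e: "e > 0" "ball h e \<subseteq> {h. \<forall>z\<in>S. h \<bullet> z > 0}" using assms(2) openE by blast
  define h' where "h' = h - (e / (2 * norm x)) *\<^sub>R x"
  have "h' \<in> ball h e" using e assms(4) by (simp add: h'_def dist_norm)
  moreover have "h' \<bullet> x < 0"
  proof -
    have "(e / (2 * norm x)) * (x \<bullet> x) > 0" using e assms(4) by simp
    then show ?thesis using assms(3) by (simp add: h'_def inner_diff_left)
  qed
  ultimately show thesis using that e by blast
qed

lemma generic_nonzero:
  assumes "generic S" "finite S" "card S \<ge> 3" "x \<in> S" shows "x \<noteq> 0"
proof -
  have "\<not> S \<subseteq> {x}" using assms(2,3) card_mono[of "{x}" S] by auto
  then obtain b where b: "b \<in> S" "b \<noteq> x" by blast
  then obtain c where "det3 x b c \<noteq> 0" using generic_pair_third[OF assms(1-4), of b] by metis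
  then show ?thesis by (auto simp: det3_expand)
qed

text \<open>\<open>hull_left_side\<close> read backwards; tilting disposes of points on the boundary
  of the hemisphere.\<close>

lemma left_inside:
  assumes p: "polygon zs" "simple zs" and h: "\<forall>z\<in>set zs. h \<bullet> z > 0" and hv: "hull_vertex (set zs) p"
    and x: "x \<notin> set zs" "generic (insert x (set zs))" "left_side zs x = left_turn zs p"
  shows "h \<bullet> x > 0"
proof (rule ccontr)
  assume "\<not> h \<bullet> x > 0"
  moreover have "x \<noteq> 0" using generic_nonzero[OF x(2)] polygon_card[OF p(1)] x(1) by auto
  ultimately obtain h' where "\<forall>z\<in>set zs. h' \<bullet> z > 0" "h' \<bullet> x < 0" using tilt[OF _ h] by force
  then show False using hull_left_side[OF p _ hv x(1,2)] x(3) by blast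
qed

text \<open>The two excluded points are the ends of the closing edge in \<open>exists_ear\<close>,
  and in \<open>one_crossing_aux\<close> they include the auxiliary point, whose turn is not
  known.\<close>

lemma exists_hull_vertex:
  assumes S: "finite S" "generic S" "card S \<ge> 3" and h: "\<forall>z\<in>S. h \<bullet> z > 0" and pq: "p \<in> S" "q \<in> S" "p \<noteq> q"
  obtains a where "hull_vertex S a" "a \<notin> {p,q}"
proof -
  txt \<open>A vertex farthest from the great circle through p and q; a generic k makes it unique.\<close>
  have main: "\<exists>a. hull_vertex S a \<and> a \<notin> {p,q}" if N: "N \<bullet> p = 0" "N \<bullet> q = 0" "y0 \<in> S" "N \<bullet> y0 > 0" for N y0
  proof -
    let ?U = "{h. \<forall>z\<in>S. h \<bullet> z > 0}"
    \<comment> \<open>\<open>k\<close> is orthogonal to this vector exactly when the ratio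
      \<open>r\<close> defined below agrees at \<open>y\<close> and \<open>z\<close>.\<close>
    let ?n = "\<lambda>y z. (N \<bullet> y) *\<^sub>R z - (N \<bullet> z) *\<^sub>R y"
    let ?P = "{(y,z). y \<in> S \<and> z \<in> S \<and> y \<noteq> z \<and> N \<bullet> y \<noteq> 0}"
    let ?M = "(\<lambda>(y,z). ?n y z) ` ?P"
    have "finite ?P" by (rule finite_subset[of _ "S \<times> S"]) (use S in auto)
    then have fM: "finite ?M" by blast
    have "?n y z \<noteq> 0" if yz: "y \<in> S" "z \<in> S" "y \<noteq> z" "N \<bullet> y \<noteq> 0" for y z
    proof
      assume 0: "?n y z = 0"
      obtain c where c: "det3 y z c \<noteq> 0" using generic_pair_third[OF S(2,1,3) yz(1,2,3)] by metis
      have "(N \<bullet> y) *\<^sub>R z + 0 *\<^sub>R z = (N \<bullet> z) *\<^sub>R y + 0 *\<^sub>R y" using 0 by simp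
      from det3_cong_comb[OF this, of c y] have "(N \<bullet> y) * det3 z c y = 0" by simp
      moreover have "det3 z c y = det3 y z c" by (metis det3_cyc)
      ultimately show False using c yz by simp
    qed
    then have "0 \<notin> ?M" by force
    moreover have "?U \<noteq> {}" using h by blast
    ultimately obtain k where k: "k \<in> ?U" "\<forall>n\<in>?M. n \<bullet> k \<noteq> 0"
      using open_avoids_planes[OF open_halfspaces[OF S(1)] _ fM] by blast
    \<comment> \<open>In the affine chart \<open>k = 1\<close> this is, up to scale, the signed
      distance from the line through \<open>p\<close> and \<open>q\<close>.\<close>
    define r where "r y = (N \<bullet> y) / (k \<bullet> y)" for y
    have kp: "k \<bullet> y > 0" if "y \<in> S" for y using k that by auto
    obtain a where a: "a \<in> S" "\<forall>y\<in>S. r y \<le> r a"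
    proof -
      have "Max (r ` S) \<in> r ` S" using S pq by (intro Max_in) auto
      then obtain a where "a \<in> S" "r a = Max (r ` S)" by force
      moreover have "\<forall>y\<in>S. r y \<le> Max (r ` S)" using S by auto
      ultimately show thesis using that by metis
    qed
    have "r y0 > 0" using N kp by (simp add: r_def)
    then have ra: "r a > 0" using a N by force
    then have Na: "N \<bullet> a > 0" using kp[OF a(1)] by (simp add: r_def zero_less_divide_iff)
    have apq: "a \<notin> {p,q}" using Na N by auto
    have strict: "r z < r a" if z: "z \<in> S" "z \<noteq> a" for z
    proof -
      have "r z \<noteq> r a"
      proof
        assume "r z = r a"
        then have "(N \<bullet> a) * (k \<bullet> z) = (N \<bullet> z) * (k \<bullet> a)" using kp[OF a(1)] kp[OF z(1)] by (simp add: r_def frac_eq_eq)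
        then have "?n a z \<bullet> k = 0" by (simp add: inner_diff_left inner_commute[of z k] inner_commute[of a k])
        moreover have "?n a z \<in> ?M" using a z Na by force
        ultimately show False using k by blast
      qed
      then show ?thesis using a z by force
    qed
    have "finite (r ` (S - {a}))" "r ` (S - {a}) \<noteq> {}" using S pq apq by auto
    then have "Max (r ` (S - {a})) < r a" using strict by auto
    then obtain t where t: "Max (r ` (S - {a})) < t" "t < r a" using dense by blast
    define g where "g = t *\<^sub>R k - N"
    have ge: "g \<bullet> y = (t - r y) * (k \<bullet> y)" if "y \<in> S" for y
      using kp[OF that] by (simp add: g_def r_def inner_diff_left field_simps)
    have "g \<bullet> a < 0" using ge[OF a(1)] t kp[OF a(1)] by (simp add: mult_neg_pos)
    moreover have "g \<bullet> y > 0" if "y \<in> S - {a}" for y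
    proof -
      have "r y \<le> Max (r ` (S - {a}))" using that S by auto
      then show ?thesis using ge[of y] that t kp[of y] by auto
    qed
    ultimately show ?thesis using apq a hull_vertex_def by blast
  qed
  obtain c where c: "c \<in> S" "det3 p q c \<noteq> 0" using generic_pair_third[OF S(2,1,3) pq] by metis
  have "\<exists>a. hull_vertex S a \<and> a \<notin> {p,q}"
  proof (cases "det3 p q c > 0")
    case True
    then show ?thesis using main[of "cross3 p q" c] c by (simp add: det3_def[symmetric])
  next
    case False
    then have "det3 q p c > 0" using c det3_swap[of q p c] by simp
    then show ?thesis using main[of "cross3 q p" c] c by (simp add: det3_def[symmetric])
  qed
  then show thesis using that by blast
qed

section \<open>Chords and ears\<close>

text \<open>Left-turning ears only; the right-turning ones are the ears of the mirror image.\<close>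

definition ear :: "(real^3) list \<Rightarrow> real^3 \<Rightarrow> bool" where
  "ear zs e \<longleftrightarrow> (\<exists>a b. corner zs a e b \<and> ccw a e b \<and> (\<forall>w\<in>set zs - {a,e,b}. \<not> in_tri a e b w))"

lemma simple_no_cross: "simple zs \<Longrightarrow> (a,b) \<in> edges zs \<Longrightarrow> (c,d) \<in> edges zs \<Longrightarrow> \<not> crosses a b c d"
  unfolding simple_def by blast

text \<open>\<open>left_of\<close> expresses the cyclic order of three directions at
  \<open>p\<close>, which a transposition reverses.\<close>

lemma left_of_swap:
  assumes "generic S" "a \<in> S" "p \<in> S" "b \<in> S" "x \<in> S" "distinct [a,p,b,x]"
  shows "left_of a p b x = (\<not> left_of a p x b)" "left_of a p b x = (\<not> left_of x p b a)"
proof -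
  have "ccw p x b = (\<not> ccw p b x)" "ccw p b x = ccw x p b" "ccw p b a = ccw a p b" "ccw x p a = (\<not> ccw a p x)"
    using ccw_swap[of S p b x] ccw_swap[of S a p x] assms ccw_cyc by auto
  then show "left_of a p b x = (\<not> left_of a p x b)" "left_of a p b x = (\<not> left_of x p b a)"
    unfolding left_of_def by auto
qed

lemma edges_split: "edges (i # A @ k # B) = path_edges (i # A @ [k]) \<union> path_edges (k # B @ [i])"
  using path_edges_append[of "i # A" k "B @ [i]"] by (simp add: edges_def closed_path_def)

lemma edges_chord: "edges (i # A @ [k]) = insert (k, i) (path_edges (i # A @ [k]))"
  using edges_split[of i A k "[]"] by simp

lemma corner_edges: "corner zs a p b \<Longrightarrow> (a, p) \<in> edges zs \<and> (p, b) \<in> edges zs"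
  unfolding corner_def using rotated_edges by (fastforce simp: edges_def closed_path_def)

lemma left_side_path:
  assumes p: "polygon Q" "generic S" "set Q \<subseteq> S"
  shows "set B \<subseteq> S \<Longrightarrow> set B \<inter> set Q = {} \<Longrightarrow>
    (\<And>x y c d. (x,y) \<in> path_edges B \<Longrightarrow> (c,d) \<in> edges Q \<Longrightarrow> \<not> crosses x y c d) \<Longrightarrow>
    (\<forall>x\<in>set B. left_side Q x = left_side Q (hd B))"
proof (induction B rule: path_edges.induct)
  case (1 a b w)
  have "generic (insert a (insert b (set Q)))" using p 1 by (auto intro: generic_subset[of S])
  then have "left_side Q a = left_side Q b"
    by (intro left_side_same[OF p(1)]) (use 1 in auto)
  moreover have r: "\<forall>x\<in>set (b # w). left_side Q x = left_side Q (hd (b # w))"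
  proof (rule "1.IH")
    show "set (b # w) \<subseteq> S" "set (b # w) \<inter> set Q = {}" using "1.prems"(1,2) by simp_all
    show "\<not> crosses x y c d" if "(x, y) \<in> path_edges (b # w)" "(c, d) \<in> edges Q" for x y c d
      using "1.prems"(3)[of x y c d] that by simp
  qed
  ultimately show ?case by (simp only: list.sel(1) list.set ball_simps) simp
qed auto

section \<open>Chords\<close>

text \<open>With \<open>A\<close> and \<open>B\<close> nonempty, each part has at least three
  vertices and is shorter than the whole polygon.\<close>

definition chord :: "(real^3) list \<Rightarrow> real^3 \<Rightarrow> (real^3) list \<Rightarrow> real^3 \<Rightarrow> (real^3) list \<Rightarrow> bool" where
  "chord zs i A k B \<longleftrightarrow> rotated zs (i # A @ k # B) \<and> A \<noteq> [] \<and> B \<noteq> [] \<and> (\<forall>(c,d)\<in>edges zs. \<not> crosses i k c d)"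

lemma chord_sym: assumes "chord zs i A k B" "polygon zs" shows "chord zs k B i A"
proof -
  have r: "rotated zs (i # A @ k # B)" using assms by (simp add: chord_def)
  then have "rotated zs (k # B @ i # A)" using rotated_append[of "i # A" "k # B"] rotated_trans by fastforce
  moreover have "\<not> crosses k i c d" if "(c,d) \<in> edges zs" for c d
    using crosses_sym(1)[of "set zs" i k c d] that assms edges_set[OF that] rotated_set[OF r] unfolding chord_def polygon_def by auto
  ultimately show ?thesis using assms by (auto simp: chord_def)
qed

lemma chord_polygon: assumes "chord zs i A k B" "polygon zs" "simple zs"
  shows "polygon (i # A @ [k])" "simple (i # A @ [k])"
proof -
  have r: "rotated zs (i # A @ k # B)" and ne: "A \<noteq> []" "B \<noteq> []" using assms by (auto simp: chord_def)
  have p: "polygon (i # A @ k # B)" using rotated_polygon r assms by blast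
  then have g: "generic (set (i # A @ k # B))" by (simp add: polygon_def)
  have "generic (set (i # A @ [k]))" by (rule generic_subset[OF g]) auto
  then show "polygon (i # A @ [k])" using p ne by (cases A) (simp_all add: polygon_def)
  have sub: "path_edges (i # A @ [k]) \<subseteq> edges zs" using edges_split[of i A k B] rotated_edges[OF r] by simp
  have free: "\<not> crosses i k c d" if "(c,d) \<in> edges zs" for c d using assms(1) that by (auto simp: chord_def)
  have "\<not> crosses a b c d" if e: "(a,b) \<in> edges (i # A @ [k])" "(c,d) \<in> edges (i # A @ [k])" for a b c d
  proof -
    have S: "a \<in> set (i # A @ k # B)" "b \<in> set (i # A @ k # B)" "c \<in> set (i # A @ k # B)" "d \<in> set (i # A @ k # B)"
      using edges_set[OF e(1)] edges_set[OF e(2)] by auto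
    consider "(a,b) = (k,i)" "(c,d) = (k,i)" | "(a,b) = (k,i)" "(c,d) \<in> edges zs" | "(a,b) \<in> edges zs" "(c,d) = (k,i)"
      | "(a,b) \<in> edges zs" "(c,d) \<in> edges zs" using e sub unfolding edges_chord by auto
    then show ?thesis
    proof cases
      case 2 then show ?thesis using free[of c d] crosses_sym(1)[OF g S] by auto
    next
      case 3 then show ?thesis using free[of a b] crosses_sym(3)[OF g S] crosses_sym(1)[OF g S(3,4,1,2)] by auto
    next
      case 4 then show ?thesis using assms(3) simple_no_cross by blast
    qed auto
  qed
  then show "simple (i # A @ [k])" unfolding simple_def by auto
qed

text \<open>\<open>B\<close> never meets the part, so it lies on one side of it. Its first and last
  vertices see the ends \<open>k\<close> and \<open>i\<close> of the chord, which gives two readings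
  of that side; together they link the angles at \<open>k\<close> and \<open>i\<close>.\<close>

lemma chord_left_side:
  assumes "chord zs i A k B" "polygon zs" "simple zs" "x \<in> set B"
  shows "left_side (i # A @ [k]) x = (\<not> left_of (last A) k (hd B) i)" "left_side (i # A @ [k]) x = (\<not> left_of (last B) i (hd A) k)"
proof -
  let ?Q = "i # A @ [k]"
  have r: "rotated zs (i # A @ k # B)" and ne: "A \<noteq> []" "B \<noteq> []" using assms by (auto simp: chord_def)
  have p: "polygon (i # A @ k # B)" using rotated_polygon r assms by blast
  then have g: "generic (set (i # A @ k # B))" and dist: "distinct (i # A @ k # B)" by (simp_all add: polygon_def)
  have Q: "polygon ?Q" "simple ?Q" using chord_polygon[OF assms(1-3)] by simp_all
  have free: "\<not> crosses i k c d" if "(c,d) \<in> edges zs" for c d using assms(1) that by (auto simp: chord_def)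
  have Ed: "edges zs = path_edges (i # A @ [k]) \<union> path_edges (k # B @ [i])" using edges_split[of i A k B] rotated_edges[OF r] by simp
  have peB: "path_edges (k # B @ [i]) = insert (k, hd B) (insert (last B, i) (path_edges B))"
    using ne path_edges_hd[of "B @ [i]" k] path_edges_snoc[of B i] by simp
  have noc: "\<not> crosses u v c d" if "(u,v) \<in> path_edges (k # B @ [i])" "(c,d) \<in> edges ?Q" for u v c d
  proof -
    have uv: "(u,v) \<in> edges zs" using that Ed by auto
    show ?thesis
    proof (cases "(c,d) = (k,i)")
      case True
      have S: "u \<in> set (i # A @ k # B)" "v \<in> set (i # A @ k # B)" using path_edges_set[OF that(1)] by auto
      have S2: "i \<in> set (i # A @ k # B)" "k \<in> set (i # A @ k # B)" by auto
      show ?thesis using free[OF uv] True crosses_sym(3)[OF g S S2(2,1)] crosses_sym(1)[OF g S2(1,2) S] by auto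
    next
      case False
      then have "(c,d) \<in> edges zs" using that Ed edges_chord[of i A k] by auto
      then show ?thesis using uv assms(3) simple_no_cross by blast
    qed
  qed
  have BQ: "set B \<inter> set ?Q = {}" using dist by auto
  have const: "\<forall>x\<in>set B. left_side ?Q x = left_side ?Q (hd B)"
    by (rule left_side_path[OF Q(1) g]) (use BQ noc peB in auto)
  have gi: "generic (insert y (set ?Q))" if "y \<in> set B" for y by (rule generic_subset[OF g]) (use that in auto)
  have mem: "hd A \<in> set A" "last A \<in> set A" "hd B \<in> set B" "last B \<in> set B" using ne by auto
  have Xs: "crosses u v c d = crosses v u c d" if "u \<in> set (k # B @ [i])" "v \<in> set (k # B @ [i])" "(c,d) \<in> edges ?Q" for u v c d
    using crosses_sym(1)[OF g, of v u c d] that edges_set[OF that(3)] by auto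
  have "left_side ?Q (hd B) = left_of (last A) k i (hd B)"
  proof (rule left_side_corner[OF Q])
    show "hd B \<notin> set ?Q" using BQ mem by blast
    show "generic (insert (hd B) (set ?Q))" using gi mem by blast
    have "A @ [k] = butlast A @ [last A, k]"
      using append_butlast_last_id[OF ne(1)] by (metis append.assoc append_Cons append_Nil)
    then show "corner ?Q (last A) k i" using corner_last[of i "butlast A" "last A" k] by metis
    fix c d assume "(c,d) \<in> edges ?Q"
    then show "\<not> crosses (hd B) k c d" using noc[of k "hd B" c d] Xs[of "hd B" k c d] peB mem by auto
  qed
  also have "\<dots> = (\<not> left_of (last A) k (hd B) i)"
    by (rule left_of_swap(1)[OF g]) (use mem dist in auto)
  finally show "left_side ?Q x = (\<not> left_of (last A) k (hd B) i)" using const assms(4) by auto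
  have "left_side ?Q (last B) = left_of k i (hd A) (last B)"
  proof (rule left_side_corner[OF Q])
    show "last B \<notin> set ?Q" using BQ mem by blast
    show "generic (insert (last B) (set ?Q))" using gi mem by blast
    show "corner ?Q k i (hd A)" using corner_hd[of i "hd A" "tl A" k] ne by (metis append_Cons list.collapse)
    fix c d assume "(c,d) \<in> edges ?Q"
    then show "\<not> crosses (last B) i c d" using noc[of "last B" i c d] peB mem by auto
  qed
  also have "\<dots> = (\<not> left_of (last B) i (hd A) k)"
    by (rule left_of_swap(2)[OF g]) (use mem dist in auto)
  finally show "left_side ?Q x = (\<not> left_of (last B) i (hd A) k)"
    using bspec[OF const assms(4)] bspec[OF const mem(4)] by argo
qed

lemma det3_cong_comb2:
  assumes "p *\<^sub>R a + q *\<^sub>R b = r *\<^sub>R c + t *\<^sub>R d"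
  shows "p * det3 x a y + q * det3 x b y = r * det3 x c y + t * det3 x d y"
  using det3_cong_comb[OF assms, of y x] det3_cyc[of a y x] det3_cyc[of b y x] det3_cyc[of c y x] det3_cyc[of d y x]
  by simp

lemma in_tri_coords_neg:
  assumes g: "generic S" and S: "a \<in> S" "i \<in> S" "b \<in> S" "w \<in> S" "w \<notin> {a,i,b}" "distinct [a,i,b]"
    and c: "w = \<alpha> *\<^sub>R a + \<beta> *\<^sub>R i + \<gamma> *\<^sub>R b" and n: "\<not> in_tri a i b w" and b: "\<alpha> \<ge> 0 \<Longrightarrow> \<gamma> \<ge> 0 \<Longrightarrow> \<beta> > 0"
  shows "\<alpha> < 0 \<or> \<gamma> < 0"
proof (rule ccontr)
  assume "\<not> ?thesis"
  then have nn: "\<alpha> \<ge> 0" "\<gamma> \<ge> 0" by auto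
  have "det3 w i b \<noteq> 0" "det3 a i w \<noteq> 0" using generic_det3[OF g] S by auto
  then have "\<alpha> \<noteq> 0" "\<gamma> \<noteq> 0" using det3_coords[OF c] by auto
  then have "in_tri a i b w" using in_tri_intro[OF c] nn b by auto
  then show False using n by simp
qed

text \<open>The arc from \<open>x\<close> to \<open>e\<close> is free: an edge across it would have
  an end with positive \<open>e\<close>-coordinate outside the triangle, and so would leave the
  triangle through \<open>ae\<close> or \<open>eb\<close>, against simplicity.\<close>

lemma left_side_in_ear:
  assumes Q: "polygon Q" "simple Q" and x: "x \<notin> set Q" "generic (insert x (set Q))"
    and c: "corner Q a e b" "ccw a e b" and emp: "\<forall>w\<in>set Q - {a,e,b}. \<not> in_tri a e b w" and I: "in_tri a e b x"
  shows "left_side Q x"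
proof -
  let ?S = "insert x (set Q)"
  have S: "a \<in> ?S" "e \<in> ?S" "b \<in> ?S" "x \<in> ?S" using corner_set[OF c(1)] by auto
  have d: "distinct [a,e,b]" "distinct [a,e,b,x]" using corner_distinct[OF _ c(1)] Q x(1) corner_set[OF c(1)] by (auto simp: polygon_def)
  have eds: "(a,e) \<in> edges Q" "(e,b) \<in> edges Q" using corner_edges[OF c(1)] by auto
  obtain \<alpha> \<beta> \<gamma> where co: "\<alpha> > 0" "\<beta> > 0" "\<gamma> > 0" "x = \<alpha> *\<^sub>R a + \<beta> *\<^sub>R e + \<gamma> *\<^sub>R b"
    using in_tri_elim[OF x(2) S d(2) I] by metis
  have D: "det3 a e b \<noteq> 0" using generic_det3[OF x(2) S(1-3)] d by auto
  have no: False if w: "w \<in> set Q" "w' \<in> set Q" "w \<noteq> w'" "w \<noteq> e"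
      and ed: "\<And>c d. (c,d) \<in> edges Q \<Longrightarrow> \<not> crosses w w' c d"
      and eq: "p *\<^sub>R x + q *\<^sub>R e = r *\<^sub>R w + t *\<^sub>R w'" "p > 0" "q > 0" "r > 0" "t > 0"
      and pw: "det3 a w b / det3 a e b > 0" for w w' p q r t
  proof -
    have wab: "w \<noteq> a" "w \<noteq> b" using pw by auto
    obtain \<alpha>' \<beta>' \<gamma>' where cw: "w = \<alpha>' *\<^sub>R a + \<beta>' *\<^sub>R e + \<gamma>' *\<^sub>R b" using coords[OF D] by metis
    have "\<beta>' > 0" using pw det3_coords(2)[OF cw] D by simp
    have "\<not> in_tri a e b w" using emp w wab by auto
    then have neg: "\<alpha>' < 0 \<or> \<gamma>' < 0" using in_tri_coords_neg[OF x(2) S(1-3) _ _ d(1) cw] w wab \<open>\<beta>' > 0\<close> by auto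
    have z: "(p * \<alpha>) *\<^sub>R a + (p * \<beta> + q) *\<^sub>R e + (p * \<gamma>) *\<^sub>R b = r *\<^sub>R w + t *\<^sub>R w'"
      unfolding eq(1)[symmetric] co(4) by (simp add: algebra_simps)
    have "crosses w w' a e \<or> crosses w w' e b"
    proof (rule exit_triangle[OF x(2) S(1-3) _ _ d(1) _ w(3) z _ _ _ _ _ cw neg])
      fix s :: real assume "s > 0"
      then have "p * \<beta> + q > 0" "s * \<beta>' > 0" using eq co \<open>\<beta>' > 0\<close> by (auto intro: add_pos_pos)
      then show "0 < p * \<beta> + q + s * \<beta>'" by linarith
    qed (use w wab eq co in \<open>auto intro: add_pos_pos\<close>)
    then show False using ed eds by blast
  qed
  have "left_side Q x = left_of a e b x"
  proof (rule left_side_corner[OF Q x c(1)])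
    fix w w' assume ww: "(w,w') \<in> edges Q"
    show "\<not> crosses x e w w'"
    proof
      assume X: "crosses x e w w'"
      have wS: "w \<in> set Q" "w' \<in> set Q" using edges_set[OF ww] by auto
      have ne: "w \<noteq> w'" "w \<noteq> e" "w' \<noteq> e" using X by (auto simp: crosses_def)
      obtain p q r t where pos: "p > 0" "q > 0" "r > 0" "t > 0" and eq: "p *\<^sub>R x + q *\<^sub>R e = r *\<^sub>R w + t *\<^sub>R w'"
        using crosses_elim[OF x(2) S(4,2) _ _ X] wS by (metis insert_iff)
      have n1: "\<not> crosses w w' c d" if "(c,d) \<in> edges Q" for c d using simple_no_cross[OF Q(2) ww that] .
      have n2: "\<not> crosses w' w c d" if "(c,d) \<in> edges Q" for c d
        using n1[OF that] crosses_sym(1)[OF x(2), of w w' c d] wS edges_set[OF that] by auto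
      \<comment> \<open>The \<open>e\<close>-coordinates of the crossing point. Its value is
        positive, so one end of the edge has a positive \<open>e\<close>-coordinate too.\<close>
      have sum: "r * (det3 a w b / det3 a e b) + t * (det3 a w' b / det3 a e b) = p * \<beta> + q"
        using det3_cong_comb2[OF eq, of a b] det3_coords(2)[OF co(4)] D by (simp add: field_simps)
      have "p * \<beta> + q > 0" using pos co by (intro add_pos_pos mult_pos_pos)
      then have "det3 a w b / det3 a e b > 0 \<or> det3 a w' b / det3 a e b > 0"
        using sum pos by (smt (verit) mult_nonneg_nonpos)
      then show False
        using no[OF wS ne(1,2) n1 eq pos] no[OF wS(2,1) ne(1)[symmetric] ne(3) n2 _ pos(1,2,4,3)] eq
        by (metis add.commute)
    qed
  qed
  moreover have "left_of a e b x" using I c(2) ccw_cyc unfolding left_of_def in_tri_def by metis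
  ultimately show ?thesis by simp
qed

lemma in_tri_imp_left_of: "in_tri a i b k \<Longrightarrow> ccw a i b \<Longrightarrow> left_of a i b k"
  unfolding left_of_def in_tri_def using ccw_cyc by metis

text \<open>The line through \<open>k\<close> on which \<open>f\<close> is constant cuts off a
  corner at \<open>i\<close> that contains no other vertex. An edge reaching into it would have to
  leave the triangle through \<open>ai\<close> or \<open>ib\<close>, against simplicity, so the arc
  from \<open>i\<close> to \<open>k\<close> is free. Were \<open>k\<close> a left turn, one of its
  own edges would enter the corner.\<close>

lemma exists_chord:
  assumes p: "polygon zs" "simple zs" and c: "corner zs a i b" "ccw a i b"
    and w0: "w0 \<in> set zs - {a,i,b}" "in_tri a i b w0"
  obtains A k B where "chord zs i A k B" "last B = a" "hd A = b" "in_tri a i b k" "k \<in> set zs - {a,i,b}" "\<not> left_turn zs k"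
proof -
  let ?S = "set zs"
  have g: "generic ?S" using p by (simp add: polygon_def)
  have S: "a \<in> ?S" "i \<in> ?S" "b \<in> ?S" and d: "distinct [a,i,b]"
    using corner_set[OF c(1)] corner_distinct[OF _ c(1)] p by (auto simp: polygon_def)
  have eds: "(a,i) \<in> edges zs" "(i,b) \<in> edges zs" using corner_edges[OF c(1)] by auto
  define D where "D = det3 a i b"
  have D: "D > 0" using c(2) by (simp add: ccw_def D_def)
  define al be ga where "al w = det3 w i b / D" and "be w = det3 a w b / D" and "ga w = det3 a i w / D" for w
  have co: "w = al w *\<^sub>R a + be w *\<^sub>R i + ga w *\<^sub>R b" for w
  proof -
    have "w = (1 / D) *\<^sub>R (D *\<^sub>R w)" using D by simp
    also have "D *\<^sub>R w = det3 w i b *\<^sub>R a + det3 a w b *\<^sub>R i + det3 a i w *\<^sub>R b" unfolding D_def by (rule cramer)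
    finally show ?thesis by (simp add: scaleR_add_right al_def be_def ga_def)
  qed
  have lin: "p * al w + q * al w' = r * al x + t * al y" "p * be w + q * be w' = r * be x + t * be y"
    "p * ga w + q * ga w' = r * ga x + t * ga y"
    if "p *\<^sub>R w + q *\<^sub>R w' = r *\<^sub>R x + t *\<^sub>R y" for p q r t w w' x y
  proof -
    have 3: "p * det3 a i w + q * det3 a i w' = r * det3 a i x + t * det3 a i y"
      using det3_cong_comb[OF that, of a i] by (simp add: det3_cyc[symmetric, of _ a i])
    show "p * al w + q * al w' = r * al x + t * al y" "p * be w + q * be w' = r * be x + t * be y"
    "p * ga w + q * ga w' = r * ga x + t * ga y"
      using det3_cong_comb[OF that, of i b] det3_cong_comb2[OF that, of a b] 3 D
      by (simp_all add: al_def be_def ga_def add_divide_distrib[symmetric])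
  qed
  have vals: "al i = 0" "be i = 1" "ga i = 0" "al a = 1" "be a = 0" "ga a = 0" "al b = 0" "be b = 0" "ga b = 1"
    using D by (simp_all add: al_def be_def ga_def D_def)
  have InP: "in_tri a i b w \<longleftrightarrow> al w > 0 \<and> be w > 0 \<and> ga w > 0" for w
    using D c(2) unfolding in_tri_def ccw_def al_def be_def ga_def by (auto simp: zero_less_divide_iff)
  let ?W = "{w \<in> ?S - {a,i,b}. in_tri a i b w}"
  txt \<open>The minimum of f is attained at a vertex of the triangle closest to i.\<close>
  define f where "f w = (al w + ga w) / be w" for w
  obtain k where k: "k \<in> ?W" "\<forall>w\<in>?W. f k \<le> f w"
  proof -
    have "Min (f ` ?W) \<in> f ` ?W" using w0 by (intro Min_in) auto
    then obtain k where k: "k \<in> ?W" "f k = Min (f ` ?W)" by force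
    have "\<forall>w\<in>?W. f k \<le> f w" unfolding k(2) by (intro ballI Min_le) auto
    then show thesis by (rule that[OF k(1)])
  qed
  define c0 where "c0 = f k"
  have kp: "al k > 0" "be k > 0" "ga k > 0" using k InP by auto
  have c0: "c0 > 0" unfolding c0_def f_def using kp by (intro divide_pos_pos add_pos_pos)
  have c1: "al k + ga k = c0 * be k" using kp by (simp add: c0_def f_def)
  \<comment> \<open>The linear form that vanishes on this line; it is negative at \<open>i\<close>
    and nonnegative at every vertex inside the triangle.\<close>
  define G where "G w = al w + ga w - c0 * be w" for w
  have Gv: "G i < 0" "G a > 0" "G b > 0" "G k = 0" using vals c0 c1 by (simp_all add: G_def)
  have GW: "G w \<ge> 0" if "w \<in> ?W" for w
  proof -
    have "c0 \<le> (al w + ga w) / be w" "be w > 0" using k(2) that InP by (auto simp: c0_def f_def)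
    then show ?thesis by (simp add: G_def pos_le_divide_eq)
  qed
  have Glin: "p * G w + q * G w' = r * G x + t * G y" if "p *\<^sub>R w + q *\<^sub>R w' = r *\<^sub>R x + t *\<^sub>R y" for p q r t w w' x y
  proof -
    have "p * G w + q * G w' = (p * al w + q * al w') + (p * ga w + q * ga w') - c0 * (p * be w + q * be w')"
      by (simp add: G_def algebra_simps)
    also have "\<dots> = r * G x + t * G y" unfolding lin[OF that] by (simp add: G_def algebra_simps)
    finally show ?thesis .
  qed
  \<comment> \<open>No edge with an end in \<open>G < 0\<close> other than \<open>i\<close> meets
    the closed corner. The case \<open>p = 0\<close>, where \<open>z\<close> is the end
    \<open>w'\<close> itself, serves for edges ending at \<open>k\<close>.\<close>
  have key: False if w: "w \<in> ?S" "w' \<in> ?S" "w \<noteq> w'" "w \<noteq> i" and Gw: "G w < 0"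
    and ed: "\<And>c d. (c,d) \<in> edges zs \<Longrightarrow> \<not> crosses w w' c d"
    and z: "z = p *\<^sub>R w + q *\<^sub>R w'" "p \<ge> 0" "q > 0" and zp: "al z > 0" "be z > 0" "ga z > 0" "G z \<le> 0"
  for w w' z p q
  proof -
    have wab: "w \<noteq> a" "w \<noteq> b" using Gw Gv by auto
    have "w \<notin> ?W" using GW Gw by force
    then have nI: "\<not> in_tri a i b w" using w wab by auto
    have neg: "al w < 0 \<or> ga w < 0"
    proof (rule in_tri_coords_neg[OF g S w(1) _ d co[of w] nI])
      show "w \<notin> {a,i,b}" using w wab by auto
      assume "al w \<ge> 0" "ga w \<ge> 0"
      then have "c0 * be w > 0" using Gw by (simp add: G_def)
      then show "be w > 0" using c0 by (simp add: zero_less_mult_iff)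
    qed
    have z2: "al z *\<^sub>R a + be z *\<^sub>R i + ga z *\<^sub>R b = p *\<^sub>R w + q *\<^sub>R w'" using co[of z] z by simp
    have "crosses w w' a i \<or> crosses w w' i b"
    proof (rule exit_triangle[OF g S w(1,2) d _ w(3) z2 zp(1-3) z(2,3) co[of w] neg])
      show "w \<notin> {a,i,b}" using w wab by auto
      fix s :: real assume s: "s > 0" "0 \<le> al z + s * al w" "0 \<le> ga z + s * ga w"
      have "G z + s * G w < 0" using zp(4) s(1) Gw by (simp add: add_nonpos_neg mult_pos_neg)
      then have "c0 * (be z + s * be w) > (al z + s * al w) + (ga z + s * ga w)" by (simp add: G_def algebra_simps)
      then have "c0 * (be z + s * be w) > 0" using s by linarith
      then show "be z + s * be w > 0" using c0 by (simp add: zero_less_mult_iff)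
    qed
    then show False using ed eds by blast
  qed
  have kS: "k \<in> ?S" "k \<notin> {a,i,b}" "in_tri a i b k" using k by auto
  have free: "\<not> crosses i k w w'" if ww: "(w,w') \<in> edges zs" for w w'
  proof
    assume X: "crosses i k w w'"
    have wS: "w \<in> ?S" "w' \<in> ?S" using edges_set[OF ww] by auto
    have ne: "w \<noteq> w'" "w \<noteq> i" "w' \<noteq> i" using X by (auto simp: crosses_def)
    obtain p q r t where pos: "p > 0" "q > 0" "r > 0" "t > 0" and eq: "p *\<^sub>R i + q *\<^sub>R k = r *\<^sub>R w + t *\<^sub>R w'"
      using crosses_elim[OF g S(2) kS(1) wS X] by metis
    define z where "z = p *\<^sub>R i + q *\<^sub>R k"
    have eqz: "1 *\<^sub>R z + 0 *\<^sub>R z = p *\<^sub>R i + q *\<^sub>R k" by (simp add: z_def)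
    have zv: "al z = q * al k" "be z = p + q * be k" "ga z = q * ga k" "G z = p * G i"
      using lin[OF eqz] Glin[OF eqz] vals Gv by simp_all
    have zp: "al z > 0" "be z > 0" "ga z > 0" "G z < 0" using zv kp pos Gv by (auto intro: add_pos_pos mult_pos_neg)
    have "p * G i < 0" using pos Gv by (simp add: mult_pos_neg)
    then have "r * G w + t * G w' < 0" using Glin[OF eq] Gv by simp
    then consider "G w < 0" | "G w' < 0" using pos by (smt (verit) mult_nonneg_nonneg)
    then show False
    proof cases
      case 1
      show False
        using key[OF wS ne(1,2) 1 simple_no_cross[OF p(2) ww], of z r t] eq pos zp by (simp add: z_def)
    next
      case 2
      have "\<not> crosses w' w c d" if "(c,d) \<in> edges zs" for c d
        using crosses_sym(1)[OF g wS, of c d] edges_set[OF that] simple_no_cross[OF p(2) ww that] by auto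
      then show False
        using key[OF wS(2,1) ne(1)[symmetric] ne(3) 2, of z t r] eq pos zp by (simp add: z_def add.commute)
    qed
  qed
  obtain u where u: "rotated zs (i # b # u @ [a])" using c(1) corner_rotated_hd by metis
  have "k \<in> set u" using kS rotated_set[OF u] by auto
  then obtain u1 u2 where uu: "u = u1 @ k # u2" by (meson split_list)
  define A B where "A = b # u1" and "B = u2 @ [a]"
  have ch: "chord zs i A k B" using u uu free by (auto simp: chord_def A_def B_def)
  have hl: "last B = a" "hd A = b" by (auto simp: A_def B_def)
  have "\<not> left_turn zs k"
  proof
    assume pk: "left_turn zs k"
    have r: "rotated zs (i # A @ k # B)" and AB: "A \<noteq> []" "B \<noteq> []" using ch by (auto simp: chord_def)
    have dist: "distinct (i # A @ k # B)" and AS: "set (i # A @ k # B) = ?S" using rotated_distinct[OF r] rotated_set[OF r] p by (auto simp: polygon_def)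
    define x y where "x = last A" and "y = hd B"
    have mem: "x \<in> set A" "y \<in> set B" using AB by (auto simp: x_def y_def)
    have xy: "x \<in> ?S" "y \<in> ?S" "distinct [i,x,k,y]" using mem AS dist by auto
    have AB': "A = butlast A @ [x]" "B = y # tl B" using AB by (simp_all add: x_def y_def)
    have "i # A @ k # B = i # (butlast A @ [x]) @ k # (y # tl B)" by (subst AB'(1)[symmetric], subst AB'(2)[symmetric]) (rule refl)
    then have r2: "rotated zs ((i # butlast A) @ x # k # y # tl B)" using r by simp
    have cn: "corner zs x k y"
      using corner_infix[of "i # butlast A" x k y "tl B"] corner_rotated[OF r2, of x k y] by blast
    then have cc: "ccw x k y" using pk left_turn_corner[OF p(1)] by blast
    have "left_of a i b k" using in_tri_imp_left_of kS c(2) by blast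
    moreover have "(\<not> left_of x k y i) = (\<not> left_of a i b k)"
      using chord_left_side[OF ch p mem(2)] hl by (auto simp: x_def y_def)
    ultimately have L: "ccw k y i" "ccw x k i" using cc by (auto simp: left_of_def)
    \<comment> \<open>Up to a multiple of \<open>k\<close>, the vertex \<open>i\<close> is a
      positive combination of the neighbours \<open>x\<close> and \<open>y\<close>. As
      \<open>G\<close> is zero at \<open>k\<close> and negative at \<open>i\<close>, it is negative
      at \<open>x\<close> or at \<open>y\<close>.\<close>
    have eq: "det3 x k y *\<^sub>R i + (- det3 x i y) *\<^sub>R k = det3 i k y *\<^sub>R x + det3 x k i *\<^sub>R y"
      using cramer[of x k y i] by (simp add: algebra_simps)
    have "det3 x k y * G i = det3 i k y * G x + det3 x k i * G y" using Glin[OF eq] Gv by simp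
    moreover have "det3 x k y > 0" "det3 i k y > 0" "det3 x k i > 0"
      using cc L ccw_cyc(1)[of k y i] by (auto simp: ccw_def)
    ultimately have "det3 i k y * G x + det3 x k i * G y < 0" using Gv by (metis mult_pos_neg)
    then consider "G x < 0" | "G y < 0" using \<open>det3 i k y > 0\<close> \<open>det3 x k i > 0\<close> by (smt (verit) mult_nonneg_nonneg)
    then obtain w where w: "w \<in> {x,y}" "G w < 0" by auto
    have "\<not> crosses w k c d" if "(c,d) \<in> edges zs" for c d
    proof -
      have "(x,k) \<in> edges zs" "(k,y) \<in> edges zs" using corner_edges[OF cn] by auto
      then have "\<not> crosses x k c d" "\<not> crosses k y c d" using simple_no_cross[OF p(2)] that by auto
      then show ?thesis using w crosses_sym(1)[OF g xy(2) kS(1), of c d] edges_set[OF that] by auto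
    qed
    then show False using key[of w k k 0 1] w xy kS kp Gv by auto
  qed
  then show thesis using that[OF ch hl] kS by blast
qed

lemma infix_mid: assumes "p \<in> set A" shows "\<exists>L x y R. u # A @ [v] = L @ x # p # y # R"
proof -
  obtain A1 A2 where A: "A = A1 @ p # A2" using assms by (meson split_list)
  have "u # A1 = butlast (u # A1) @ [last (u # A1)]" by (metis append_butlast_last_id list.discI)
  moreover have "A2 @ [v] = hd (A2 @ [v]) # tl (A2 @ [v])" by (cases A2) auto
  ultimately have "u # A @ [v] = butlast (u # A1) @ last (u # A1) # p # hd (A2 @ [v]) # tl (A2 @ [v])"
    using A by (metis append.assoc append_Cons append_Nil)
  then show ?thesis by blast
qed

lemma corner_sub:
  assumes "p \<in> set A" "rotated zs (u # A @ v # B)"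
  shows "\<exists>x y. corner (u # A @ [v]) x p y \<and> corner zs x p y"
proof -
  obtain L x y R where e: "u # A @ [v] = L @ x # p # y # R" using infix_mid[OF assms(1)] by metis
  then have eq: "u # A @ v # B = L @ x # p # y # (R @ B)" by (metis append.assoc append_Cons append_Nil)
  have "rotated zs (L @ x # p # y # (R @ B))" using assms(2) by (simp only: eq)
  then show ?thesis using e corner_infix[of L x p y R] corner_infix[of L x p y "R @ B"] corner_rotated by metis
qed

lemma left_turn_sub:
  assumes "p \<in> set A" "rotated zs (u # A @ v # B)" "polygon zs" "polygon (u # A @ [v])"
  shows "left_turn (u # A @ [v]) p = left_turn zs p"
  using corner_sub[OF assms(1,2)] left_turn_corner assms(3,4) by metis

text \<open>The vertices of \<open>B\<close> lie on the right of the part, whereas by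
  \<open>left_side_in_ear\<close> the triangle of its ear lies on the left. As \<open>e\<close> is
  not an end of the chord, its neighbours are the same in both polygons.\<close>

lemma chord_ear:
  assumes ch: "chord zs i A k B" and p: "polygon zs" "simple zs" and e: "ear (i # A @ [k]) e" "e \<in> set A"
    and L: "left_of (last B) i (hd A) k"
  shows "ear zs e"
proof -
  let ?Q = "i # A @ [k]"
  have r: "rotated zs (i # A @ k # B)" using ch by (simp add: chord_def)
  have Q: "polygon ?Q" "simple ?Q" using chord_polygon[OF ch p] .
  obtain x y where xy: "corner ?Q x e y" "corner zs x e y" using corner_sub[OF e(2) r] by metis
  have cc: "ccw x e y" and emp: "\<forall>w\<in>set ?Q - {x,e,y}. \<not> in_tri x e y w"
    using e(1) xy(1) corner_unique[of ?Q] Q unfolding ear_def polygon_def by metis+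
  have "\<not> in_tri x e y w" if w: "w \<in> set zs - {x,e,y}" for w
  proof (cases "w \<in> set ?Q")
    case True then show ?thesis using emp w by blast
  next
    case False
    then have wB: "w \<in> set B" using w rotated_set[OF r] by auto
    have gz: "generic (set zs)" using p by (simp add: polygon_def)
    have "insert w (set ?Q) \<subseteq> set zs" unfolding rotated_set[OF r, symmetric] using wB by auto
    then have "generic (insert w (set ?Q))" by (rule generic_subset[OF gz])
    moreover have "\<not> left_side ?Q w" using chord_left_side(2)[OF ch p wB] L by simp
    ultimately show ?thesis using left_side_in_ear[OF Q False _ xy(1) cc emp] by blast
  qed
  then show ?thesis using xy cc ear_def by blast
qed

lemma hull_vertex_subset: "hull_vertex S a \<Longrightarrow> T \<subseteq> S \<Longrightarrow> a \<in> T \<Longrightarrow> hull_vertex T a"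
  unfolding hull_vertex_def by blast

text \<open>The chord runs inside the angle at \<open>i\<close>, so both parts inherit the left turn
  there.\<close>

lemma chord_ends:
  assumes ch: "chord zs i A k B" and p: "polygon zs" "simple zs" and a: "last B = a" "hd A = b"
    and c: "corner zs a i b" "ccw a i b" and I: "in_tri a i b k"
  shows "left_turn (i # A @ [k]) i" "left_turn (k # B @ [i]) i" "left_of (last B) i (hd A) k"
proof -
  have ne: "A \<noteq> []" "B \<noteq> []" using ch by (auto simp: chord_def)
  have "corner (i # A @ [k]) k i b" using corner_hd[of i "hd A" "tl A" k] ne a by (metis append_Cons list.collapse)
  moreover have "corner (k # B @ [i]) a i k"
  proof -
    have "B @ [i] = butlast B @ [a, i]" using append_butlast_last_id[OF ne(2)] a by (metis append.assoc append_Cons append_Nil)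
    then show ?thesis using corner_last[of k "butlast B" a i] by metis
  qed
  moreover have "ccw k i b" "ccw a i k" using I c(2) by (auto simp: in_tri_def)
  ultimately show "left_turn (i # A @ [k]) i" "left_turn (k # B @ [i]) i" unfolding left_turn_def by blast+
  show "left_of (last B) i (hd A) k" using in_tri_imp_left_of[OF I c(2)] a by simp
qed

lemma chord_length: "chord zs i A k B \<Longrightarrow> length (i # A @ [k]) < length zs"
  using rotated_length[of zs "i # A @ k # B"] by (cases B) (auto simp: chord_def)

text \<open>The claim is an ear off a prescribed edge, which for the parts is the chord. Take a hull
  vertex \<open>i\<close> off that edge; if it is not an ear itself, a chord from \<open>i\<close>
  gives two parts that have \<open>i\<close> as a left-turning hull vertex, and each has an ear off
  the chord.\<close>

lemma exists_ear:
  "polygon zs \<Longrightarrow> simple zs \<Longrightarrow> \<forall>z\<in>set zs. h \<bullet> z > 0 \<Longrightarrow> (\<And>p. hull_vertex (set zs) p \<Longrightarrow> left_turn zs p) \<Longrightarrow>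
    zs = m # A @ [k] \<Longrightarrow> \<exists>e\<in>set A. ear zs e"
proof (induction "length zs" arbitrary: zs m A k rule: less_induct)
  case less
  note p = less.prems(1,2)
  have g: "generic (set zs)" "card (set zs) \<ge> 3" "distinct zs" using p polygon_card by (auto simp: polygon_def)
  have mk: "m \<in> set zs" "k \<in> set zs" "m \<noteq> k" using less.prems(5) g(3) by auto
  obtain i where i: "hull_vertex (set zs) i" "i \<notin> {m,k}" using exists_hull_vertex[OF _ g(1,2) less.prems(3) mk] by auto
  have iA: "i \<in> set A" and iz: "i \<in> set zs" using i less.prems(5) by (auto simp: hull_vertex_def)
  obtain a b where c: "corner zs a i b" using corner_exists[OF p(1) iz] by metis
  have cc: "ccw a i b" using less.prems(4)[OF i(1)] left_turn_corner[OF p(1) c] by simp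
  show ?case
  proof (cases "\<exists>w\<in>set zs - {a,i,b}. in_tri a i b w")
    case False
    then show ?thesis using c cc iA ear_def by blast
  next
    case True
    then obtain A' k' B' where ch: "chord zs i A' k' B'" and la: "last B' = a" "hd A' = b" and I: "in_tri a i b k'"
      using exists_chord[OF p c cc] by metis
    have ch2: "chord zs k' B' i A'" using chord_sym[OF ch p(1)] .
    have r: "rotated zs (i # A' @ k' # B')" using ch by (simp add: chord_def)
    have rs: "set (i # A' @ k' # B') = set zs" "distinct (i # A' @ k' # B')" using rotated_set[OF r] rotated_distinct[OF r] g(3) by auto
    note ends = chord_ends[OF ch p la c cc I]
    have L2: "left_of (last A') k' (hd B') i"
    proof -
      have "hd B' \<in> set B'" using ch by (auto simp: chord_def)
      from chord_left_side[OF ch p this] ends(3) show ?thesis by simp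
    qed
    have ear1: "\<exists>e\<in>set A'. ear zs e"
    proof -
      let ?Q = "i # A' @ [k']"
      have Q: "polygon ?Q" "simple ?Q" using chord_polygon[OF ch p] .
      have sub: "set ?Q \<subseteq> set zs" using rs by auto
      have hQ: "\<forall>z\<in>set ?Q. h \<bullet> z > 0" using less.prems(3) sub by blast
      have "hull_vertex (set ?Q) i" using hull_vertex_subset[OF i(1) sub] by simp
      then have "left_turn ?Q q" if "hull_vertex (set ?Q) q" for q using hull_left_turn_eq[OF Q hQ that] ends(1) by blast
      then have "\<exists>e\<in>set A'. ear ?Q e" using less.hyps[OF chord_length[OF ch] Q hQ] by blast
      then show ?thesis using chord_ear[OF ch p _ _ ends(3)] by blast
    qed
    have ear2: "\<exists>e\<in>set B'. ear zs e"
    proof -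
      let ?Q = "k' # B' @ [i]"
      have Q: "polygon ?Q" "simple ?Q" using chord_polygon[OF ch2 p] .
      have sub: "set ?Q \<subseteq> set zs" using rs by auto
      have hQ: "\<forall>z\<in>set ?Q. h \<bullet> z > 0" using less.prems(3) sub by blast
      have "hull_vertex (set ?Q) i" using hull_vertex_subset[OF i(1) sub] by simp
      then have "left_turn ?Q q" if "hull_vertex (set ?Q) q" for q using hull_left_turn_eq[OF Q hQ that] ends(2) by blast
      then have "\<exists>e\<in>set B'. ear ?Q e" using less.hyps[OF chord_length[OF ch2] Q hQ] by blast
      then show ?thesis using chord_ear[OF ch2 p _ _ L2] by blast
    qed
    \<comment> \<open>The prescribed edge belongs to one of the parts, so the ear found in the other
      part avoids its ends.\<close>
    have "(k,m) \<in> edges zs" using edges_chord[of m A k] less.prems(5) by auto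
    then have "(k,m) \<in> path_edges (i # A' @ [k']) \<union> path_edges (k' # B' @ [i])" using edges_split[of i A' k' B'] rotated_edges[OF r] by simp
    then have "{k,m} \<subseteq> set (i # A' @ [k']) \<or> {k,m} \<subseteq> set (k' # B' @ [i])" using path_edges_set[of k m] by blast
    then have "{k,m} \<inter> set A' = {} \<or> {k,m} \<inter> set B' = {}" using rs(2) by auto
    moreover have "set A' \<subseteq> set zs" "set B' \<subseteq> set zs" using rs by auto
    moreover have "set zs \<subseteq> {m,k} \<union> set A" using less.prems(5) by auto
    ultimately show ?thesis using ear1 ear2 by blast
  qed
qed

section \<open>Cutting off an ear\<close>

text \<open>By the triangle parity, an edge crossing the new edge \<open>ab\<close> would cross
  \<open>ai\<close> or \<open>ib\<close> or end inside the empty triangle. The angles on the left at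
  \<open>a\<close> and \<open>b\<close> shrink, so left turns there persist, while right turns may
  become left.\<close>

lemma delete_ear:
  assumes zs: "zs = i # b # ws @ [a]" "ws \<noteq> []" and p: "polygon zs" "simple zs"
    and cc: "ccw a i b" and emp: "\<forall>w\<in>set ws. \<not> in_tri a i b w"
  defines "Q \<equiv> b # ws @ [a]"
  shows "polygon Q" "simple Q" "\<not> left_side Q i" "\<And>q. q \<in> set ws \<Longrightarrow> left_turn Q q = left_turn zs q"
    "left_turn zs b \<Longrightarrow> left_turn Q b" "left_turn zs a \<Longrightarrow> left_turn Q a"
proof -
  have g: "generic (set zs)" and dist: "distinct zs" using p by (auto simp: polygon_def)
  have S: "a \<in> set zs" "i \<in> set zs" "b \<in> set zs" "set ws \<subseteq> set zs" "set Q \<subseteq> set zs" using zs Q_def by auto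
  have ne: "a \<noteq> i" "b \<noteq> i" "a \<noteq> b" "i \<notin> set Q" "{a,i,b} \<inter> set ws = {}" using dist zs Q_def by auto
  have "generic (set Q)" using generic_subset[OF g S(5)] .
  then show pQ: "polygon Q" using p zs unfolding polygon_def Q_def by (cases ws) auto
  have Ez: "edges zs = insert (i,b) (insert (a,i) (path_edges Q))"
    using path_edges_snoc[of "i # b # ws @ [a]" i] zs by (auto simp: edges_def closed_path_def Q_def)
  have EQ: "edges Q = insert (a,b) (path_edges Q)" using edges_chord[of b ws a] by (simp add: Q_def)
  have noab: "\<not> crosses a b w w'" if ww: "(w,w') \<in> path_edges Q" for w w'
  proof (cases "{w,w'} \<inter> {a,b} = {}")
    case False then show ?thesis by auto
  next
    case True
    have wS: "w \<in> set Q" "w' \<in> set Q" using path_edges_set[OF ww] by auto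
    then have wz: "w \<in> set zs" "w' \<in> set zs" using S by auto
    have ww': "w \<noteq> w'" using path_edges_neq[OF _ ww] pQ by (simp add: polygon_def)
    have inw: "w \<in> set ws" "w' \<in> set ws" using True wS Q_def by auto
    have d: "distinct [w,w',a,i,b]" using True ww' ne wS by auto
    have "((crosses w w' a i \<noteq> crosses w w' i b) \<noteq> crosses w w' b a) = (in_tri a i b w \<noteq> in_tri a i b w')"
      using parity_triangle[OF g wz S(1-3) d] .
    moreover have "\<not> crosses w w' a i" "\<not> crosses w w' i b" using simple_no_cross[OF p(2)] ww Ez by auto
    ultimately have "\<not> crosses w w' b a" using emp inw by auto
    then show ?thesis using crosses_sym(3)[OF g S(1,3) wz] crosses_sym(2)[OF g wz S(1,3)] by simp
  qed
  have noab2: "\<not> crosses w w' a b" if ww: "(w,w') \<in> path_edges Q" for w w'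
  proof -
    have "w \<in> set zs" "w' \<in> set zs" using path_edges_set[OF ww] S by auto
    then show ?thesis using noab[OF ww] crosses_sym(3)[OF g S(1,3)] by auto
  qed
  show sQ: "simple Q" unfolding simple_def EQ using noab noab2 simple_no_cross[OF p(2)] Ez by auto
  define c where "c = hd ws"
  define d where "d = last ws"
  have cd: "c \<in> set ws" "d \<in> set ws" using zs c_def d_def by auto
  then have cdz: "c \<in> set zs" "d \<in> set zs" "distinct [b,a,i,c]" "distinct [a,b,i,d]" using S ne by auto
  have bc: "(b,c) \<in> path_edges Q" "(d,a) \<in> path_edges Q" using zs(2) path_edges_snoc[of "b # ws" a] c_def d_def by (auto simp: Q_def neq_Nil_conv)
  have cornQ: "corner Q a b c" using corner_hd[of b c "tl ws" a] zs(2) c_def by (metis Q_def append_Cons list.collapse)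
  have dws: "ws @ [a] = butlast ws @ [d, a]" using append_butlast_last_id[OF zs(2)] d_def by (metis append.assoc append_Cons append_Nil)
  have cornQ2: "corner Q d a b" using corner_last[of b "butlast ws" d a] dws by (metis Q_def)
  have cornz: "corner zs i b c"
    using corner_infix[of "[]" i b c "tl ws @ [a]"] zs c_def by (metis append_Cons append_Nil list.collapse)
  have cornz2: "corner zs d a i"
  proof -
    have "zs = i # (b # butlast ws) @ [d, a]" using zs dws by simp
    then show ?thesis using corner_last[of i "b # butlast ws" d a] by simp
  qed
  \<comment> \<open>The next vertex \<open>c\<close> is neither in the triangle nor across
    \<open>ai\<close>, hence not in the lune of the triangle at \<open>b\<close>. Symmetrically for
    \<open>d\<close> at \<open>a\<close> below.\<close>
  have "\<not> crosses b c a i" using simple_no_cross[OF p(2)] bc Ez by auto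
  then have 1: "\<not> sector b a i c" using crosses_corner[OF g S(3,1,2) cdz(1,3)] emp cd in_tri_cyc by metis
  have "\<not> crosses d a i b" using simple_no_cross[OF p(2)] bc Ez by auto
  then have "\<not> crosses a d b i" using crosses_sym(1)[OF g cdz(2) S(1,2,3)] crosses_sym(2)[OF g S(1) cdz(2) S(2,3)] by simp
  moreover have "in_tri a b i d = in_tri a i b d"
  proof -
    have "ccw a b i = (\<not> ccw a i b)" "ccw d b i = (\<not> ccw d i b)" "ccw a d i = (\<not> ccw a i d)" "ccw a b d = (\<not> ccw a d b)"
      using ccw_swap(2)[OF g S(1,2,3)] ccw_swap(2)[OF g cdz(2) S(2,3)] ccw_swap(2)[OF g S(1,2) cdz(2)]
        ccw_swap(2)[OF g S(1) cdz(2) S(3)] cdz(4) ne(1-3) by auto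
    then show ?thesis unfolding in_tri_def by auto
  qed
  ultimately have 2: "\<not> sector a b i d" using crosses_corner[OF g S(1,3,2) cdz(2,4)] emp cd by simp
  have dne: "b \<noteq> c" "a \<noteq> c" "d \<noteq> a" "d \<noteq> i" using cdz(3,4) by auto
  have e: "ccw b a i = ccw a i b" "ccw b a c = (\<not> ccw a b c)" "ccw a b i = (\<not> ccw a i b)"
    "ccw a d i = (\<not> ccw d a i)" "ccw a b d = ccw d a b"
  proof -
    show "ccw b a i = ccw a i b" by (rule ccw_cyc(2))
    show "ccw b a c = (\<not> ccw a b c)" by (rule ccw_swap(1)[OF g S(1,3) cdz(1) ne(3) dne(1,2)])
    show "ccw a b i = (\<not> ccw a i b)" by (rule ccw_swap(2)[OF g S(1,2,3) ne(1) ne(2)[symmetric] ne(3)])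
    show "ccw a d i = (\<not> ccw d a i)" by (rule ccw_swap(1)[OF g cdz(2) S(1,2) dne(3) ne(1) dne(4)])
    show "ccw a b d = ccw d a b" by (rule ccw_cyc(1))
  qed
  have f: "ccw b c i = ccw i b c" by (simp add: ccw_cyc)
  have 3: "\<not> (ccw i b c \<and> \<not> ccw a b c)" using 1 cc f e(1,2) unfolding sector_def by auto
  show "left_turn zs b \<Longrightarrow> left_turn Q b" using 3 left_turn_corner[OF p(1) cornz] left_turn_corner[OF pQ cornQ] by auto
  show "left_turn zs a \<Longrightarrow> left_turn Q a" using 2 cc e(3-5) left_turn_corner[OF p(1) cornz2] left_turn_corner[OF pQ cornQ2] unfolding sector_def by auto
  have "left_side Q i = left_of a b c i"
  proof (rule left_side_corner[OF pQ sQ ne(4) _ cornQ])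
    show "generic (insert i (set Q))" using S by (intro generic_subset[OF g]) auto
    fix u v assume uv: "(u,v) \<in> edges Q"
    show "\<not> crosses i b u v"
    proof (cases "(u,v) = (a,b)")
      case False
      then show ?thesis using uv EQ Ez simple_no_cross[OF p(2)] by auto
    qed auto
  qed
  also have "\<dots> = (if ccw a b c then ccw b c i \<and> ccw a b i else ccw b c i \<or> ccw a b i)" by (simp add: left_of_def)
  finally show "\<not> left_side Q i" using 3 f e(3) cc by auto
  fix q assume q: "q \<in> set ws"
  have "rotated zs (b # ws @ a # [i])" using rotated_append[of "[i]" "b # ws @ [a]"] zs by simp
  then show "left_turn Q q = left_turn zs q" using left_turn_sub[OF q] p(1) pQ by (simp add: Q_def)
qed

section \<open>Balanced polygons\<close>

definition hemispheric :: "(real^3) set \<Rightarrow> bool" where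
  "hemispheric S \<longleftrightarrow> (\<exists>h. \<forall>z\<in>S. h \<bullet> z > 0)"

text \<open>At most two changes of the turning direction.\<close>

definition two_blocks :: "(real^3) list \<Rightarrow> bool" where
  "two_blocks zs \<longleftrightarrow> (\<exists>us vs. rotated zs (us @ vs) \<and> (\<forall>p\<in>set us. left_turn zs p) \<and> (\<forall>p\<in>set vs. \<not> left_turn zs p))"

lemma hemispheric_subset: "hemispheric S \<Longrightarrow> T \<subseteq> S \<Longrightarrow> hemispheric T" unfolding hemispheric_def by blast

lemma dual_vector:
  assumes "det3 a b c \<noteq> 0"
  obtains h where "h \<bullet> a = x" "h \<bullet> b = y" "h \<bullet> c = z"
proof -
  define h where "h = (x / det3 a b c) *\<^sub>R cross3 b c + (y / det3 a b c) *\<^sub>R cross3 c a + (z / det3 a b c) *\<^sub>R cross3 a b"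
  have "h \<bullet> w = (x / det3 a b c) * det3 b c w + (y / det3 a b c) * det3 c a w + (z / det3 a b c) * det3 a b w" for w
    by (simp add: h_def inner_add_left det3_def)
  moreover have "det3 b c a = det3 a b c" "det3 c a b = det3 a b c" using det3_cyc by metis+
  ultimately have "h \<bullet> a = x" "h \<bullet> b = y" "h \<bullet> c = z" using assms by simp_all
  then show thesis using that by blast
qed

lemma hemispheric_triple: assumes "det3 a b c \<noteq> 0" shows "hemispheric {a,b,c}"
  using dual_vector[OF assms, of 1 1 1] unfolding hemispheric_def by (metis empty_iff insert_iff zero_less_one)

text \<open>The sign condition makes the \<open>a\<close>-coordinate \<open>r\<close> of
  \<open>d\<close> positive. With the value 1 at \<open>b\<close> and \<open>c\<close>, a large
  enough value at \<open>a\<close> therefore makes \<open>h\<close> positive at \<open>d\<close>;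
  the choice below gives at least 1.\<close>

lemma hemispheric_quad:
  assumes "det3 a b c * det3 b c d > 0" shows "hemispheric {a,b,c,d}"
proof -
  let ?D = "det3 a b c"
  have D: "?D \<noteq> 0" using assms by auto
  define r where "r = det3 b c d / ?D"
  define P where "P = det3 a d c / ?D"
  define Q where "Q = det3 a b d / ?D"
  have r: "r > 0" using assms by (auto simp: r_def zero_less_divide_iff zero_less_mult_iff)
  obtain h where h: "h \<bullet> a = (1 + \<bar>P\<bar> + \<bar>Q\<bar>) / r" "h \<bullet> b = 1" "h \<bullet> c = 1" using dual_vector[OF D] by blast
  have "?D * (h \<bullet> d) = det3 d b c * (h \<bullet> a) + det3 a d c * (h \<bullet> b) + det3 a b d * (h \<bullet> c)"
    using arg_cong[OF cramer[of a b c d], of "\<lambda>v. h \<bullet> v"] by (simp add: inner_add_right)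
  moreover have "det3 d b c = det3 b c d" by (metis det3_cyc)
  ultimately have "h \<bullet> d = r * (h \<bullet> a) + P * (h \<bullet> b) + Q * (h \<bullet> c)"
    using D by (simp add: r_def P_def Q_def field_simps)
  then have "h \<bullet> d = 1 + \<bar>P\<bar> + \<bar>Q\<bar> + P + Q" using h r by simp
  then have "h \<bullet> d > 0" by linarith
  moreover have "h \<bullet> a > 0" using h r by simp
  ultimately show ?thesis unfolding hemispheric_def using h by (intro exI[of _ h]) auto
qed

text \<open>Helly's theorem for the half-spaces of all \<open>h\<close> positive at a given vertex.
  With five vertices, any four omit one, so if every vertex were critical, every four half-spaces
  would meet.\<close>

lemma exists_noncritical:
  assumes S: "finite S" "5 \<le> card S" and n: "\<not> hemispheric S"
  shows "\<exists>m\<in>S. \<not> hemispheric (S - {m})"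
proof (rule ccontr)
  assume "\<not> ?thesis"
  then have all: "hemispheric (S - {m})" if "m \<in> S" for m using that by blast
  have small: "hemispheric T" if "T \<subseteq> S" "card T \<le> 4" for T
  proof -
    have "T \<noteq> S" using that S by auto
    then obtain m where m: "m \<in> S" "m \<notin> T" using \<open>T \<subseteq> S\<close> by blast
    then have "T \<subseteq> S - {m}" using \<open>T \<subseteq> S\<close> by blast
    then show ?thesis using all[OF m(1)] hemispheric_subset by blast
  qed
  let ?F = "\<lambda>z. {h::real^3. h \<bullet> z > 0}"
  have inter: "(\<Inter>(?F ` T) \<noteq> {}) = hemispheric T" for T unfolding hemispheric_def by auto
  have sub: "\<Inter>t \<noteq> {}" if tt: "t \<subseteq> ?F ` S" "card t \<le> 4" for t
  proof -
    obtain T where T: "T \<subseteq> S" "inj_on ?F T" "t = ?F ` T"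
      using iffD1[OF subset_image_inj tt(1)] by blast
    then have "card T = card t" using card_image[OF T(2)] by (simp only:)
    then have "hemispheric T" using small[OF T(1)] tt(2) by (simp only:)
    then show ?thesis unfolding T(3) inter[of T] .
  qed
  \<comment> \<open>Different vectors may define the same half-space, so the family can be too small
    for Helly's theorem.\<close>
  have "\<Inter>(?F ` S) \<noteq> {}"
  proof (cases "card (?F ` S) \<le> 4")
    case True then show ?thesis using sub by blast
  next
    case False
    have cv: "convex (?F z)" for z :: "real^3"
      using convex_halfspace_gt[of 0 z] by (simp add: inner_commute)
    show ?thesis
      by (rule Helly) (use False cv sub in auto)
  qed
  then show False using n inter by blast
qed

section \<open>The antipodal image\<close>

text \<open>The antipodal map exchanges left and right turns but keeps crossings and the property of
  lying in an open hemisphere.\<close>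

definition mirror :: "(real^3) list \<Rightarrow> (real^3) list" where "mirror zs = map uminus zs"

lemma ccw_mirror:
  assumes "generic S" "a \<in> S" "b \<in> S" "c \<in> S" "a \<noteq> b" "b \<noteq> c" "a \<noteq> c"
  shows "ccw (-a) (-b) (-c) = (\<not> ccw a b c)"
  using generic_det3[OF assms] by (auto simp: ccw_def det3_neg)

lemma mirror_set: "set (mirror zs) = uminus ` set zs" by (simp add: mirror_def)

lemma mirror_generic: "generic S \<Longrightarrow> generic (uminus ` S)"
  unfolding generic_def by (auto simp: det3_neg)

lemma mirror_polygon: "polygon zs \<Longrightarrow> polygon (mirror zs)"
  unfolding polygon_def by (auto simp: mirror_set mirror_generic) (simp_all add: mirror_def distinct_map)

lemma mirror_crosses:
  assumes "generic S" "a \<in> S" "b \<in> S" "c \<in> S" "d \<in> S"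
  shows "crosses (-a) (-b) (-c) (-d) = crosses a b c d"
proof (cases "distinct [a,b,c,d]")
  case True
  then have "ccw (-b) (-c) (-d) = (\<not> ccw b c d)" "ccw (-a) (-c) (-d) = (\<not> ccw a c d)"
     "ccw (-a) (-b) (-d) = (\<not> ccw a b d)" "ccw (-a) (-b) (-c) = (\<not> ccw a b c)"
    using ccw_mirror[OF assms(1)] assms(2-) by auto
  then show ?thesis unfolding crosses_def by auto
next
  case False then show ?thesis unfolding crosses_def by auto
qed

lemma path_edges_map: "path_edges (map f w) = (\<lambda>(a,b). (f a, f b)) ` path_edges w"
  by (induction w rule: path_edges.induct) auto

lemma mirror_edges: "edges (mirror zs) = (\<lambda>(a,b). (-a, -b)) ` edges zs"
proof (cases zs)
  case (Cons z w)
  then have "closed_path (mirror zs) = map uminus (closed_path zs)" by (simp add: closed_path_def mirror_def)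
  then show ?thesis by (simp add: edges_def path_edges_map)
next
  case Nil then show ?thesis by (simp add: edges_def mirror_def closed_path_def)
qed

lemma mirror_simple: assumes "polygon zs" "simple zs" shows "simple (mirror zs)"
proof -
  have "\<not> crosses (-a) (-b) (-c) (-d)" if "(a,b) \<in> edges zs" "(c,d) \<in> edges zs" for a b c d
    using mirror_crosses[of "set zs" a b c d] edges_set[OF that(1)] edges_set[OF that(2)] simple_no_cross[OF assms(2) that] assms(1)
    by (simp add: polygon_def)
  then show ?thesis unfolding simple_def mirror_edges by auto
qed

lemma mirror_rotated: "rotated zs zs' \<Longrightarrow> rotated (mirror zs) (mirror zs')"
  unfolding rotated_def mirror_def by (auto simp: rotate_map)

lemma mirror_corner: "corner zs a p b \<Longrightarrow> corner (mirror zs) (-a) (-p) (-b)"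
  unfolding corner_def using mirror_rotated by (fastforce simp: mirror_def)

lemma mirror_left_turn: assumes "polygon zs" "p \<in> set zs" shows "left_turn (mirror zs) (-p) = (\<not> left_turn zs p)"
proof -
  obtain a b where c: "corner zs a p b" using corner_exists assms by metis
  have "distinct [a,p,b]" using corner_distinct[OF _ c] assms by (auto simp: polygon_def)
  then have "ccw (-a) (-p) (-b) = (\<not> ccw a p b)"
    using corner_set[OF c] assms by (intro ccw_mirror[of "set zs"]) (auto simp: polygon_def)
  then show ?thesis using left_turn_corner[OF assms(1) c] left_turn_corner[OF mirror_polygon[OF assms(1)] mirror_corner[OF c]] by simp
qed

lemma mirror_two_blocks: assumes "polygon zs" "two_blocks zs" shows "two_blocks (mirror zs)"
proof -
  obtain us vs where uv: "rotated zs (us @ vs)" "\<forall>p\<in>set us. left_turn zs p" "\<forall>p\<in>set vs. \<not> left_turn zs p" using assms by (auto simp: two_blocks_def)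
  have s: "set us \<subseteq> set zs" "set vs \<subseteq> set zs" using rotated_set[OF uv(1)] by auto
  have "rotated zs (vs @ us)" using uv(1) rotated_append rotated_trans by blast
  then have "rotated (mirror zs) (mirror vs @ mirror us)" using mirror_rotated by (fastforce simp: mirror_def)
  moreover have "\<forall>p\<in>set (mirror vs). left_turn (mirror zs) p" "\<forall>p\<in>set (mirror us). \<not> left_turn (mirror zs) p"
    using mirror_left_turn[OF assms(1)] uv s by (auto simp: mirror_set)
  ultimately show ?thesis unfolding two_blocks_def by blast
qed

lemma hemispheric_uminus: "hemispheric (uminus ` S) = hemispheric S"
proof -
  have "hemispheric (uminus ` S)" if S: "hemispheric S" for S :: "(real^3) set"
  proof -
    obtain h where "\<forall>z\<in>S. h \<bullet> z > 0" using S hemispheric_def by blast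
    then show ?thesis unfolding hemispheric_def by (intro exI[of _ "-h"]) auto
  qed
  from this[of S] this[of "uminus ` S"] show ?thesis by (auto simp: image_image)
qed

section \<open>Turning blocks under ear removal and chords\<close>

text \<open>Only the two neighbours of \<open>i\<close> can become left turns. As \<open>i\<close>
  is in the left block, such a neighbour stands at an end of the right block and can be moved to the
  left one.\<close>

lemma two_blocks_delete:
  assumes zs: "zs = i # Q" and p: "polygon zs" "polygon Q" "left_turn zs i" "two_blocks zs"
    and up: "\<And>q. q \<in> set Q \<Longrightarrow> left_turn zs q \<Longrightarrow> left_turn Q q"
    and dn: "\<And>q. q \<in> set Q \<Longrightarrow> q \<noteq> hd Q \<Longrightarrow> q \<noteq> last Q \<Longrightarrow> left_turn Q q \<Longrightarrow> left_turn zs q"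
  shows "two_blocks Q"
proof -
  obtain us vs where uv: "rotated zs (us @ vs)" "\<forall>p\<in>set us. left_turn zs p" "\<forall>p\<in>set vs. \<not> left_turn zs p"
    using p by (auto simp: two_blocks_def)
  have "i \<in> set us" using rotated_set[OF uv(1)] zs uv p(3) by auto
  then obtain u1 u2 where us: "us = u1 @ i # u2" by (meson split_list)
  have "rotated zs (i # u2 @ vs @ u1)" using uv(1) us rotated_append[of u1 "i # u2 @ vs"] rotated_trans by fastforce
  then have Q: "Q = u2 @ vs @ u1" using rotated_hd_eq p(1) zs polygon_def by metis
  have dQ: "distinct Q" "Q \<noteq> []" "length Q \<ge> 3" using p(2) by (auto simp: polygon_def)
  have u: "\<forall>q\<in>set u1 \<union> set u2. left_turn Q q" using up uv us Q by auto
  have v: "\<not> left_turn Q q" if "q \<in> set vs" "q \<noteq> hd Q" "q \<noteq> last Q" for q using dn[of q] that uv Q by auto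
  have hl: "hd Q \<noteq> last Q" using dQ by (cases Q) (auto split: if_splits)
  have main: "two_blocks Q" if "rotated Q (P @ N)" "\<forall>q\<in>set P. left_turn Q q" "\<forall>q\<in>set N. \<not> left_turn Q q" for P N
    using that unfolding two_blocks_def by blast
  \<comment> \<open>\<open>Q\<close> is \<open>u2 @ vs @ u1\<close>, so its head is in the right
    block only as the first element of that block.\<close>
  have hdc: "u2 = [] \<and> (\<exists>w. vs = hd Q # w)" if "hd Q \<in> set vs"
  proof -
    have "u2 = []" using that Q dQ by (cases u2) auto
    then show ?thesis using that Q by (cases vs) auto
  qed
  have lac: "u1 = [] \<and> (\<exists>w. vs = w @ [last Q])" if "last Q \<in> set vs"
  proof -
    have "u1 = []"
    proof (rule ccontr)
      assume "u1 \<noteq> []"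
      then have "last Q \<in> set u1" using Q by simp
      then show False using that Q dQ by auto
    qed
    moreover have "vs \<noteq> []" using that by auto
    moreover from this have "last Q = last vs" using \<open>u1 = []\<close> Q by simp
    ultimately show ?thesis by (metis append_butlast_last_id)
  qed
  show ?thesis
  proof (cases "hd Q \<in> set vs \<and> left_turn Q (hd Q)")
    case True
    note b = this
    obtain w where w: "u2 = []" "vs = hd Q # w" using hdc b by blast
    show ?thesis
    proof (cases "last Q \<in> set vs \<and> left_turn Q (last Q)")
      case True
      obtain x where x: "u1 = []" "vs = x @ [last Q]" using lac True by blast
      then obtain y where y: "vs = hd Q # y @ [last Q]" using w hl by (cases x) auto
      have Qe: "Q = (hd Q # y) @ [last Q]" using Q w x y by simp
      then have "rotated Q ([last Q, hd Q] @ y)" using rotated_append[of "hd Q # y" "[last Q]"] by (metis append_Cons append_Nil)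
      moreover have "\<forall>q\<in>set y. \<not> left_turn Q q"
      proof
        fix q assume q: "q \<in> set y"
        have "distinct ((hd Q # y) @ [last Q])" using Qe dQ by metis
        then have "q \<noteq> hd Q" "q \<noteq> last Q" using q by auto
        then show "\<not> left_turn Q q" using v q y by auto
      qed
      ultimately show ?thesis using main[of "[last Q, hd Q]" y] b True by auto
    next
      case False
      have Qe: "Q = (hd Q # w) @ u1" using Q w by simp
      then have "rotated Q ((u1 @ [hd Q]) @ w)" using rotated_append[of "hd Q # w" u1] by simp
      moreover have "\<forall>q\<in>set w. \<not> left_turn Q q"
      proof
        fix q assume q: "q \<in> set w"
        have "distinct ((hd Q # w) @ u1)" using Qe dQ by metis
        then have "q \<noteq> hd Q" using q by auto
        then show "\<not> left_turn Q q" using v[of q] q w False by auto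
      qed
      ultimately show ?thesis using main[of "u1 @ [hd Q]" w] b u by auto
    qed
  next
    case nb: False
    show ?thesis
    proof (cases "last Q \<in> set vs \<and> left_turn Q (last Q)")
      case True
      obtain x where x: "u1 = []" "vs = x @ [last Q]" using lac True by blast
      have Qe: "Q = (u2 @ x) @ [last Q]" using Q x by simp
      then have "rotated Q ((last Q # u2) @ x)" using rotated_append[of "u2 @ x" "[last Q]"] by (metis append_Cons append_Nil append.assoc)
      moreover have "\<forall>q\<in>set x. \<not> left_turn Q q"
      proof
        fix q assume q: "q \<in> set x"
        have "distinct ((u2 @ x) @ [last Q])" using Qe dQ by metis
        then have "q \<noteq> last Q" using q by auto
        then show "\<not> left_turn Q q" using v[of q] q x nb by auto
      qed
      ultimately show ?thesis using main[of "last Q # u2" x] True u by auto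
    next
      case False
      have "rotated Q ((u1 @ u2) @ vs)" using rotated_append[of "u2 @ vs" u1] Q by simp
      moreover have "\<forall>q\<in>set vs. \<not> left_turn Q q" using v nb False by blast
      ultimately show ?thesis using main[of "u1 @ u2" vs] u by auto
    qed
  qed
qed

text \<open>\<open>m\<close> splits the left block and \<open>k\<close> the right one, and each part
  receives one piece of each. In both parts \<open>k\<close> stands between the left turn
  \<open>m\<close> and the right block, so it fits into either block.\<close>

lemma two_blocks_chord:
  assumes ch: "chord zs m A k B" and p: "polygon zs" "simple zs" and b: "two_blocks zs" "left_turn zs m" "\<not> left_turn zs k"
  shows "left_turn (m # A @ [k]) m \<Longrightarrow> two_blocks (m # A @ [k])" "left_turn (k # B @ [m]) m \<Longrightarrow> two_blocks (k # B @ [m])"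
proof -
  let ?Q1 = "m # A @ [k]" and ?Q2 = "k # B @ [m]"
  obtain us vs where uv: "rotated zs (us @ vs)" "\<forall>p\<in>set us. left_turn zs p" "\<forall>p\<in>set vs. \<not> left_turn zs p"
    using b by (auto simp: two_blocks_def)
  have r: "rotated zs (m # A @ k # B)" using ch by (simp add: chord_def)
  have r2: "rotated zs (k # B @ m # A)" using chord_sym[OF ch p(1)] by (simp add: chord_def)
  have Q: "polygon ?Q1" "polygon ?Q2" using chord_polygon(1)[OF ch p] chord_polygon(1)[OF chord_sym[OF ch p(1)] p] .
  have "m \<in> set us" "k \<in> set vs" using rotated_set[OF uv(1)] rotated_set[OF r] uv b by auto
  then obtain u1 u2 v1 v2 where us: "us = u1 @ m # u2" and vs: "vs = v1 @ k # v2" by (meson split_list)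
  have "rotated zs (m # u2 @ vs @ u1)" using uv(1) us rotated_append[of u1 "m # u2 @ vs"] rotated_trans by fastforce
  then have "rotated (m # A @ k # B) (m # u2 @ vs @ u1)" using r rotated_sym rotated_trans by blast
  moreover have dist: "distinct (m # A @ k # B)" using rotated_distinct[OF r] p by (simp add: polygon_def)
  ultimately have eq: "A @ k # B = (u2 @ v1) @ k # (v2 @ u1)" using rotated_hd_eq vs by fastforce
  have "k \<notin> set A" "k \<notin> set B" using dist by auto
  then have AB: "A = u2 @ v1" "B = v2 @ u1" using append_Cons_eq_iff[of k A B "u2 @ v1" "v2 @ u1"] eq by auto
  have pA: "left_turn ?Q1 q = left_turn zs q" if "q \<in> set A" for q using left_turn_sub[OF that r p(1) Q(1)] .
  have pB: "left_turn ?Q2 q = left_turn zs q" if "q \<in> set B" for q using left_turn_sub[OF that r2 p(1) Q(2)] .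
  show "two_blocks ?Q1" if m: "left_turn ?Q1 m"
  proof (cases "left_turn ?Q1 k")
    case True
    have "rotated ?Q1 ((k # m # u2) @ v1)" using rotated_append[of "m # u2 @ v1" "[k]"] AB by simp
    then show ?thesis unfolding two_blocks_def using m True pA AB uv us vs by (intro exI[of _ "k # m # u2"] exI[of _ v1]) auto
  next
    case False
    have "rotated ?Q1 ((m # u2) @ (v1 @ [k]))" using rotated_refl AB by simp
    then show ?thesis unfolding two_blocks_def using m False pA AB uv us vs by (intro exI[of _ "m # u2"] exI[of _ "v1 @ [k]"]) auto
  qed
  show "two_blocks ?Q2" if m: "left_turn ?Q2 m"
  proof -
    have r3: "rotated ?Q2 (u1 @ [m] @ k # v2)" using rotated_append[of "k # v2" "u1 @ [m]"] AB by simp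
    show ?thesis
    proof (cases "left_turn ?Q2 k")
      case True
      show ?thesis unfolding two_blocks_def using r3 m True pB AB uv us vs by (intro exI[of _ "u1 @ [m, k]"] exI[of _ v2]) auto
    next
      case False
      show ?thesis unfolding two_blocks_def using r3 m False pB AB uv us vs by (intro exI[of _ "u1 @ [m]"] exI[of _ "k # v2"]) auto
    qed
  qed
qed

section \<open>The minimal counterexample\<close>

text \<open>No hemisphere containing all vertices but one contains the last one, so it can be tilted
  strictly past it. For \<open>e\<close> this puts \<open>e\<close> outside the hemisphere of the
  rest; for \<open>f\<close> it cuts \<open>f\<close> off, which makes \<open>f\<close> a hull
  vertex.\<close>

lemma critical_left_turn:
  assumes p: "polygon zs" "simple zs" and c: "corner zs a e b" "ccw a e b" "\<forall>w\<in>set zs - {a,e,b}. \<not> in_tri a e b w"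
    and n: "\<not> hemispheric (set zs)" "hemispheric (set zs - {e})" "hemispheric (set zs - {f})" and f: "f \<in> set zs - {a,e,b}"
  shows "left_turn zs f"
proof -
  obtain ws where r: "rotated zs (e # b # ws @ [a])" using c(1) corner_rotated_hd by metis
  let ?Z = "e # b # ws @ [a]" and ?Q = "b # ws @ [a]"
  have Z: "polygon ?Z" "simple ?Z" "set ?Z = set zs" using rotated_polygon[OF r] rotated_simple[OF r] rotated_set[OF r] p by auto
  have fw: "f \<in> set ws" using f Z(3) by auto
  then have ws: "ws \<noteq> []" by auto
  have d: "distinct ?Z" using Z by (simp add: polygon_def)
  have emp: "\<forall>w\<in>set ws. \<not> in_tri a e b w" using c(3) d unfolding Z(3)[symmetric] by auto
  note del = delete_ear[OF refl ws Z(1,2) c(2) emp]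
  have setQ: "set ?Q = set zs - {e}" using d Z(3)[symmetric] by auto
  have g: "generic (set zs)" using p by (simp add: polygon_def)
  have ez: "e \<in> set zs" "f \<in> set zs" using corner_set[OF c(1)] f by auto
  have nz: "e \<noteq> 0" "f \<noteq> 0" using generic_nonzero[OF g _ _ ez(1)] generic_nonzero[OF g _ _ ez(2)] polygon_card[OF p(1)] by auto
  obtain h0 where h0: "\<forall>z\<in>set ?Q. h0 \<bullet> z > 0" using n(2) setQ hemispheric_def by metis
  have "h0 \<bullet> e \<le> 0"
  proof (rule ccontr)
    assume "\<not> h0 \<bullet> e \<le> 0"
    then have "\<forall>z\<in>set zs. h0 \<bullet> z > 0" using h0 setQ by force
    then show False using n(1) hemispheric_def by blast
  qed
  then obtain h where h: "\<forall>z\<in>set ?Q. h \<bullet> z > 0" "h \<bullet> e < 0" using tilt[OF _ h0 _ nz(1)] by blast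
  obtain g0 where g0: "\<forall>z\<in>set zs - {f}. g0 \<bullet> z > 0" using n(3) hemispheric_def by metis
  have "g0 \<bullet> f \<le> 0"
  proof (rule ccontr)
    assume "\<not> g0 \<bullet> f \<le> 0"
    then have "\<forall>z\<in>set zs. g0 \<bullet> z > 0" using g0 by force
    then show False using n(1) hemispheric_def by blast
  qed
  then obtain g1 where g1: "\<forall>z\<in>set zs - {f}. g1 \<bullet> z > 0" "g1 \<bullet> f < 0" using tilt[OF _ g0 _ nz(2)] by blast
  have hv: "hull_vertex (set ?Q) f" unfolding hull_vertex_def setQ using g1 f by blast
  have "e \<notin> set ?Q" "generic (insert e (set ?Q))" using d g generic_subset[OF g, of "insert e (set ?Q)"] ez setQ by auto
  then have "left_side ?Q e = (\<not> left_turn ?Q f)" using hull_left_side[OF del(1,2) h(1) hv _ _ h(2)] by blast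
  then have "left_turn ?Q f" using del(3) by blast
  then show ?thesis using del(4)[OF fw] left_turn_rotated[OF r] by simp
qed

text \<open>The induction hypothesis as a condition on the length alone, so that it serves a polygon
  and its mirror image alike.\<close>

definition smaller_unbal :: "nat \<Rightarrow> bool" where
  "smaller_unbal n \<longleftrightarrow> (\<forall>ys. length ys < n \<and> polygon ys \<and> simple ys \<and> two_blocks ys \<longrightarrow> hemispheric (set ys))"

text \<open>Cutting off the ear leaves a shorter simple polygon with two blocks, to which the
  induction hypothesis applies.\<close>

lemma ear_critical:
  assumes IH: "smaller_unbal (length zs)" and p: "polygon zs" "simple zs" "two_blocks zs" "4 \<le> length zs"
    and c: "corner zs a e b" "ccw a e b" "\<forall>w\<in>set zs - {a,e,b}. \<not> in_tri a e b w"
  shows "hemispheric (set zs - {e})"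
proof -
  obtain ws where r: "rotated zs (e # b # ws @ [a])" using c(1) corner_rotated_hd by metis
  let ?Z = "e # b # ws @ [a]" and ?Q = "b # ws @ [a]"
  have Z: "polygon ?Z" "simple ?Z" "set ?Z = set zs" "length ?Z = length zs" using rotated_polygon[OF r] rotated_simple[OF r] rotated_set[OF r] rotated_length[OF r] p by auto
  have ws: "ws \<noteq> []" using Z(4) p(4) by auto
  have d: "distinct ?Z" using Z by (simp add: polygon_def)
  have emp: "\<forall>w\<in>set ws. \<not> in_tri a e b w" using c(3) d unfolding Z(3)[symmetric] by auto
  note del = delete_ear[OF refl ws Z(1,2) c(2) emp]
  have setQ: "set ?Q = set zs - {e}" using d Z(3)[symmetric] by auto
  have tZ: "two_blocks ?Z"
  proof -
    obtain us vs where "rotated zs (us @ vs)" "\<forall>p\<in>set us. left_turn zs p" "\<forall>p\<in>set vs. \<not> left_turn zs p" using p(3) by (auto simp: two_blocks_def)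
    then show ?thesis unfolding two_blocks_def using left_turn_rotated[OF r] rotated_trans[OF rotated_sym[OF r]] by blast
  qed
  have pe: "left_turn ?Z e" using left_turn_corner[OF p(1) c(1)] c(2) left_turn_rotated[OF r] by simp
  have "two_blocks ?Q"
  proof (rule two_blocks_delete[OF refl Z(1) del(1) pe tZ])
    fix q assume "q \<in> set ?Q" "left_turn ?Z q"
    then show "left_turn ?Q q" using del(4-6) by auto
  next
    fix q assume "q \<in> set ?Q" "q \<noteq> hd ?Q" "q \<noteq> last ?Q" "left_turn ?Q q"
    then show "left_turn ?Z q" using del(4) by auto
  qed
  then have "hemispheric (set ?Q)" using IH del(1,2) Z(4) unfolding smaller_unbal_def by (metis length_Cons lessI)
  then show ?thesis using setQ by simp
qed

text \<open>If the hull of the part turned right, its inside would be on the right, where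
  \<open>B\<close> lies; the hemisphere of the part would then contain the whole polygon. So the
  hull turns left and \<open>exists_ear\<close> applies.\<close>

lemma chord_ears:
  assumes ch: "chord zs m A k B" and p: "polygon zs" "simple zs" and n: "\<not> hemispheric (set zs)"
    and Q1: "hemispheric (set (m # A @ [k]))" and L: "left_of (last B) m (hd A) k"
  shows "\<exists>e\<in>set A. ear zs e"
proof -
  let ?Q = "m # A @ [k]"
  have r: "rotated zs (m # A @ k # B)" using ch by (simp add: chord_def)
  have Q: "polygon ?Q" "simple ?Q" using chord_polygon[OF ch p] .
  obtain h where h: "\<forall>z\<in>set ?Q. h \<bullet> z > 0" using Q1 hemispheric_def by blast
  have zs: "set zs = set ?Q \<union> set B" "set B \<inter> set ?Q = {}" using rotated_set[OF r] rotated_distinct[OF r] p by (auto simp: polygon_def)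
  have "left_turn ?Q q" if q: "hull_vertex (set ?Q) q" for q
  proof (rule ccontr)
    assume nq: "\<not> left_turn ?Q q"
    have "h \<bullet> x > 0" if x: "x \<in> set B" for x
    proof (rule left_inside[OF Q h q])
      show "x \<notin> set ?Q" using x zs by blast
      have gz: "generic (set zs)" using p by (simp add: polygon_def)
      show "generic (insert x (set ?Q))" by (rule generic_subset[OF gz]) (use zs(1) x in blast)
      show "left_side ?Q x = left_turn ?Q q" using chord_left_side(2)[OF ch p x] L nq by simp
    qed
    then have "hemispheric (set zs)" unfolding hemispheric_def zs using h by blast
    then show False using n by simp
  qed
  then obtain e where "e \<in> set A" "ear ?Q e" using exists_ear[OF Q h _ refl] by blast
  then show ?thesis using chord_ear[OF ch p _ _ L] by blast
qed

text \<open>To be applied at \<open>m\<close> and then, in the mirror image, at \<open>k\<close>;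
  this is why \<open>k\<close> is shown to be noncritical as well.\<close>

lemma noncritical_step:
  assumes IH: "smaller_unbal (length zs)" and p: "polygon zs" "simple zs" "two_blocks zs" "4 \<le> length zs"
    and n: "\<not> hemispheric (set zs)" and m: "m \<in> set zs" "left_turn zs m" "\<not> hemispheric (set zs - {m})"
  obtains A k B e1 e2 where "chord zs m A k B" "\<not> left_turn zs k" "\<not> hemispheric (set zs - {k})"
    "e1 \<in> set A" "ear zs e1" "e2 \<in> set B" "ear zs e2"
proof -
  obtain a b where c: "corner zs a m b" using corner_exists[OF p(1) m(1)] by metis
  have cc: "ccw a m b" using m(2) left_turn_corner[OF p(1) c] by simp
  obtain w where "w \<in> set zs - {a,m,b}" "in_tri a m b w" using ear_critical[OF IH p c cc] m(3) by blast
  then obtain A k B where ch: "chord zs m A k B" and la: "last B = a" "hd A = b" and I: "in_tri a m b k"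
    and k: "k \<in> set zs - {a,m,b}" "\<not> left_turn zs k" using exists_chord[OF p(1,2) c cc] by metis
  have ch2: "chord zs k B m A" using chord_sym[OF ch p(1)] .
  note ends = chord_ends[OF ch p(1,2) la c cc I]
  have g: "generic (set zs)" using p by (simp add: polygon_def)
  have abm: "a \<in> set zs" "m \<in> set zs" "b \<in> set zs" "distinct [a,m,b,k]"
    using corner_set[OF c] corner_distinct[OF _ c] p(1) k by (auto simp: polygon_def)
  have L2: "left_of (last A) k (hd B) m"
  proof -
    have "hd B \<in> set B" using ch by (auto simp: chord_def)
    from chord_left_side[OF ch p(1,2) this] ends(3) show ?thesis by simp
  qed
  have nk: "\<not> hemispheric (set zs - {k})"
  proof
    assume "hemispheric (set zs - {k})"
    then obtain h where h: "\<forall>z\<in>set zs - {k}. h \<bullet> z > 0" using hemispheric_def by blast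
    obtain x y z where co: "x > 0" "y > 0" "z > 0" "k = x *\<^sub>R a + y *\<^sub>R m + z *\<^sub>R b"
      using in_tri_elim[OF g abm(1-3) _ abm(4) I] k by blast
    have pos: "h \<bullet> a > 0" "h \<bullet> m > 0" "h \<bullet> b > 0" using h abm by auto
    have "h \<bullet> k = x * (h \<bullet> a) + y * (h \<bullet> m) + z * (h \<bullet> b)" by (simp add: co(4) inner_add_right)
    also have "\<dots> > 0" using co pos by (intro add_pos_pos mult_pos_pos)
    finally have "\<forall>z\<in>set zs. h \<bullet> z > 0" using h by force
    then have "hemispheric (set zs)" unfolding hemispheric_def by blast
    then show False using n by simp
  qed
  have t: "two_blocks (m # A @ [k])" "two_blocks (k # B @ [m])" using two_blocks_chord[OF ch p(1-3) m(2) k(2)] ends by auto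
  have u1: "hemispheric (set (m # A @ [k]))" using IH chord_length[OF ch] chord_polygon[OF ch p(1,2)] t unfolding smaller_unbal_def by blast
  have u2: "hemispheric (set (k # B @ [m]))" using IH chord_length[OF ch2] chord_polygon[OF ch2 p(1,2)] t unfolding smaller_unbal_def by blast
  obtain e1 where e1: "e1 \<in> set A" "ear zs e1" using chord_ears[OF ch p(1,2) n u1 ends(3)] by blast
  obtain e2 where e2: "e2 \<in> set B" "ear zs e2" using chord_ears[OF ch2 p(1,2) n u2 L2] by blast
  show thesis using that[OF ch k(2) nk e1 e2] .
qed

lemma ear_left_turn: "polygon zs \<Longrightarrow> ear zs e \<Longrightarrow> left_turn zs e \<and> e \<in> set zs"
  unfolding ear_def left_turn_def using corner_set[of zs _ e] by auto

lemma noncritical_left_turn_False: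
  assumes IH: "smaller_unbal (length zs)" and p: "polygon zs" "simple zs" "two_blocks zs" "4 \<le> length zs"
    and n: "\<not> hemispheric (set zs)" and m: "m \<in> set zs" "left_turn zs m" "\<not> hemispheric (set zs - {m})"
  shows False
proof -
  obtain A k B e1 e2 where ch: "chord zs m A k B" and k: "\<not> left_turn zs k" "\<not> hemispheric (set zs - {k})"
    and e1: "e1 \<in> set A" "ear zs e1" and e2: "e2 \<in> set B" "ear zs e2"
    using noncritical_step[OF assms] by metis
  have ch2: "chord zs k B m A" using chord_sym[OF ch p(1)] .
  have r: "rotated zs (m # A @ k # B)" and r2: "rotated zs (k # B @ m # A)" using ch ch2 by (auto simp: chord_def)
  have kz: "k \<in> set zs" using rotated_set[OF r] by auto
  have cr: "hemispheric (set zs - {e})" if "ear zs e" for e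
    using that ear_critical[OF IH p] unfolding ear_def by blast
  let ?M = "mirror zs"
  have M: "polygon ?M" "simple ?M" "two_blocks ?M" "length ?M = length zs"
    using mirror_polygon mirror_simple mirror_two_blocks p by (auto simp: mirror_def)
  have setM: "set ?M - {- x} = uminus ` (set zs - {x})" for x by (auto simp: mirror_set)
  have IHM: "smaller_unbal (length ?M)" "4 \<le> length ?M" using IH p(4) M(4) by simp_all
  have nM: "\<not> hemispheric (set ?M)" using n by (simp add: mirror_set hemispheric_uminus)
  have kM: "-k \<in> set ?M" "left_turn ?M (-k)" "\<not> hemispheric (set ?M - {-k})"
  proof -
    show "-k \<in> set ?M" using kz by (simp add: mirror_set)
    show "left_turn ?M (-k)" using k mirror_left_turn[OF p(1) kz] by simp
    show "\<not> hemispheric (set ?M - {-k})" using k unfolding setM hemispheric_uminus by simp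
  qed
  \<comment> \<open>An ear of the mirror image, that is, a right-turning ear of the polygon.\<close>
  obtain f' where f': "ear ?M f'" using noncritical_step[OF IHM(1) M(1-3) IHM(2) nM kM] by metis
  define f where "f = - f'"
  have ff: "f' = - f" by (simp add: f_def)
  have fz: "f \<in> set zs" using ear_left_turn[OF M(1) f'] unfolding ff by (auto simp: mirror_set)
  have fn: "\<not> left_turn zs f" using ear_left_turn[OF M(1) f'] mirror_left_turn[OF p(1) fz] unfolding ff by simp
  have "hemispheric (set ?M - {-f})" using f' ear_critical[OF IHM(1) M(1-3) IHM(2)] unfolding ear_def ff by blast
  then have fc: "hemispheric (set zs - {f})" by (simp add: setM hemispheric_uminus)
  \<comment> \<open>Ears are critical, \<open>m\<close> and \<open>k\<close> are not.\<close>
  have "f \<noteq> m" "f \<noteq> k" using fc m k by auto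
  then have fAB: "f \<in> set A \<or> f \<in> set B" using fz rotated_set[OF r] by auto
  have d: "distinct (m # A @ k # B)" using rotated_distinct[OF r] p by (simp add: polygon_def)
  \<comment> \<open>An ear strictly inside the part without \<open>f\<close> has both neighbours in
    that part, so it is not adjacent to \<open>f\<close>.\<close>
  have crit: "left_turn zs f" if e: "ear zs e" "e \<in> set C" "rotated zs (x # C @ y # C')" and fC: "f \<notin> set (x # C @ [y])" for e C C' x y
  proof -
    obtain a b where ab: "corner zs a e b" "ccw a e b" "\<forall>w\<in>set zs - {a,e,b}. \<not> in_tri a e b w" using e(1) ear_def by blast
    obtain a' b' where ab': "corner (x # C @ [y]) a' e b'" "corner zs a' e b'" using corner_sub[OF e(2,3)] by blast
    have "a = a'" "b = b'" using corner_unique[OF _ ab(1) ab'(2)] p by (auto simp: polygon_def)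
    then have "{a,e,b} \<subseteq> set (x # C @ [y])" using corner_set[OF ab'(1)] by auto
    then have "f \<in> set zs - {a,e,b}" using fC fz by blast
    then show ?thesis using critical_left_turn[OF p(1,2) ab n cr[OF e(1)] fc] by blast
  qed
  from fAB show False
  proof
    assume "f \<in> set A"
    then have "f \<notin> set (k # B @ [m])" using d by auto
    then show False using crit[OF e2(2,1) r2] fn by blast
  next
    assume "f \<in> set B"
    then have "f \<notin> set (m # A @ [k])" using d by auto
    then show False using crit[OF e1(2,1) r] fn by blast
  qed
qed

text \<open>Equal turns at two consecutive vertices would give a hemisphere by
  \<open>hemispheric_quad\<close>. So the turns alternate, which two blocks do not allow.\<close>

lemma quad_False:
  assumes p: "polygon zs" "length zs = 4" "two_blocks zs" and n: "\<not> hemispheric (set zs)"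
  shows False
proof -
  obtain us vs where uv: "rotated zs (us @ vs)" "\<forall>p\<in>set us. left_turn zs p" "\<forall>p\<in>set vs. \<not> left_turn zs p"
    using p(3) by (auto simp: two_blocks_def)
  have len: "length (us @ vs) = 4" using rotated_length[OF uv(1)] p by simp
  have "\<exists>a b c d. xs = [a,b,c,d]" if "length xs = 4" for xs :: "(real^3) list"
    using that by (auto simp: length_Suc_conv numeral_eq_Suc)
  then obtain a b c d where e: "us @ vs = [a,b,c,d]" using len by metis
  have r: "rotated zs [a,b,c,d]" using uv(1) e by simp
  have P: "polygon [a,b,c,d]" "set zs = {a,b,c,d}" using rotated_polygon[OF r p(1)] rotated_set[OF r] by auto
  have alt: "ccw x y z \<noteq> ccw y z w" if s: "{x,y,z,w} = {a,b,c,d}" "distinct [x,y,z,w]" for x y z w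
  proof
    assume eq: "ccw x y z = ccw y z w"
    have g: "generic {x,y,z,w}" using P s by (simp add: polygon_def)
    have "det3 x y z \<noteq> 0" "det3 y z w \<noteq> 0" using s generic_det3[OF g, of x y z] generic_det3[OF g, of y z w] by auto
    then have "det3 x y z * det3 y z w > 0" using eq unfolding ccw_def by (auto simp: zero_less_mult_iff)
    then show False using hemispheric_quad[of x y z w] n P s by simp
  qed
  have dist: "distinct [a,b,c,d]" using P by (simp add: polygon_def)
  have cn: "corner zs d a b" "corner zs a b c" "corner zs b c d" "corner zs c d a"
    using corner_hd[of a b "[c]" d] corner_infix[of "[]" a b c "[d]"] corner_infix[of "[a]" b c d "[]"] corner_last[of a "[b]" c d]
      corner_rotated[OF r] by auto
  have "left_turn zs a \<noteq> left_turn zs b" "left_turn zs b \<noteq> left_turn zs c" "left_turn zs c \<noteq> left_turn zs d"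
    using alt[of d a b c] alt[of a b c d] alt[of b c d a] dist left_turn_corner[OF p(1)] cn by auto
  \<comment> \<open>In each case two consecutive vertices fall into the same block.\<close>
  moreover have "us = [] \<or> us = [a] \<or> (\<exists>x. us = a # b # x)" using e by (cases us rule: remdups_adj.cases) (auto simp: Cons_eq_append_conv)
  ultimately show False using uv e by auto
qed

lemma simple_two_blocks_hemispheric:
  "polygon zs \<Longrightarrow> simple zs \<Longrightarrow> two_blocks zs \<Longrightarrow> hemispheric (set zs)"
proof (induction "length zs" arbitrary: zs rule: less_induct)
  case less
  note p = less.prems
  have IH: "smaller_unbal (length zs)" unfolding smaller_unbal_def using less.hyps by blast
  show ?case
  proof (rule ccontr)
    assume n: "\<not> hemispheric (set zs)"
    have len: "length zs \<ge> 3" using p by (simp add: polygon_def)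
    consider "length zs = 3" | "length zs = 4" | "length zs \<ge> 5" using len by linarith
    then show False
    proof cases
      case 1
      then obtain a b c where zs: "zs = [a,b,c]" by (auto simp: length_Suc_conv numeral_eq_Suc)
      then have "det3 a b c \<noteq> 0" using p(1) by (auto simp: polygon_def generic_def)
      then show False using hemispheric_triple n zs by simp
    next
      case 2
      then show False using quad_False p n by blast
    next
      case 3
      have "card (set zs) = length zs" using p(1) by (simp add: polygon_def distinct_card)
      then obtain m where m: "m \<in> set zs" "\<not> hemispheric (set zs - {m})" using exists_noncritical[of "set zs"] 3 n by auto
      have l4: "4 \<le> length zs" using 3 by simp
      show False
      proof (cases "left_turn zs m")
        case True
        then show False using noncritical_left_turn_False[OF IH p l4 n m(1) _ m(2)] by blast
      next
        case False
        let ?M = "mirror zs"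
        have M: "polygon ?M" "simple ?M" "two_blocks ?M" "length ?M = length zs"
          using mirror_polygon mirror_simple mirror_two_blocks p by (auto simp: mirror_def)
        have setM: "set ?M - {- m} = uminus ` (set zs - {m})" by (auto simp: mirror_set)
        have "\<not> hemispheric (set ?M)" using n by (simp add: mirror_set hemispheric_uminus)
        moreover have "-m \<in> set ?M" "left_turn ?M (-m)" using m False mirror_left_turn[OF p(1) m(1)] by (auto simp: mirror_set)
        moreover have "\<not> hemispheric (set ?M - {-m})" using m unfolding setM hemispheric_uminus by simp
        ultimately show False using noncritical_left_turn_False[of ?M "-m"] IH l4 M by simp
      qed
    qed
  qed
qed

section \<open>Polygons with one crossing\<close>

text \<open>y is a perturbation of the crossing point x, which itself is not in general position.\<close>

locale near_point =
  fixes S :: "(real^3) set" and x y q r :: "real^3" and \<alpha> \<beta> :: real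
  assumes g: "generic (insert y S)" and yS: "y \<notin> S" and qr: "q \<in> S" "r \<in> S" "q \<noteq> r"
    and x: "x = \<alpha> *\<^sub>R q + \<beta> *\<^sub>R r" "\<alpha> > 0" "\<beta> > 0"
    and near: "\<And>a b. a \<in> S \<Longrightarrow> b \<in> S \<Longrightarrow> det3 x a b > 0 \<Longrightarrow> det3 y a b > 0"
begin

text \<open>\<open>near\<close> concerns positive determinants; exchanging \<open>a\<close> and
  \<open>b\<close> gives the negative ones.\<close>

lemma sign: assumes "a \<in> S" "b \<in> S" "det3 x a b \<noteq> 0" shows "ccw y a b = ccw x a b"
proof (cases "det3 x a b > 0")
  case True then show ?thesis using near[OF assms(1,2)] by (simp add: ccw_def)
next
  case False
  have sw: "det3 z b a = - det3 z a b" for z by (simp add: det3_expand algebra_simps)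
  have "det3 x b a > 0" using False assms(3) sw[of x] by simp
  then have "det3 y b a > 0" using near assms by blast
  then show ?thesis using False sw[of y] by (simp add: ccw_def)
qed

lemma det_x: "det3 x a b = \<alpha> * det3 q a b + \<beta> * det3 r a b"
  by (simp add: x(1) det3_add det3_scale)

lemma gS: "generic S" using generic_subset[OF g] by blast

text \<open>Seen from \<open>q\<close>, the points \<open>x\<close> and \<open>r\<close> lie in the
  same direction, and \<open>y\<close> is close to \<open>x\<close>.\<close>

lemma near_ccw: assumes "a \<in> S" "a \<noteq> q" "a \<noteq> r" shows "ccw q y a = ccw q r a"
proof -
  have nz: "det3 r q a \<noteq> 0" using generic_det3[OF gS] qr assms by auto
  then have "ccw y q a = ccw x q a" using sign[OF qr(1) assms(1)] x(2,3) by (simp add: det_x)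
  also have "\<dots> = ccw r q a" using x(2,3) by (simp add: ccw_def det_x zero_less_mult_iff)
  finally have 1: "ccw y q a = ccw r q a" .
  have "ccw q y a = (\<not> ccw y q a)" by (rule ccw_swap(1)[OF g]) (use qr assms yS in auto)
  moreover have "ccw q r a = (\<not> ccw r q a)" by (rule ccw_swap(1)[OF gS]) (use qr assms in auto)
  ultimately show ?thesis using 1 by simp
qed

lemma near_end: assumes "b \<in> S" "b \<noteq> q" "b \<noteq> r" shows "ccw y r b = ccw q r b" "ccw y b r = ccw q b r"
proof -
  have "det3 q r b \<noteq> 0" "det3 q b r \<noteq> 0" using generic_det3[OF gS] qr assms by auto
  then show "ccw y r b = ccw q r b" "ccw y b r = ccw q b r"
    using sign[OF qr(2) assms(1)] sign[OF assms(1) qr(2)] x(2,3) by (simp_all add: det_x) (simp_all add: ccw_def det_x zero_less_mult_iff)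
qed

text \<open>If \<open>q\<close> and \<open>r\<close> are on the same side of \<open>ab\<close>, so
  are \<open>x\<close> between them and the nearby \<open>y\<close>. Otherwise the test fails
  because of the position of \<open>a\<close> and \<open>b\<close> relative to the direction from
  \<open>q\<close> to \<open>r\<close>, which is shared by the arc from \<open>q\<close> to
  \<open>y\<close>.\<close>

lemma near_no_cross: assumes ab: "a \<in> S" "b \<in> S" and n: "\<not> crosses q r a b" shows "\<not> crosses q y a b"
proof (cases "a = b \<or> q \<in> {a,b}")
  case True then show ?thesis by auto
next
  case False
  consider "a = r" | "b = r" | "a \<noteq> r" "b \<noteq> r" by blast
  then show ?thesis
  proof cases
    case 1 then show ?thesis using near_end(1)[OF ab(2)] False unfolding crosses_def by auto
  next
    case 2 then show ?thesis using near_end(2)[OF ab(1)] False unfolding crosses_def by auto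
  next
    case 3
    have nz: "det3 q a b \<noteq> 0" "det3 r a b \<noteq> 0" using generic_det3[OF gS] qr ab False 3 by auto
    have c: "ccw q y a = ccw q r a" "ccw q y b = ccw q r b" using near_ccw ab False 3 by auto
    show ?thesis
    proof (cases "ccw q a b = ccw r a b")
      case True
      have "det3 x a b \<noteq> 0 \<and> ccw x a b = ccw q a b"
      proof (cases "det3 q a b > 0")
        case pos: True
        then have "det3 r a b > 0" using True by (simp add: ccw_def)
        then have "det3 x a b > 0" using pos x(2,3) by (simp add: det_x add_pos_pos)
        then show ?thesis using pos by (simp add: ccw_def)
      next
        case neg: False
        then have "det3 q a b < 0" "det3 r a b < 0" using nz True by (auto simp: ccw_def)
        then have "\<alpha> * det3 q a b < 0" "\<beta> * det3 r a b < 0" using x(2,3) by (simp_all add: mult_pos_neg)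
        then have "det3 x a b < 0" by (simp add: det_x)
        then show ?thesis using neg by (simp add: ccw_def)
      qed
      then have "ccw y a b = ccw q a b" using sign[OF ab] by simp
      then show ?thesis unfolding crosses_def by auto
    next
      case False2: False
      then have "\<not> ((ccw q r b \<noteq> ccw q r a) \<and> (ccw r a b \<noteq> ccw q r b))"
        using n False 3 qr unfolding crosses_def by auto
      then show ?thesis unfolding crosses_def c using False2 by auto
    qed
  qed
qed

end

text \<open>The loop \<open>p, P, q\<close> is closed by a point \<open>y\<close> near the crossing.
  By \<open>t\<close>, the edge \<open>sp\<close> passes to the right of \<open>qr\<close> after the
  crossing, so the other loop starts on the left of this one and stays there, as it never meets
  it.\<close>

lemma one_crossing_aux:
  assumes zs: "zs = p # P @ q # r # R @ [s]" and pz: "polygon zs" "\<forall>z\<in>set zs. left_turn zs z"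
    and X: "crosses q r s p" and t: "\<not> ccw q r p"
    and only: "\<And>a b c d. (a,b) \<in> edges zs \<Longrightarrow> (c,d) \<in> edges zs \<Longrightarrow> crosses a b c d \<Longrightarrow>
        (a,b) = (q,r) \<and> (c,d) = (s,p) \<or> (a,b) = (s,p) \<and> (c,d) = (q,r)"
  shows "hemispheric (set zs)"
proof -
  let ?S = "set zs"
  let ?C1 = "p # P @ [q]" and ?C2 = "r # R @ [s]"
  have g: "generic ?S" and dz: "distinct zs" using pz by (auto simp: polygon_def)
  have dist: "distinct (?C1 @ ?C2)" using dz zs by auto
  have mem: "q \<in> ?S" "r \<in> ?S" "s \<in> ?S" "p \<in> ?S" using zs by auto
  have dX: "distinct [q,r,s,p]" using X by (simp add: crosses_def)
  obtain \<alpha> \<beta> \<gamma> \<delta> where co: "\<alpha> > 0" "\<beta> > 0" "\<gamma> > 0" "\<delta> > 0" "\<alpha> *\<^sub>R q + \<beta> *\<^sub>R r = \<gamma> *\<^sub>R s + \<delta> *\<^sub>R p"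
    using crosses_elim[OF g mem X] by metis
  define x where "x = \<alpha> *\<^sub>R q + \<beta> *\<^sub>R r"
  have x2: "x = \<delta> *\<^sub>R p + \<gamma> *\<^sub>R s" using co by (simp add: x_def add.commute)
  have dt: "det3 q r p < 0" using t generic_det3[OF g mem(1,2,4)] dX by (auto simp: ccw_def)
  have cr: "det3 y a b = cross3 a b \<bullet> y" for y a b using det3_cyc[of a b y] by (simp add: det3_def)
  \<comment> \<open>Finitely many strict sign conditions satisfied by \<open>x\<close>; they hold on
    a neighbourhood of \<open>x\<close>.\<close>
  let ?AB = "{(a,b). a \<in> ?S \<and> b \<in> ?S \<and> det3 x a b > 0}"
  let ?V = "\<Inter>(a,b)\<in>?AB. {y. det3 y a b > 0}"
  have finAB: "finite ?AB" by (rule finite_subset[of _ "?S \<times> ?S"]) auto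
  have oV: "open ?V" by (rule open_INT[OF finAB]) (auto simp: cr open_halfspace_gt)
  have xV: "x \<in> ?V" by auto
  \<comment> \<open>\<open>y\<close> is placed on the same side of \<open>qr\<close> as
    \<open>p\<close>, so that the edge from \<open>y\<close> to \<open>p\<close> does not cross
    \<open>qr\<close>.\<close>
  let ?U = "?V \<inter> {y. det3 q r y < 0}"
  have oU: "open ?U" using oV by (intro open_Int) (auto simp: det3_def open_lt)
  obtain e where e: "e > 0" "ball x e \<subseteq> ?V" by (rule openE[OF oV xV])
  have "p \<noteq> 0" using dt by (auto simp: det3_expand)
  \<comment> \<open>The crossing point moved towards \<open>p\<close> by half the radius of the
    ball, which shows that \<open>?U\<close> is nonempty.\<close>
  define y0 where "y0 = x + (e / (2 * norm p)) *\<^sub>R p"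
  have "y0 \<in> ball x e" using e \<open>p \<noteq> 0\<close> by (simp add: y0_def dist_norm)
  moreover have "det3 q r y0 < 0"
  proof -
    have "det3 q r y0 = (e / (2 * norm p)) * det3 q r p"
      by (simp add: y0_def x_def det3_expand algebra_simps)
    then show ?thesis using e dt \<open>p \<noteq> 0\<close> by (simp add: mult_pos_neg divide_neg_pos)
  qed
  ultimately have "?U \<noteq> {}" using e by blast
  then obtain y where y: "y \<in> ?U" "y \<notin> ?S" "generic (insert y ?S)"
    using exists_generic_point[OF oU _ _ g] polygon_card[OF pz(1)] by blast
  have near: "det3 y a b > 0" if "a \<in> ?S" "b \<in> ?S" "det3 x a b > 0" for a b using y(1) that by blast
  have qry: "\<not> ccw q r y" using y(1) by (auto simp: ccw_def)
  interpret N1: near_point ?S x y q r \<alpha> \<beta>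
  proof
    show "q \<noteq> r" using dX by simp
  qed (fact y(3) y(2) mem x_def co near)+
  interpret N2: near_point ?S x y p s \<delta> \<gamma>
  proof
    show "p \<noteq> s" using dX by auto
  qed (fact y(3) y(2) mem x2 co near)+
  have edz: "edges zs = path_edges ?C1 \<union> {(q,r), (s,p)} \<union> path_edges ?C2"
  proof -
    have "edges zs = path_edges ((p # P) @ q # (r # R @ [s, p]))" by (simp add: edges_def closed_path_def zs)
    also have "\<dots> = path_edges ((p # P) @ [q]) \<union> path_edges (q # r # R @ [s, p])" by (rule path_edges_append)
    also have "(p # P) @ [q] = ?C1" by simp
    also have "path_edges (q # r # R @ [s, p]) = insert (q,r) (path_edges ((r # R @ [s]) @ [p]))" by simp
    also have "\<dots> = insert (q,r) (insert (s,p) (path_edges ?C2))" using path_edges_snoc[of "r # R @ [s]" p] by simp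
    finally show ?thesis by auto
  qed
  have sep: "(q,r) \<notin> path_edges ?C1" "(s,p) \<notin> path_edges ?C1" "(q,r) \<notin> path_edges ?C2" "(s,p) \<notin> path_edges ?C2"
    using dist path_edges_set[of q r ?C1] path_edges_set[of s p ?C1] path_edges_set[of q r ?C2] path_edges_set[of s p ?C2] by auto
  let ?L = "y # ?C1"
  have edL: "edges ?L = insert (y,p) (insert (q,y) (path_edges ?C1))"
    using path_edges_snoc[of "y # ?C1" y] by (auto simp: edges_def closed_path_def)
  have inS: "a \<in> ?S \<and> b \<in> ?S" if "(a,b) \<in> path_edges ?C1 \<union> path_edges ?C2" for a b
    using edges_set[of a b zs] that edz by auto
  have no: "\<not> crosses q y a b \<and> \<not> crosses p y a b \<and> \<not> crosses q r a b \<and> \<not> crosses p s a b" if ab: "(a,b) \<in> path_edges ?C1 \<union> path_edges ?C2" for a b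
  proof -
    have e: "(a,b) \<in> edges zs" "(q,r) \<in> edges zs" "(s,p) \<in> edges zs" using ab edz by auto
    have S: "a \<in> ?S" "b \<in> ?S" using inS[OF ab] by auto
    have ne: "(a,b) \<noteq> (q,r)" "(a,b) \<noteq> (s,p)" using ab sep by auto
    have 1: "\<not> crosses q r a b" using only[OF e(2,1)] ne by auto
    have "\<not> crosses s p a b" using only[OF e(3,1)] ne by auto
    then have 2: "\<not> crosses p s a b" using crosses_sym(1)[OF g mem(3,4) S] by simp
    show ?thesis using 1 2 N1.near_no_cross[OF S 1] N2.near_no_cross[OF S 2] by blast
  qed
  have gy: "generic (insert y ?S)" using y(3) .
  have yy: "y \<in> insert y ?S" by simp
  have noL: "\<not> crosses a b c d \<and> \<not> crosses c d a b" if ab: "(a,b) \<in> path_edges ?C1 \<union> path_edges ?C2" and cd: "(c,d) \<in> edges ?L" for a b c d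
  proof -
    have S: "a \<in> insert y ?S" "b \<in> insert y ?S" using inS[OF ab] by auto
    have S2: "c \<in> insert y ?S" "d \<in> insert y ?S" using edges_set[OF cd] zs by auto
    have "\<not> crosses c d a b"
    proof -
      consider "(c,d) = (y,p)" | "(c,d) = (q,y)" | "(c,d) \<in> path_edges ?C1" using cd edL by auto
      then show ?thesis
      proof cases
        case 1
        then show ?thesis using no[OF ab] crosses_sym(1)[OF gy _ yy S, of p] mem by auto
      next
        case 2 then show ?thesis using no[OF ab] by auto
      next
        case 3
        have "(a,b) \<in> edges zs" "(c,d) \<in> edges zs" using ab 3 edz by auto
        then show ?thesis using only[of c d a b] 3 sep by auto
      qed
    qed
    then show ?thesis using crosses_sym(3)[OF gy S S2] by simp
  qed
  have subL: "set ?L \<subseteq> insert y ?S" using zs by auto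
  have pL: "polygon ?L"
    using generic_subset[OF gy subL] dist y(2) zs unfolding polygon_def by auto
  have sL: "simple ?L"
  proof -
    have "\<not> crosses a b c d" if ab: "(a,b) \<in> edges ?L" and cd: "(c,d) \<in> edges ?L" for a b c d
    proof (cases "(a,b) \<in> path_edges ?C1 \<or> (c,d) \<in> path_edges ?C1")
      case True then show ?thesis using noL ab cd by blast
    next
      case False
      then have "(a,b) \<in> {(y,p),(q,y)}" "(c,d) \<in> {(y,p),(q,y)}" using ab cd edL by auto
      then show ?thesis by auto
    qed
    then show ?thesis unfolding simple_def by auto
  qed
  define q' where "q' = last (p # P)"
  have q'e: "?C1 = butlast (p # P) @ [q', q]"
    using append_butlast_last_id[of "p # P"] unfolding q'_def by (metis append.assoc append_Cons append_Nil list.discI)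
  have cLq: "corner ?L q' q y" using corner_last[of y "butlast (p # P)" q' q] q'e by metis
  have czq: "corner zs q' q r"
  proof -
    have "zs = butlast (p # P) @ q' # q # r # (R @ [s])" using zs q'e by (metis append.assoc append_Cons append_Nil)
    then show ?thesis using corner_infix by metis
  qed
  have q'z: "q' \<in> ?S" "q' \<noteq> q" "q' \<noteq> r" using corner_set[OF czq] corner_distinct[OF dz czq] by auto
  have ccq: "ccw q' q r" "ccw q' q y"
  proof -
    show 1: "ccw q' q r" using left_turn_corner[OF pz(1) czq] pz(2) mem by blast
    have "ccw q y q' = ccw q r q'" using N1.near_ccw[OF q'z] .
    then show "ccw q' q y" using 1 ccw_cyc by metis
  qed
  define p' where "p' = hd (P @ [q])"
  have p'e: "P @ [q] = p' # tl (P @ [q])" unfolding p'_def by (cases P) auto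
  have cLp: "corner ?L y p p'" using corner_infix[of "[]" y p p' "tl (P @ [q])"] p'e by simp
  have czp: "corner zs s p p'"
  proof -
    have "zs = p # p' # (tl (P @ [q]) @ r # R) @ [s]" using zs p'e by (metis append.assoc append_Cons append_Nil)
    then show ?thesis using corner_hd by metis
  qed
  have p'z: "p' \<in> ?S" "p' \<noteq> p" "p' \<noteq> s" using corner_set[OF czp] corner_distinct[OF dz czp] by auto
  have ccp: "ccw y p p'"
  proof -
    have 1: "ccw s p p'" using left_turn_corner[OF pz(1) czp] pz(2) mem by blast
    have 2: "ccw p y p' = ccw p s p'" using N2.near_ccw[OF p'z] .
    have "ccw p s p' = (\<not> ccw s p p')" by (rule ccw_swap(1)[OF g]) (use mem p'z dX in auto)
    moreover have "ccw p y p' = (\<not> ccw y p p')" by (rule ccw_swap(1)[OF gy]) (use mem p'z y(2) in auto)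
    ultimately show ?thesis using 1 2 by simp
  qed
  have posC1: "left_turn ?L z" if z: "z \<in> set ?C1" for z
  proof -
    consider "z = p" | "z = q" | "z \<in> set P" using z by auto
    then show ?thesis
    proof cases
      case 1 then show ?thesis using left_turn_corner[OF pL cLp] ccp by simp
    next
      case 2 then show ?thesis using left_turn_corner[OF pL cLq] ccq by simp
    next
      case 3
      obtain L a b R' where e: "?C1 = L @ a # z # b # R'" using infix_mid[OF 3] by metis
      have c1: "corner zs a z b"
      proof -
        have "zs = L @ a # z # b # (R' @ r # R @ [s])" using zs e by (metis append.assoc append_Cons append_Nil)
        then show ?thesis using corner_infix by metis
      qed
      have c2: "corner ?L a z b" using corner_infix[of "y # L" a z b R'] e by simp
      have "z \<in> ?S" using 3 zs by auto
      then show ?thesis using left_turn_corner[OF pz(1) c1] left_turn_corner[OF pL c2] pz(2) by blast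
    qed
  qed
  \<comment> \<open>Only the turn at \<open>y\<close> is open, and a single right turn is one
    block.\<close>
  have "two_blocks ?L"
  proof (cases "left_turn ?L y")
    case True
    then show ?thesis unfolding two_blocks_def using posC1 rotated_refl[of ?L] by (intro exI[of _ ?L] exI[of _ "[]"]) auto
  next
    case False
    have "rotated ?L (?C1 @ [y])" using rotated_append[of "[y]" ?C1] by simp
    then show ?thesis unfolding two_blocks_def using posC1 False by (intro exI[of _ ?C1] exI[of _ "[y]"]) auto
  qed
  then have "hemispheric (set ?L)" using simple_two_blocks_hemispheric pL sL by blast
  then obtain h where h: "\<forall>z\<in>set ?L. h \<bullet> z > 0" using hemispheric_def by blast
  have yp: "y \<in> set ?L" "p \<in> set ?L" "y \<noteq> p" using y(2) mem by auto
  obtain a where a: "hull_vertex (set ?L) a" "a \<notin> {y,p}" using exists_hull_vertex[OF _ _ _ h yp] polygon_card[OF pL] by auto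
  then have apos: "left_turn ?L a" using posC1 by (auto simp: hull_vertex_def)
  have C2L: "set ?C2 \<inter> set ?L = {}" using dist y(2) zs by auto
  \<comment> \<open>\<open>y\<close> was placed on the right of \<open>qr\<close>, so
    \<open>r\<close> lies to the left of the edge from \<open>q\<close> to \<open>y\<close>.\<close>
  have side_r: "left_side ?L r"
  proof -
    have "left_side ?L r = left_of q' q y r"
    proof (rule left_side_corner[OF pL sL _ _ cLq])
      show "r \<notin> set ?L" using C2L by auto
      show "generic (insert r (set ?L))" by (rule generic_subset[OF gy]) (use subL mem in auto)
      fix c d assume cd: "(c,d) \<in> edges ?L"
      consider "(c,d) = (y,p)" | "(c,d) = (q,y)" | "(c,d) \<in> path_edges ?C1" using cd edL by auto
      then show "\<not> crosses r q c d"
      proof cases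
        case 1
        have "ccw r q p = (\<not> ccw q r p)" by (rule ccw_swap(1)[OF g]) (use mem dX in auto)
        moreover have "ccw r q y = (\<not> ccw q r y)" by (rule ccw_swap(1)[OF gy]) (use mem dX y(2) in auto)
        ultimately show ?thesis using 1 t qry by (simp add: crosses_def)
      next
        case 2 then show ?thesis by auto
      next
        case 3 then show ?thesis using no[of c d] crosses_sym(1)[OF g mem(1,2), of c d] inS[of c d] by auto
      qed
    qed
    moreover have "ccw q y r = (\<not> ccw q r y)" by (rule ccw_swap(2)[OF gy]) (use mem dX y(2) in auto)
    ultimately show ?thesis using ccq qry by (simp add: left_of_def)
  qed
  have "\<forall>z\<in>set ?C2. left_side ?L z = left_side ?L (hd ?C2)"
  proof (rule left_side_path[OF pL gy subL])
    show "set ?C2 \<subseteq> insert y ?S" using zs by auto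
    show "set ?C2 \<inter> set ?L = {}" using C2L .
    fix a b c d assume "(a,b) \<in> path_edges ?C2" "(c,d) \<in> edges ?L"
    then show "\<not> crosses a b c d" using noL by blast
  qed
  then have sC2: "left_side ?L z" if "z \<in> set ?C2" for z using that side_r by (metis list.sel(1))
  have "h \<bullet> z > 0" if z: "z \<in> set ?C2" for z
  proof (rule left_inside[OF pL sL h a(1)])
    show "z \<notin> set ?L" using z C2L by blast
    show "generic (insert z (set ?L))" by (rule generic_subset[OF gy]) (use subL z zs in auto)
    show "left_side ?L z = left_turn ?L a" using sC2[OF z] apos by simp
  qed
  moreover have "?S \<subseteq> set ?L \<union> set ?C2" using zs by auto
  ultimately show ?thesis unfolding hemispheric_def using h by blast
qed

lemma path_edges_split: "(a,b) \<in> path_edges w \<Longrightarrow> \<exists>U V. w = U @ a # b # V"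
proof (induction w rule: path_edges.induct)
  case (1 c d w)
  show ?case
  proof (cases "(a,b) = (c,d)")
    case True then show ?thesis by (intro exI[of _ "[]"] exI[of _ w]) auto
  next
    case False
    then obtain U V where "d # w = U @ a # b # V" using 1 by auto
    then show ?thesis by (intro exI[of _ "c # U"] exI[of _ V]) auto
  qed
qed auto

lemma one_crossing:
  assumes pz: "polygon zs" "\<forall>z\<in>set zs. left_turn zs z" and e: "(q,r) \<in> edges zs" "(s,p) \<in> edges zs" and X: "crosses q r s p"
    and only: "\<And>a b c d. (a,b) \<in> edges zs \<Longrightarrow> (c,d) \<in> edges zs \<Longrightarrow> crosses a b c d \<Longrightarrow>
        (a,b) = (q,r) \<and> (c,d) = (s,p) \<or> (a,b) = (s,p) \<and> (c,d) = (q,r)"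
  shows "hemispheric (set zs)"
proof -
  have g: "generic (set zs)" using pz by (simp add: polygon_def)
  have mem: "q \<in> set zs" "r \<in> set zs" "s \<in> set zs" "p \<in> set zs" using edges_set[OF e(1)] edges_set[OF e(2)] by auto
  have dX: "distinct [q,r,s,p]" using X by (simp add: crosses_def)
  obtain w where w: "rotated zs (p # w)" using rotated_to_hd mem by metis
  have dw: "distinct (p # w)" using rotated_distinct[OF w] pz by (simp add: polygon_def)
  have ew: "(q,r) \<in> path_edges (p # w @ [p])" "(s,p) \<in> path_edges (p # w @ [p])" using e rotated_edges[OF w] by (auto simp: edges_def closed_path_def)
  obtain U V where UV: "p # w @ [p] = U @ s # p # V" using path_edges_split[OF ew(2)] by metis
  have "U \<noteq> []" using UV dX by (cases U) auto
  \<comment> \<open>As \<open>p\<close> heads a list without repetitions, the edge ending at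
    \<open>p\<close> is the closing one.\<close>
  have "V = []"
  proof (rule ccontr)
    assume "V \<noteq> []"
    then have "p # w = U @ s # p # butlast V" using UV by (metis append_butlast_last_id append_Cons append_assoc butlast.simps(2) butlast_append butlast_snoc list.discI)
    then show False using dw \<open>U \<noteq> []\<close> by (cases U) auto
  qed
  then have ws: "p # w = U @ [s]" using UV by (metis append_Cons append_assoc append_Nil butlast_snoc)
  obtain U' V' where UV': "p # w @ [p] = U' @ q # r # V'" using path_edges_split[OF ew(1)] by metis
  have "V' \<noteq> []" using UV' dX by auto
  then have w2: "p # w = U' @ q # r # butlast V'" using UV' by (metis append_butlast_last_id append_Cons append_assoc butlast.simps(2) butlast_append butlast_snoc list.discI)
  obtain P where P: "U' = p # P" using w2 dX by (cases U') auto
  have "last (q # r # butlast V') = s" using w2 ws by (metis last_appendR last_snoc list.discI)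
  then have "butlast V' \<noteq> [] \<and> last (butlast V') = s" using dX by (auto split: if_splits)
  then obtain R where R: "butlast V' = R @ [s]" by (metis append_butlast_last_id)
  have Z: "p # w = p # P @ q # r # R @ [s]" using w2 P R by simp
  let ?Z = "p # P @ q # r # R @ [s]" and ?Z2 = "r # R @ s # p # P @ [q]"
  have rZ: "rotated zs ?Z" using w Z by simp
  have rZ2: "rotated zs ?Z2" using rotated_trans[OF rZ] rotated_append[of "p # P @ [q]" "r # R @ [s]"] by simp
  have r: "polygon Z" "\<forall>z\<in>set Z. left_turn Z z" "edges Z = edges zs" "set Z = set zs" if "rotated zs Z" for Z
    using rotated_polygon[OF that] rotated_set[OF that] rotated_edges[OF that] left_turn_rotated[OF that] pz by auto
  show ?thesis
  proof (cases "ccw q r p")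
    case False
    show ?thesis using one_crossing_aux[OF refl r(1,2)[OF rZ] X False] only r(3,4)[OF rZ] by auto
  next
    case True
    have X2: "crosses s p q r" using X crosses_sym(3)[OF g mem] by simp
    \<comment> \<open>At a crossing, if \<open>p\<close> is on the left of \<open>qr\<close>, then
      \<open>r\<close> is on the right of \<open>sp\<close>; the two loops exchange their
      roles.\<close>
    have "\<not> ccw s p r" using X True ccw_cyc(1)[of s p r] unfolding crosses_def by auto
    then show ?thesis using one_crossing_aux[OF refl r(1,2)[OF rZ2] X2] only r(3,4)[OF rZ2] by auto
  qed
qed

section \<open>Space polygons\<close>

lemma one_crossing_neg:
  assumes pz: "polygon zs" "\<forall>z\<in>set zs. \<not> left_turn zs z" and e: "(q,r) \<in> edges zs" "(s,p) \<in> edges zs" and X: "crosses q r s p"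
    and only: "\<And>a b c d. (a,b) \<in> edges zs \<Longrightarrow> (c,d) \<in> edges zs \<Longrightarrow> crosses a b c d \<Longrightarrow>
        (a,b) = (q,r) \<and> (c,d) = (s,p) \<or> (a,b) = (s,p) \<and> (c,d) = (q,r)"
  shows "hemispheric (set zs)"
proof -
  have g: "generic (set zs)" using pz by (simp add: polygon_def)
  have mX: "crosses (-a) (-b) (-c) (-d) = crosses a b c d" if "(a,b) \<in> edges zs" "(c,d) \<in> edges zs" for a b c d
    using mirror_crosses[OF g] edges_set[OF that(1)] edges_set[OF that(2)] by blast
  have "hemispheric (set (mirror zs))"
  proof (rule one_crossing[of _ "-q" "-r" "-s" "-p"])
    show "polygon (mirror zs)" using mirror_polygon pz by blast
    show "\<forall>z\<in>set (mirror zs). left_turn (mirror zs) z" using mirror_left_turn[OF pz(1)] pz(2) by (auto simp: mirror_set)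
    show "(-q,-r) \<in> edges (mirror zs)" "(-s,-p) \<in> edges (mirror zs)" using e by (force simp: mirror_edges)+
    show "crosses (-q) (-r) (-s) (-p)" using X mX[OF e] by simp
    fix a b c d assume ab: "(a,b) \<in> edges (mirror zs)" "(c,d) \<in> edges (mirror zs)" "crosses a b c d"
    obtain a' b' c' d' where o: "a = -a'" "b = -b'" "c = -c'" "d = -d'" "(a',b') \<in> edges zs" "(c',d') \<in> edges zs"
      using ab(1,2) unfolding mirror_edges by auto
    have "crosses a' b' c' d'" using ab(3) mX[OF o(5,6)] o by simp
    from only[OF o(5,6) this] show "(a,b) = (-q,-r) \<and> (c,d) = (-s,-p) \<or> (a,b) = (-s,-p) \<and> (c,d) = (-q,-r)"
      using o by auto
  qed
  then show ?thesis by (simp add: mirror_set hemispheric_uminus)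
qed

section \<open>Changes in periodic sequences\<close>

lemma change_between:
  fixes k l :: nat
  assumes "\<not> s k" "s l" "k < l"
  shows "\<exists>m. k \<le> m \<and> m < l \<and> \<not> s m \<and> s (m + 1)"
  using assms
proof (induction l)
  case (Suc l)
  show ?case
  proof (cases "s l")
    case True
    then have "k < l" using Suc.prems by (cases "k = l") auto
    then show ?thesis using Suc.IH[OF Suc.prems(1) True] less_SucI by blast
  next
    case False
    then show ?thesis using Suc.prems by (intro exI[of _ l]) auto
  qed
qed simp

lemma periodic_mod:
  fixes d :: "nat \<Rightarrow> bool"
  assumes "\<And>i. d (i + n) = d i" shows "d (i mod n) = d i"
proof -
  have "d (j + n * k) = d j" for j k
  proof (induction k)
    case (Suc k)
    have "d (j + n * Suc k) = d ((j + n * k) + n)" by (simp add: algebra_simps)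
    then show ?case using assms Suc by metis
  qed simp
  from this[of "i mod n" "i div n"] show ?thesis by simp
qed

text \<open>Changes may be counted in any window of one period, because reduction modulo
  \<open>n\<close> is injective on it.\<close>

lemma changes_shift:
  fixes d :: "nat \<Rightarrow> bool"
  assumes n: "n > 0" and per: "\<And>i. d (i + n) = d i"
    and J: "J \<subseteq> {..<n}" "\<And>j. j \<in> J \<Longrightarrow> d (a + j) \<noteq> d (a + j + 1)"
  shows "card J \<le> card {i. i < n \<and> d i \<noteq> d (i + 1)}"
proof (rule card_inj_on_le[of "\<lambda>j. (a + j) mod n"])
  show "inj_on (\<lambda>j. (a + j) mod n) J"
  proof (rule inj_onI)
    fix x y assume xy: "x \<in> J" "y \<in> J" "(a + x) mod n = (a + y) mod n"
    then have "(int a + int x) mod int n = (int a + int y) mod int n" by (metis of_nat_add of_nat_mod)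
    then have "int n dvd int x - int y" by (simp add: mod_eq_dvd_iff)
    moreover have "x < n" "y < n" using xy J(1) by auto
    ultimately show "x = y" using dvd_imp_le_int[of "int x - int y" "int n"] by (cases "x = y") auto
  qed
  show "(\<lambda>j. (a + j) mod n) ` J \<subseteq> {i. i < n \<and> d i \<noteq> d (i + 1)}"
  proof
    fix i assume "i \<in> (\<lambda>j. (a + j) mod n) ` J"
    then obtain j where j: "j \<in> J" "i = (a + j) mod n" by blast
    have "d (i + 1) = d ((i + 1) mod n)" using periodic_mod[of d n, OF per] by metis
    also have "(i + 1) mod n = (a + j + 1) mod n" unfolding j(2) by (rule mod_add_left_eq)
    also have "d \<dots> = d (a + j + 1)" using periodic_mod[of d n, OF per] by metis
    finally have "d (i + 1) = d (a + j + 1)" .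
    moreover have "d i = d (a + j)" using periodic_mod[of d n, OF per] j(2) by metis
    ultimately show "i \<in> {i. i < n \<and> d i \<noteq> d (i + 1)}" using J(2)[OF j(1)] n j(2) by simp
  qed
  show "finite {i. i < n \<and> d i \<noteq> d (i + 1)}" by simp
qed

lemma rising:
  fixes d :: "nat \<Rightarrow> bool"
  assumes n: "n > 0" and per: "\<And>i. d (i + n) = d i" and ab: "d a" "\<not> d b"
  obtains m where "\<not> d m" "d (m + 1)"
proof -
  have "d (a + n * k)" for k
  proof (induction k)
    case (Suc k)
    have "d ((a + n * k) + n)" using Suc per by blast
    then show ?case by (simp add: algebra_simps)
  qed (use ab in simp)
  then have "d (a + n * (b + 1))" .
  \<comment> \<open>\<open>b + 1\<close> periods after \<open>a\<close> is certainly later than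
    \<open>b\<close>.\<close>
  moreover have "b < a + n * (b + 1)" using mult_le_mono1[of 1 n "b + 1"] n by simp
  ultimately show thesis using change_between[of d b] ab that by blast
qed

text \<open>In the window that starts just after a rise \<open>m\<close>, the offset
  \<open>n - 1\<close> is \<open>m\<close> one period later. So a fall occurs before it, and the
  step after it is a rise.\<close>

lemma two_changes:
  fixes d :: "nat \<Rightarrow> bool"
  assumes n: "n > 0" and per: "\<And>i. d (i + n) = d i" and ab: "d a" "\<not> d b"
  shows "2 \<le> card {i. i < n \<and> d i \<noteq> d (i + 1)}"
proof -
  obtain m where m: "\<not> d m" "d (m + 1)" using rising[of n d, OF n per ab] .
  let ?s = "\<lambda>j. d (m + 1 + j)"
  have e: "\<not> ?s (n - 1)" using per[of m] m n by simp
  have "n \<noteq> 1" using e m by (auto)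
  then obtain j where j: "j < n - 1" "?s j" "\<not> ?s (j + 1)"
    using change_between[of "\<lambda>x. \<not> ?s x" 0 "n - 1"] m e n by auto
  have "card {j, n - 1} \<le> card {i. i < n \<and> d i \<noteq> d (i + 1)}"
  proof (rule changes_shift[where a = "m + 1" and d = d and n = n, OF n per])
    show "{j, n - 1} \<subseteq> {..<n}" using j n by auto
    fix x assume "x \<in> {j, n - 1}"
    then show "d (m + 1 + x) \<noteq> d (m + 1 + x + 1)" using j e per[of "m + 1"] m n by (auto simp: algebra_simps)
  qed
  then show ?thesis using j by simp
qed

text \<open>Start just after a rise, with the first false value at offset \<open>k\<close>. If a
  true value returned within the period, the offsets \<open>k - 1\<close>, \<open>x\<close>,
  \<open>y\<close>, \<open>n - 1\<close> would be four changes: fall, rise, fall, rise.\<close>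

lemma few_changes:
  fixes d :: "nat \<Rightarrow> bool"
  assumes n: "n > 0" and per: "\<And>i. d (i + n) = d i" and c: "card {i. i < n \<and> d i \<noteq> d (i + 1)} \<le> 3"
  shows "\<exists>a k. k \<le> n \<and> (\<forall>j<k. d (a + j)) \<and> (\<forall>j. k \<le> j \<and> j < n \<longrightarrow> \<not> d (a + j))"
proof (cases "(\<forall>i. d i) \<or> (\<forall>i. \<not> d i)")
  case True
  then show ?thesis
  proof
    assume "\<forall>i. d i" then show ?thesis by (intro exI[of _ 0] exI[of _ n]) auto
  next
    assume "\<forall>i. \<not> d i" then show ?thesis by (intro exI[of _ 0] exI[of _ 0]) auto
  qed
next
  case False
  then obtain a b where "d a" "\<not> d b" by blast
  then obtain m where m: "\<not> d m" "d (m + 1)" using rising[of n d, OF n per] by metis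
  define s where "s j = d (m + 1 + j)" for j
  have s0: "s 0" "\<not> s (n - 1)" "s n" using per[of m] per[of "m + 1"] m n by (simp_all add: s_def)
  define k where "k = (LEAST k. \<not> s k)"
  have k: "\<not> s k" "k \<le> n - 1" "\<And>j. j < k \<Longrightarrow> s j"
  proof -
    show "\<not> s k" unfolding k_def by (rule LeastI[of "\<lambda>k. \<not> s k", OF s0(2)])
    show "k \<le> n - 1" unfolding k_def by (rule Least_le[of "\<lambda>k. \<not> s k", OF s0(2)])
    show "s j" if "j < k" for j using not_less_Least[of j "\<lambda>k. \<not> s k"] that unfolding k_def by blast
  qed
  have k0: "k > 0" using k(1) s0(1) by (cases k) auto
  have "\<not> s l" if l: "k \<le> l" "l < n" for l
  proof
    assume sl: "s l"
    then have "k < l" using l k by (cases "k = l") auto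
    then obtain x where x: "k \<le> x" "x < l" "\<not> s x" "s (x + 1)" using change_between[of s k l] k sl by blast
    have "l < n - 1" using sl s0(2) l by (cases "l = n - 1") auto
    then obtain y where y: "l \<le> y" "y < n - 1" "s y" "\<not> s (y + 1)" using change_between[of "\<lambda>x. \<not> s x" l "n - 1"] sl s0 by auto
    have "card {k - 1, x, y, n - 1} \<le> card {i. i < n \<and> d i \<noteq> d (i + 1)}"
    proof (rule changes_shift[where a = "m + 1" and d = d and n = n, OF n per])
      show "{k - 1, x, y, n - 1} \<subseteq> {..<n}" using k x y l n by auto
      fix j assume "j \<in> {k - 1, x, y, n - 1}"
      then have "s j \<noteq> s (j + 1)" using k k0 x y s0 n by auto
      then show "d (m + 1 + j) \<noteq> d (m + 1 + j + 1)" by (simp add: s_def add.assoc)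
    qed
    moreover have "k - 1 < x" "x < y" "y < n - 1" using k0 x y by auto
    then have "card {k - 1, x, y, n - 1} = 4" by (simp add: card_insert_if)
    ultimately show False using c by simp
  qed
  then show ?thesis using k n unfolding s_def by (intro exI[of _ "m + 1"] exI[of _ k]) auto
qed

section \<open>The tangent indicatrix\<close>

lemma vtx_mod: "vtx v n (i mod int n + k) = vtx v n (i + k)"
  by (simp add: vtx_def mod_add_left_eq)

lemma tang_mod: "tang v n (i mod int n + k) = tang v n (i + k)"
  using vtx_mod[of v n i k] vtx_mod[of v n i "k + 1"] by (simp add: tang_def add.assoc)

lemma tang_period: "tang v n (i + int n) = tang v n i"
  using tang_mod[of v n "i + int n" 0] tang_mod[of v n i 0] by simp

definition tangents :: "(nat \<Rightarrow> real^3) \<Rightarrow> nat \<Rightarrow> (real^3) list" where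
  "tangents v n = map (\<lambda>j. tang v n (int j)) [0..<n]"

lemma rotated_tangents: "rotated (tangents v n) (map (\<lambda>j. tang v n (int i + int j)) [0..<n])"
proof -
  have "rotate i (tangents v n) = map (\<lambda>j. tang v n (int i + int j)) [0..<n]"
  proof (rule nth_equalityI)
    fix j assume "j < length (rotate i (tangents v n))"
    then have j: "j < n" by (simp add: tangents_def)
    have "rotate i (tangents v n) ! j = tang v n (int ((i + j) mod n))"
      using j by (simp add: tangents_def nth_rotate)
    also have "\<dots> = tang v n (int i + int j)" using tang_mod[of v n "int (i + j)" 0] by (simp add: zmod_int)
    finally show "rotate i (tangents v n) ! j = map (\<lambda>j. tang v n (int i + int j)) [0..<n] ! j" using j by simp
  qed (simp add: tangents_def)
  then show ?thesis unfolding rotated_def by metis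
qed

lemma corner_tangents:
  assumes "n \<ge> 3" shows "corner (tangents v n) (tang v n (int i - 1)) (tang v n (int i)) (tang v n (int i + 1))"
proof -
  have e: "[0..<n] = 0 # 1 # 2 # [3..<n]" using assms by (simp add: upt_conv_Cons eval_nat_numeral)
  \<comment> \<open>Congruent to \<open>i - 1\<close> modulo \<open>n\<close>, and a natural number
    even for \<open>i = 0\<close>.\<close>
  define m where "m = i + n - 1"
  have "rotated (tangents v n) (map (\<lambda>j. tang v n (int m + int j)) [0..<n])" by (rule rotated_tangents)
  then have c: "corner (tangents v n) (tang v n (int m)) (tang v n (int m + 1)) (tang v n (int m + 2))"
    unfolding corner_def e by auto
  have "int m = (int i - 1) + int n" using assms by (simp add: m_def)
  then have "int m + k = (int i - 1 + k) + int n" for k by simp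
  then have t: "tang v n (int m + k) = tang v n (int i - 1 + k)" for k by (simp only: tang_period)
  have tt: "tang v n (int m) = tang v n (int i - 1)" "tang v n (int m + 1) = tang v n (int i)" "tang v n (int m + 2) = tang v n (int i + 1)"
    using t[of 0] t[of 1] t[of 2] by (simp_all add: algebra_simps)
  show ?thesis using c unfolding tt .
qed

lemma path_edges_upt: "path_edges (map f [0..<Suc m]) = (\<lambda>j. (f j, f (Suc j))) ` {..<m}"
proof (induction m)
  case (Suc m)
  have "path_edges (map f [0..<Suc (Suc m)]) = insert (f m, f (Suc m)) (path_edges (map f [0..<Suc m]))"
    using path_edges_snoc[of "map f [0..<Suc m]" "f (Suc m)"] by simp
  also have "\<dots> = (\<lambda>j. (f j, f (Suc j))) ` {..<Suc m}" unfolding Suc lessThan_Suc by simp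
  finally show ?case .
qed simp

text \<open>Edges are indexed by their end points, as in
  \<open>parallel_same_orient\<close>.\<close>

lemma edges_tangents:
  assumes "n > 0"
  shows "edges (tangents v n) = (\<lambda>i. (tang v n (int i - 1), tang v n (int i))) ` {..<n}"
proof -
  let ?f = "\<lambda>j. tang v n (int j)"
  have "hd (tangents v n) = ?f 0" using assms by (simp add: tangents_def upt_conv_Cons)
  also have "\<dots> = ?f n" using tang_period[of v n 0] by simp
  finally have "closed_path (tangents v n) = map ?f [0..<Suc n]" by (simp add: closed_path_def tangents_def)
  then have e: "edges (tangents v n) = (\<lambda>j. (?f j, ?f (Suc j))) ` {..<n}" unfolding edges_def by (simp only: path_edges_upt)
  have 1: "(?f j, ?f (Suc j)) \<in> (\<lambda>i. (tang v n (int i - 1), tang v n (int i))) ` {..<n}" if "j < n" for j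
  proof (cases "Suc j = n")
    case True
    have "int j = -1 + int n" using True by linarith
    then have "tang v n (int j) = tang v n (int 0 - 1)" using tang_period[of v n "-1"] by simp
    moreover have "?f (Suc j) = tang v n (int 0)" using tang_period[of v n 0] True by simp
    ultimately show ?thesis using assms by (intro image_eqI[of _ _ 0]) auto
  next
    case False
    then show ?thesis using that by (intro image_eqI[of _ _ "Suc j"]) auto
  qed
  have 2: "(tang v n (int i - 1), tang v n (int i)) \<in> (\<lambda>j. (?f j, ?f (Suc j))) ` {..<n}" if "i < n" for i
  proof (cases i)
    case 0
    have "int (n - 1) = -1 + int n" using assms by linarith
    then have "tang v n (-1) = ?f (n - 1)" using tang_period[of v n "-1"] by simp
    moreover have "tang v n 0 = ?f (Suc (n - 1))" using tang_period[of v n 0] assms by simp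
    ultimately show ?thesis using assms 0 by (intro image_eqI[of _ _ "n - 1"]) auto
  next
    case (Suc j)
    then show ?thesis using that by (intro image_eqI[of _ _ j]) auto
  qed
  show ?thesis unfolding e using 1 2 by blast
qed

lemma det3_zero_coplanar: assumes "det3 a b c = 0" shows "coplanar {0, a, b, c}"
proof (cases "cross3 a b = 0")
  case False
  define w where "w = cross3 a b"
  have D: "det3 a b w \<noteq> 0" using False by (simp add: det3_def w_def)
  \<comment> \<open>Cramer's rule in the basis \<open>a\<close>, \<open>b\<close>, \<open>w\<close>:
    the coefficient of \<open>w\<close> is \<open>det3 a b c\<close>, which vanishes.\<close>
  have "det3 a b w *\<^sub>R c = det3 c b w *\<^sub>R a + det3 a c w *\<^sub>R b" using cramer[of a b w c] assms by simp
  then have "c = (1 / det3 a b w) *\<^sub>R (det3 c b w *\<^sub>R a + det3 a c w *\<^sub>R b)" using D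
    by (metis divide_inverse mult_1 real_vector.scale_scale scaleR_one left_inverse scaleR_left_imp_eq inverse_eq_divide)
  then obtain x y where c: "c = x *\<^sub>R a + y *\<^sub>R b" by (simp add: scaleR_add_right)
  have "{0, a, b, c} \<subseteq> affine hull {0, a, b}"
  proof -
    have "c \<in> affine hull {0, a, b}" unfolding affine_hull_3 c
      by (intro CollectI exI[of _ "1 - x - y"] exI[of _ x] exI[of _ y]) simp
    then show ?thesis using hull_subset[of "{0,a,b}" affine] by auto
  qed
  then show ?thesis unfolding coplanar_def by blast
next
  case True
  then have "collinear {0, a, b}" by (simp add: cross_eq_0)
  then consider "a = 0" | "b = 0" | t where "b = t *\<^sub>R a" unfolding collinear_lemma by blast
  then show ?thesis
  proof cases
    case 1
    then have "{0,a,b,c} \<subseteq> affine hull {0,b,c}" using hull_subset[of "{0,b,c}" affine] by auto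
    then show ?thesis unfolding coplanar_def by blast
  next
    case 2
    then have "{0,a,b,c} \<subseteq> affine hull {0,a,c}" using hull_subset[of "{0,a,c}" affine] by auto
    then show ?thesis unfolding coplanar_def by blast
  next
    case 3
    have "b \<in> affine hull {0, a, c}" unfolding affine_hull_3 3
      by (intro CollectI exI[of _ "1 - t"] exI[of _ t] exI[of _ 0]) simp
    then have "{0,a,b,c} \<subseteq> affine hull {0,a,c}" using hull_subset[of "{0,a,c}" affine] by auto
    then show ?thesis unfolding coplanar_def by blast
  qed
qed

text \<open>Distinctness is a consequence of general position too: two equal tangents would be
  coplanar with any third.\<close>

lemma polygon_tangents:
  assumes n: "n \<ge> 6" and adm: "admissible_polygon v n"
  shows "polygon (tangents v n)"
proof -
  let ?U = "\<lambda>i. tang v n (int i)"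
  have cop: "det3 (?U i) (?U j) (?U k) \<noteq> 0" if "i < n" "j < n" "k < n" "i \<noteq> j" "j \<noteq> k" "i \<noteq> k" for i j k
    using det3_zero_coplanar adm that unfolding admissible_polygon_def by blast
  have inj: "inj_on ?U {0..<n}"
  proof (rule inj_onI, rule ccontr)
    fix i j assume ij: "i \<in> {0..<n}" "j \<in> {0..<n}" "?U i = ?U j" "i \<noteq> j"
    have "card {i,j} < card {0..<n}" using n by (simp add: card_insert_if)
    then obtain k where "k \<in> {0..<n}" "k \<notin> {i,j}" by (metis card_mono finite_atLeastLessThan finite.emptyI finite_insert not_le subsetI)
    then have "det3 (?U i) (?U j) (?U k) \<noteq> 0" using ij(1,2,4) by (intro cop) auto
    moreover have "det3 (?U i) (?U j) (?U k) = 0" unfolding ij(3) by simp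
    ultimately show False by simp
  qed
  have "generic (set (tangents v n))" unfolding generic_def
  proof (intro ballI impI)
    fix a b c assume abc: "a \<in> set (tangents v n)" "b \<in> set (tangents v n)" "c \<in> set (tangents v n)" "a \<noteq> b \<and> b \<noteq> c \<and> a \<noteq> c"
    then obtain i j k where "a = ?U i" "b = ?U j" "c = ?U k" "i < n" "j < n" "k < n" by (auto simp: tangents_def)
    then show "det3 a b c \<noteq> 0" using cop[of i j k] abc(4) by auto
  qed
  then show ?thesis using n inj by (simp add: polygon_def tangents_def distinct_map)
qed

lemma edge_vector:
  assumes adm: "admissible_polygon v n" and n: "n > 0"
  obtains c where "c > 0" "vtx v n (i + 1) - vtx v n i = c *\<^sub>R tang v n i"
proof -
  define m where "m = nat (i mod int n)"
  have m: "m < n" "int m = i mod int n" using n by (auto simp: m_def nat_less_iff)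
  have "vtx v n (int m + 1) \<noteq> vtx v n (int m)" using adm m(1) unfolding admissible_polygon_def by blast
  then have "vtx v n (i + 1) \<noteq> vtx v n i" unfolding m(2) using vtx_mod[of v n i 1] vtx_mod[of v n i 0] by simp
  then show thesis using that[of "norm (vtx v n (i + 1) - vtx v n i)"] by (simp add: tang_def sgn_div_norm)
qed

lemma tangents_not_hemispheric:
  assumes adm: "admissible_polygon v n" and n: "n > 0"
  shows "\<not> hemispheric (set (tangents v n))"
proof
  assume "hemispheric (set (tangents v n))"
  then obtain h where "\<forall>z\<in>set (tangents v n). h \<bullet> z > 0" by (auto simp: hemispheric_def)
  then have h: "h \<bullet> tang v n (int i) > 0" if "i < n" for i using that by (simp add: tangents_def)
  have "h \<bullet> (vtx v n (int i + 1) - vtx v n (int i)) > 0" if i: "i < n" for i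
  proof -
    obtain c where "c > 0" "vtx v n (int i + 1) - vtx v n (int i) = c *\<^sub>R tang v n (int i)" using edge_vector[OF adm n] by metis
    then show ?thesis using h[OF i] by simp
  qed
  then have "(\<Sum>i<n. h \<bullet> (vtx v n (int i + 1) - vtx v n (int i))) > 0" using n by (intro sum_pos) auto
  also have "(\<Sum>i<n. h \<bullet> (vtx v n (int i + 1) - vtx v n (int i))) = (\<Sum>i<n. h \<bullet> vtx v n (int (Suc i)) - h \<bullet> vtx v n (int i))"
    by (simp add: inner_diff_right add.commute)
  also have "\<dots> = h \<bullet> vtx v n (int n) - h \<bullet> vtx v n (int 0)" by (rule sum_lessThan_telescope)
  also have "\<dots> = 0" by (simp add: vtx_def)
  finally show False by simp
qed

text \<open>The plane of the three vertices has a normal that is a positive multiple of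
  \<open>cross3 ?b ?c\<close>. Relative to it, the preceding vertex lies in direction
  \<open>- ?a\<close> and the following one in direction \<open>?d\<close>, so the minus sign makes
  opposite turns correspond to equal sides.\<close>

lemma flattening_if_change:
  assumes n: "n \<ge> 6" and adm: "admissible_polygon v n"
    and ch: "ccw (tang v n (int i - 1)) (tang v n (int i)) (tang v n (int i + 1)) \<noteq>
      ccw (tang v n (int i)) (tang v n (int i + 1)) (tang v n (int i + 2))"
  shows "flattening v n (int i)"
proof -
  have n0: "n > 0" using n by simp
  let ?a = "tang v n (int i - 1)" and ?b = "tang v n (int i)" and ?c = "tang v n (int i + 1)" and ?d = "tang v n (int i + 2)"
  obtain p where p: "p > 0" "vtx v n (int i) - vtx v n (int i - 1) = p *\<^sub>R ?a" using edge_vector[OF adm n0, of "int i - 1"] by auto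
  obtain q where q: "q > 0" "vtx v n (int i + 1) - vtx v n (int i) = q *\<^sub>R ?b" using edge_vector[OF adm n0, of "int i"] by auto
  obtain r where r: "r > 0" "vtx v n (int i + 2) - vtx v n (int i + 1) = r *\<^sub>R ?c" using edge_vector[OF adm n0, of "int i + 1"] by (auto simp: add.assoc)
  obtain s where s: "s > 0" "vtx v n (int i + 3) - vtx v n (int i + 2) = s *\<^sub>R ?d" using edge_vector[OF adm n0, of "int i + 2"] by (auto simp: add.assoc)
  have 1: "vtx v n (int i + 2) - vtx v n (int i) = q *\<^sub>R ?b + r *\<^sub>R ?c" using q(2) r(2) by (simp add: algebra_simps)
  have 2: "vtx v n (int i - 1) - vtx v n (int i) = - (p *\<^sub>R ?a)" using p(2) by (simp add: algebra_simps)
  have 3: "vtx v n (int i + 3) - vtx v n (int i) = q *\<^sub>R ?b + r *\<^sub>R ?c + s *\<^sub>R ?d" using q(2) r(2) s(2) by (simp add: algebra_simps)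
  have P: "polygon (tangents v n)" using polygon_tangents[OF n adm] .
  have nz: "det3 ?a ?b ?c \<noteq> 0" "det3 ?b ?c ?d \<noteq> 0"
  proof -
    have n3: "n \<ge> 3" using n by simp
    have c: "corner (tangents v n) ?a ?b ?c" "corner (tangents v n) ?b ?c ?d"
      using corner_tangents[OF n3, of v i] corner_tangents[OF n3, of v "Suc i"] by (simp_all add: algebra_simps)
    have g: "generic (set (tangents v n))" "distinct (tangents v n)" using P by (simp_all add: polygon_def)
    show "det3 ?a ?b ?c \<noteq> 0" "det3 ?b ?c ?d \<noteq> 0"
      using generic_det3[OF g(1)] corner_set[OF c(1)] corner_set[OF c(2)] corner_distinct[OF g(2) c(1)] corner_distinct[OF g(2) c(2)] by auto
  qed
  have neg: "det3 ?a ?b ?c * det3 ?b ?c ?d < 0" using ch nz unfolding ccw_def by (auto simp: mult_less_0_iff)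
  let ?N = "cross3 (q *\<^sub>R ?b) (q *\<^sub>R ?b + r *\<^sub>R ?c)"
  have N: "?N \<bullet> z = q * r * det3 ?b ?c z" for z
    using det3_expand[of "q *\<^sub>R ?b" "q *\<^sub>R ?b + r *\<^sub>R ?c" z] unfolding det3_def[symmetric] by (simp add: det3_expand algebra_simps)
  have "det3 ?b ?c ?a = det3 ?a ?b ?c" by (rule det3_cyc)
  then have Na: "?N \<bullet> (- (p *\<^sub>R ?a)) = - (p * q * r * det3 ?a ?b ?c)" by (simp add: N)
  have Nd: "?N \<bullet> (q *\<^sub>R ?b + r *\<^sub>R ?c + s *\<^sub>R ?d) = q * r * s * det3 ?b ?c ?d"
    unfolding N by (simp add: det3_expand algebra_simps)
  have "(?N \<bullet> (- (p *\<^sub>R ?a))) * (?N \<bullet> (q *\<^sub>R ?b + r *\<^sub>R ?c + s *\<^sub>R ?d)) = (p * q * q * r * r * s) * (- (det3 ?a ?b ?c * det3 ?b ?c ?d))"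
    unfolding Na Nd by (simp add: algebra_simps)
  also have "\<dots> > 0" using neg p q r s by (intro mult_pos_pos) auto
  finally show ?thesis unfolding flattening_def Let_def q(2) 1 2 3 .
qed

lemma parallel_if_crosses:
  assumes g: "generic S" "a \<in> S" "b \<in> S" "c \<in> S" "d \<in> S" and X: "crosses a b c d"
  shows "sph_arc a b \<inter> sph_arc c d \<noteq> {}"
proof -
  obtain p q r t where pos: "p > 0" "q > 0" "r > 0" "t > 0" and eq: "p *\<^sub>R a + q *\<^sub>R b = r *\<^sub>R c + t *\<^sub>R d"
    using crosses_elim[OF g X] by metis
  have arc: "sgn (x *\<^sub>R u + y *\<^sub>R w) \<in> sph_arc u w" if xy: "x > 0" "y > 0" for x y :: real and u w :: "real^3"
  proof -
    have "x *\<^sub>R u + y *\<^sub>R w = (x + y) *\<^sub>R ((1 - y / (x + y)) *\<^sub>R u + (y / (x + y)) *\<^sub>R w)"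
      using xy by (simp add: scaleR_add_right right_diff_distrib)
    then have "sgn (x *\<^sub>R u + y *\<^sub>R w) = sgn ((1 - y / (x + y)) *\<^sub>R u + (y / (x + y)) *\<^sub>R w)"
      using xy by (simp add: sgn_scaleR)
    then show ?thesis using xy unfolding sph_arc_def by (intro image_eqI[of _ _ "y / (x + y)"]) auto
  qed
  show ?thesis using arc[OF pos(1,2), of a b] arc[OF pos(3,4), of c d] eq by auto
qed

theorem theorem16:
  fixes v :: "nat \<Rightarrow> real^3" and n :: nat
  assumes "n \<ge> 6"
    and "admissible_polygon v n"
  shows "2 * T_plus v n + num_flattenings v n \<ge> 4"
proof (rule ccontr)
  assume "\<not> ?thesis"
  then have small: "2 * T_plus v n + num_flattenings v n \<le> 3" by simp
  have n: "n > 0" "n \<ge> 3" using assms by auto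
  let ?zs = "tangents v n"
  let ?U = "tang v n"
  have P: "polygon ?zs" using polygon_tangents[OF assms] .
  have g: "generic (set ?zs)" using P by (simp add: polygon_def)
  have nb: "\<not> hemispheric (set ?zs)" using tangents_not_hemispheric[OF assms(2) n(1)] .
  have E: "edges ?zs = (\<lambda>i. (?U (int i - 1), ?U (int i))) ` {..<n}" using edges_tangents[OF n(1)] .
  define d where "d i = ccw (?U (int i - 1)) (?U (int i)) (?U (int i + 1))" for i :: nat
  have per: "d (i + n) = d i" for i
    using tang_period[of v n "int i - 1"] tang_period[of v n "int i"] tang_period[of v n "int i + 1"]
    by (simp add: d_def algebra_simps)
  have posd: "left_turn ?zs (?U (int i)) = d i" for i using left_turn_corner[OF P corner_tangents[OF n(2)]] by (simp add: d_def)
  have "{i. i < n \<and> d i \<noteq> d (i + 1)} \<subseteq> {i. i < n \<and> flattening v n (int i)}"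
    using flattening_if_change[OF assms] by (auto simp: d_def algebra_simps)
  then have F: "card {i. i < n \<and> d i \<noteq> d (i + 1)} \<le> num_flattenings v n"
    unfolding num_flattenings_def by (intro card_mono) auto
  \<comment> \<open>All crossings of edges, neighbours included: edges that share a vertex never
    cross, so the exclusions in \<open>T_plus\<close> cost nothing.\<close>
  define K where "K = {(i,j). i < j \<and> j < n \<and> crosses (?U (int i - 1)) (?U (int i)) (?U (int j - 1)) (?U (int j))}"
  have memU: "?U (int i - 1) \<in> set ?zs \<and> ?U (int i) \<in> set ?zs" if "i < n" for i
    using edges_set[of "?U (int i - 1)" "?U (int i)" ?zs] E that by auto
  let ?T = "{(i, j). i < j \<and> j < n \<and> j \<noteq> i + 1 \<and> \<not> (i = 0 \<and> j = n - 1) \<and> parallel_same_orient v n i j}"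
  have KT: "K \<subseteq> ?T"
  proof
    fix x assume "x \<in> K"
    then obtain i j where x: "x = (i,j)" and ij: "i < j" "j < n" and X: "crosses (?U (int i - 1)) (?U (int i)) (?U (int j - 1)) (?U (int j))"
      by (auto simp: K_def)
    have "j \<noteq> i + 1" using X by auto
    moreover have "\<not> (i = 0 \<and> j = n - 1)"
    proof
      assume "i = 0 \<and> j = n - 1"
      then have "int i - 1 = -1" "int j = -1 + int n" using n by linarith+
      then have "?U (int i - 1) = ?U (int j)" using tang_period[of v n "-1"] by simp
      then show False using X by (simp add: crosses_def)
    qed
    moreover have "parallel_same_orient v n i j"
      unfolding parallel_same_orient_def using parallel_if_crosses[OF g _ _ _ _ X] memU[of i] memU[of j] ij by auto
    ultimately show "x \<in> ?T" using x ij by simp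
  qed
  have finT: "finite ?T" by (rule finite_subset[of _ "{..<n} \<times> {..<n}"]) auto
  have cK: "card K \<le> T_plus v n" unfolding T_plus_def using card_mono[OF finT KT] .
  have finK: "finite K" using finite_subset[OF KT finT] .
  have Kcase: "(i,j) \<in> K \<or> (j,i) \<in> K" if "i < n" "j < n" "crosses (?U (int i - 1)) (?U (int i)) (?U (int j - 1)) (?U (int j))" for i j
  proof -
    have "i \<noteq> j" using that(3) by auto
    moreover have "crosses (?U (int j - 1)) (?U (int j)) (?U (int i - 1)) (?U (int i))"
      using that crosses_sym(3)[OF g] memU by blast
    ultimately show ?thesis using that unfolding K_def by (cases "i < j") auto
  qed
  show False
  proof (cases "K = {}")
    case True
    have "simple ?zs" unfolding simple_def E using Kcase True by fastforce
    moreover have "two_blocks ?zs"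
    proof -
      have "card {i. i < n \<and> d i \<noteq> d (i + 1)} \<le> 3" using F small by linarith
      then obtain a k where k: "k \<le> n" "\<forall>j<k. d (a + j)" "\<forall>j. k \<le> j \<and> j < n \<longrightarrow> \<not> d (a + j)" using few_changes[of n d, OF n(1) per] by blast
      let ?f = "\<lambda>j. ?U (int a + int j)"
      have "[0..<n] = [0..<k] @ [k..<n]" using k(1) upt_add_eq_append[of 0 k "n - k"] by simp
      then have "rotated ?zs (map ?f [0..<k] @ map ?f [k..<n])" using rotated_tangents[of v n a] by simp
      moreover have "left_turn ?zs (?f j) = d (a + j)" for j using posd[of "a + j"] by simp
      ultimately show ?thesis unfolding two_blocks_def using k by (intro exI[of _ "map ?f [0..<k]"] exI[of _ "map ?f [k..<n]"]) auto
    qed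
    ultimately show False using simple_two_blocks_hemispheric P nb by blast
  next
    case False
    then have "card K \<ge> 1" using finK by (simp add: Suc_leI card_gt_0_iff)
    \<comment> \<open>One crossing uses up two of the three, so at most one flattening is
      left.\<close>
    then have T1: "T_plus v n = 1" "num_flattenings v n \<le> 1" and K1: "card K = 1" using cK small by auto
    obtain x where "K = {x}" using K1 card_1_singletonE by blast
    then obtain i j where Kij: "K = {(i,j)}" by (cases x) auto
    then have ij: "i < j" "j < n" and X: "crosses (?U (int i - 1)) (?U (int i)) (?U (int j - 1)) (?U (int j))" by (auto simp: K_def)
    have e: "(?U (int i - 1), ?U (int i)) \<in> edges ?zs" "(?U (int j - 1), ?U (int j)) \<in> edges ?zs" using ij E by auto
    have only: "(a,b) = (?U (int i - 1), ?U (int i)) \<and> (c,e) = (?U (int j - 1), ?U (int j)) \<or>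
        (a,b) = (?U (int j - 1), ?U (int j)) \<and> (c,e) = (?U (int i - 1), ?U (int i))"
      if ab: "(a,b) \<in> edges ?zs" "(c,e) \<in> edges ?zs" "crosses a b c e" for a b c e
    proof -
      obtain k l where kl: "k < n" "l < n" "(a,b) = (?U (int k - 1), ?U (int k))" "(c,e) = (?U (int l - 1), ?U (int l))"
        using ab(1,2) unfolding E by auto
      then have "(k,l) \<in> K \<or> (l,k) \<in> K" using Kcase[of k l] ab(3) by auto
      then show ?thesis using Kij kl by auto
    qed
    \<comment> \<open>A change never occurs alone around a cycle.\<close>
    have "(\<forall>i. d i) \<or> (\<forall>i. \<not> d i)" using two_changes[of n d, OF n(1) per] F T1 by fastforce
    then show False
    proof
      assume "\<forall>i. d i"
      then have "\<forall>z\<in>set ?zs. left_turn ?zs z" using posd by (auto simp: tangents_def)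
      then show False using one_crossing[OF P _ e X only] nb by blast
    next
      assume "\<forall>i. \<not> d i"
      then have "\<forall>z\<in>set ?zs. \<not> left_turn ?zs z" using posd by (auto simp: tangents_def)
      then show False using one_crossing_neg[OF P _ e X only] nb by blast
    qed
  qed
qed

end
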